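(* Let $(y_h^m,u_h,p_h^m)\in V_h^m\times U_{adh}\times V_h^m$ satisfy the discrete system $$a_h(y_h^m,w_h^m)=l_h[f+Bu_h,\phi](w_h^m)\ \ \forall w_h^m\in V_h^m,\qquad a_h(q_h^m,p_h^m)=l_h[g'(y_h^m),0](q_h^m)\ \ \forall q_h^m\in V_h^m,$$ $$(j'(u_h)+B^*p_h^m,v_h-u_h)\ge 0\ \ \forall v_h\in U_{adh}.$$ Given an initial guess $u_{h0}\in U_{adh}$ and step sizes $\rho_n>0$ ($n\in\mathbb{N}$), let $\{(u_{hn},y_{hn}^m,p_{hn}^m)\}_{n=0}^\infty$ be the sequence generated by the projected gradient iteration $$a_h(y_{hn}^m,w_h^m)=l_h[f+Bu_{hn},\phi](w_h^m)\ \ \forall w_h^m\in V_h^m,\qquad a_h(q_h^m,p_{hn}^m)=l_h[g'(y_{hn}^m),0](q_h^m)\ \ \forall q_h^m\in V_h^m,$$ $$u_{h,n+1}=Pr_{U_{adh}}\big(u_{hn}-\rho_n(j'(u_{hn})+B^*p_{hn}^m)\big),$$ with $y_{hn}^m,p_{hn}^m\in V_h^m$. Suppose that the integral-form assumption and the strong convexity/Lipschitz assumption on $g,j$ (both stated in the context) hold. Then $\{\rho_n\}_{n=0}^\infty$ can be chosen such that there exist constants $0<\eta<1$ and $\lambda=\lambda(\eta)>0$ satisfying, for all $n$, $$\|u_{hn}-u_h\|_{L^2}+\lambda|||y_{hn}^m-y_h^m|||_{\mathrm{DG}}+\lambda|||p_{hn}^m-p_h^m|||_{\mathrm{DG}}\le\eta^n\big(\|u_{h0}-u_h\|_{L^2}+\lambda|||y_{h0}^m-y_h^m|||_{\mathrm{DG}}+\lambda|||p_{h0}^m-p_h^m|||_{\mathrm{DG}}\big).$$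 In particular $(u_{hn},y_{hn}^m,p_{hn}^m)$ converges to $(u_h,y_h^m,p_h^m)$ linearly.
   Context: **Control problem data.** Let $d\in\{2,3\}$, let $\Omega,\Omega_u\subset\mathbb{R}^d$ be convex polygonal/polyhedral domains, $U=L^2(\Omega_u)$, and $U_{ad}\subset U$ closed and convex. $A=(a_{ij}(x))\in (W^{1,\infty}(\Omega))^{d\times d}$ is symmetric with $\lambda_0\|\xi\|^2\le \xi^TA(x)\xi\le\Lambda\|\xi\|^2$ for all $\xi\in\mathbb{R}^d$, $x\in\Omega$, for constants $0<\lambda_0<\Lambda$. $f\in L^2(\Omega)$, $\phi\in H^{3/2}(\partial\Omega)$, $B:L^2(\Omega_u)\to L^2(\Omega)$ is bounded linear with adjoint $B^*$. $g:L^2(\Omega)\to\mathbb{R}$ and $j:U\to\mathbb{R}$ are convex, continuously Fréchet differentiable. (The discrete system approximates the optimality conditions of minimizing $g(y)+j(u)$ over $u\in U_{ad}$ subject to $-\nabla\cdot(A\nabla y)=f+Bu$ in $\Omega$, $y=\phi$ on $\partial\Omega$.) Here $(\cdot,\cdot)$ and $\|\cdot\|_{L^2}$ are the $L^2$ inner product and norm on $\Omega$ or $\Omega_u$ according to the arguments. **Integral-form assumption.** $j(u)=\int_{\Omega_u}\tilde j(u)\,dx$, $g(y)=\int_\Omega\tilde g(y)\,dx$ (the integrand may depend on $x$, e.g. through given targets), with $j'(u)(v)=\int_{\Omega_u}\tilde j'(u)v\,dx$, $g'(y)(w)=\int_\Omega\tilde g'(y)w\,dx$ for all $u,v\in U$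 and $y,w\in L^2(\Omega)$. One identifies $j'(u)$ with the function $\tilde j'(u)$ and $g'(y)$ with $\tilde g'(y)$. **Strong convexity/Lipschitz assumption.** There are positive constants $\alpha,\beta,L$ such that for all $u,\tilde u\in U_{ad}$, $y,\tilde y\in L^2(\Omega)$: $\alpha\|u-\tilde u\|_{L^2}^2\le(j'(u)-j'(\tilde u),u-\tilde u)$, $\beta\|y-\tilde y\|_{L^2}^2\le(g'(y)-g'(\tilde y),y-\tilde y)$, $\|j'(u)-j'(\tilde u)\|_{L^2}\le L\|u-\tilde u\|_{L^2}$, $\|g'(y)-g'(\tilde y)\|_{L^2}\le L\|y-\tilde y\|_{L^2}$. **Meshes and reconstructed space.** $\mathcal{T}_h$ is a quasi-uniform triangulation of $\Omega$ of mesh size $h$; $\mathcal{E}_h^I$, $\mathcal{E}_h^B$ are its interior and boundary $(d-1)$-dimensional faces, $\mathcal{E}_h=\mathcal{E}_h^I\cup\mathcal{E}_h^B$; $h_e$ is the size of $e\in\mathcal{E}_h$. Let $m\ge1$. For $K\in\mathcal{T}_h$ the patch $S(K)$ is built recursively: $S_0(K)=\{K\}$, $S_t(K)=\bigcup_{K'\in S_{t-1}(K)}N(K')$ with $N(K)=\{K'\in\mathcal{T}_h:\exists e\in\mathcal{E}_h,\ e\subset\partial K'\cap\partial K\}$, stopping at the first $t$ with $\#S_t(K)\ge\#S$ for a prescribed threshold $\#S$ independent of $K$; $S(K)=S_t(K)$. Let $\boldsymbol{x}_K$ be the barycenter of $K$, $I(K)=\{\boldsymbol{x}_{K'}:K'\in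 S(K)\}$, and $V_h^0$ the piecewise constants on $\mathcal{T}_h$. For $w_h\in V_h^0$, let $\mathcal{R}_K^mw_h\in\mathbb{P}_m(S(K))$ be the minimizer of $\sum_{\boldsymbol{x}\in I(K)}(p(\boldsymbol{x})-w_h(\boldsymbol{x}))^2$ over $p\in\mathbb{P}_m(S(K))$ with $p(\boldsymbol{x}_K)=w_h(\boldsymbol{x}_K)$; $\#S$ is chosen so that this problem is uniquely solvable for every $K$. Define $(\mathcal{R}^mw_h)|_K=(\mathcal{R}_K^mw_h)|_K$ and $V_h^m=\mathcal{R}^mV_h^0$. **Jumps, averages, forms, norms.** On an interior face $e$ shared by $K^\pm$ with unit outward normals $\mathbf{n}^\pm$: $[v]=v^+\mathbf{n}^++v^-\mathbf{n}^-$ for scalars, $\{\boldsymbol\tau\}=\tfrac12(\boldsymbol\tau^++\boldsymbol\tau^-)$ for vectors. On a boundary face: $[v]=v\mathbf{n}$, $\{\boldsymbol\tau\}=\boldsymbol\tau$. For $y,w\in V_h^m$ and $s\in L^2(\Omega)$, $$a_h(y,w)=\sum_{K\in\mathcal{T}_h}\int_KA\nabla y\cdot\nabla w\,dx-\sum_{e\in\mathcal{E}_h}\int_e\{A\nabla y\}\cdot[w]\,ds-\sum_{e\in\mathcal{E}_h}\int_e\{A\nabla w\}\cdot[y]\,ds+\mu\sum_{e\in\mathcal{E}_h}h_e^{-1}\int_e[y]\cdot[w]\,ds,$$ $$l_h[s,\phi](w)=\sum_{K\in\mathcal{T}_h}\int_Ksw\,dx-\sum_{e\in\mathcal{E}_h^B}\int_e\{A\nabla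 w\}\cdot\mathbf{n}_e\phi\,ds+\mu\sum_{e\in\mathcal{E}_h^B}h_e^{-1}\int_e[w]\cdot\mathbf{n}_e\phi\,ds.$$ With $\widetilde{h_e}=h_e/\mu$: $\|w\|_{\mathrm{DG}}^2=\sum_K\|\nabla w\|_{L^2(K)}^2+\sum_{e\in\mathcal{E}_h}\widetilde{h_e}^{-1}\|[w]\|_{L^2(e)}^2$ and $|||w|||_{\mathrm{DG}}^2=\|w\|_{\mathrm{DG}}^2+\sum_{e\in\mathcal{E}_h}\widetilde{h_e}\|\{\nabla w\}\|_{L^2(e)}^2$. The penalty $\mu>0$ is fixed and sufficiently large that $a_h$ is bounded and coercive on $V_h^m$ with respect to $|||\cdot|||_{\mathrm{DG}}$. **Control discretization.** $\mathcal{T}_h^u$ is a quasi-uniform mesh of $\Omega_u$ of mesh size $h_u$, $U_h$ the piecewise constant functions on $\mathcal{T}_h^u$, $U_{adh}=U_{ad}\cap U_h$. $Pr_{U_{adh}}:U\to U_{adh}$ is the $L^2$-projection onto the closed convex set $U_{adh}$. *)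

theory Defs
  imports "HOL-Analysis.Analysis"
begin

section \<open>The Hilbert space of square-integrable functions\<close>

text \<open>
  Elements are classes, modulo Lebesgue-null sets, of square-integrable functions on the whole
  space.  The space over a domain \<open>\<Omega>\<close> is the closed subspace of the classes vanishing almost
  everywhere off \<open>\<Omega>\<close> (\<open>L2_on\<close> below), so that its norm and inner product are those of \<open>\<Omega>\<close>.
\<close>

definition sq_integrable :: "('a::euclidean_space \<Rightarrow> real) \<Rightarrow> bool" where
  "sq_integrable f \<longleftrightarrow> f \<in> borel_measurable lebesgue \<and> integrable lebesgue (\<lambda>x. (f x)\<^sup>2)"

definition l2_rel :: "('a::euclidean_space \<Rightarrow> real) \<Rightarrow> ('a \<Rightarrow> real) \<Rightarrow> bool" where
  "l2_rel f g \<longleftrightarrow> sq_integrable f \<and> sq_integrable g \<and> (AE x in lebesgue. f x = g x)"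

lemma sq_integrable_0: "sq_integrable (\<lambda>x. 0)"
  by (simp add: sq_integrable_def)

lemma sq_integrable_scale: "sq_integrable f \<Longrightarrow> sq_integrable (\<lambda>x. c * f x)"
  by (auto simp: sq_integrable_def power_mult_distrib)

lemma sq_integrable_mult:
  assumes "sq_integrable f" "sq_integrable g"
  shows "integrable lebesgue (\<lambda>x. f x * g x)"
proof (rule Bochner_Integration.integrable_bound)
  show "integrable lebesgue (\<lambda>x. (f x)\<^sup>2 + (g x)\<^sup>2)"
    using assms by (auto simp: sq_integrable_def)
  show "(\<lambda>x. f x * g x) \<in> borel_measurable lebesgue"
    using assms by (auto simp: sq_integrable_def)
  have "\<bar>a * b\<bar> \<le> \<bar>a\<^sup>2 + b\<^sup>2\<bar>" for a b :: real
  proof -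
    have "2 * (\<bar>a\<bar> * \<bar>b\<bar>) \<le> a\<^sup>2 + b\<^sup>2"
      using sum_squares_bound[of "\<bar>a\<bar>" "\<bar>b\<bar>"] by (simp add: mult.assoc)
    moreover have "0 \<le> \<bar>a\<bar> * \<bar>b\<bar>" by simp
    ultimately have "\<bar>a\<bar> * \<bar>b\<bar> \<le> a\<^sup>2 + b\<^sup>2" by linarith
    then show ?thesis by (simp add: abs_mult)
  qed
  then show "AE x in lebesgue. norm (f x * g x) \<le> norm ((f x)\<^sup>2 + (g x)\<^sup>2)"
    by simp
qed

lemma sq_integrable_add:
  assumes "sq_integrable f" "sq_integrable g"
  shows "sq_integrable (\<lambda>x. f x + g x)"
proof -
  have "integrable lebesgue (\<lambda>x. (f x)\<^sup>2 + (g x)\<^sup>2 + 2 * (f x * g x))"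
    using assms sq_integrable_mult[OF assms] by (auto simp: sq_integrable_def)
  then show ?thesis
    using assms by (auto simp: sq_integrable_def power2_sum mult.assoc)
qed

quotient_type (overloaded) 'a l2 = "'a::euclidean_space \<Rightarrow> real" / partial: l2_rel
proof (rule part_equivpI)
  show "\<exists>f. l2_rel f f"
    using sq_integrable_0 by (auto simp: l2_rel_def)
  show "symp l2_rel"
    by (auto simp: l2_rel_def symp_def)
  show "transp l2_rel"
    unfolding l2_rel_def transp_def by fastforce
qed

instantiation l2 :: (euclidean_space) real_vector
begin

lift_definition zero_l2 :: "'a l2" is "\<lambda>x. 0"
  by (simp add: l2_rel_def sq_integrable_0)

lift_definition plus_l2 :: "'a l2 \<Rightarrow> 'a l2 \<Rightarrow> 'a l2" is "\<lambda>f g x. f x + g x"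
  by (auto simp: l2_rel_def sq_integrable_add)

lift_definition scaleR_l2 :: "real \<Rightarrow> 'a l2 \<Rightarrow> 'a l2" is "\<lambda>c f x. c * f x"
  by (auto simp: l2_rel_def sq_integrable_scale)

lift_definition uminus_l2 :: "'a l2 \<Rightarrow> 'a l2" is "\<lambda>f x. - f x"
  using sq_integrable_scale[of _ "-1"] by (auto simp: l2_rel_def)

lift_definition minus_l2 :: "'a l2 \<Rightarrow> 'a l2 \<Rightarrow> 'a l2" is "\<lambda>f g x. f x - g x"
proof -
  have *: "sq_integrable (\<lambda>x. f x - g x)" if "sq_integrable f" "sq_integrable g" for f g :: "'a \<Rightarrow> real"
    using sq_integrable_add[OF that(1) sq_integrable_scale[OF that(2), of "-1"]] by simp
  show "l2_rel f f' \<Longrightarrow> l2_rel g g' \<Longrightarrow> l2_rel (\<lambda>x. f x - g x) (\<lambda>x. f' x - g' x)" for f f' g g' :: "'a \<Rightarrow> real"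
    by (auto simp: l2_rel_def *)
qed

instance
proof
  fix u v w :: "'a l2" and a b r :: real
  have m: "sq_integrable (\<lambda>x. f x - g x)" if "sq_integrable f" "sq_integrable g" for f g :: "'a \<Rightarrow> real"
    using sq_integrable_add[OF that(1) sq_integrable_scale[OF that(2), of "-1"]] by simp
  have n: "sq_integrable (\<lambda>x. - f x)" if "sq_integrable f" for f :: "'a \<Rightarrow> real"
    using sq_integrable_scale[OF that, of "-1"] by simp
  note s = l2_rel_def sq_integrable_0 sq_integrable_add sq_integrable_scale m n
  show "u + v + w = u + (v + w)" by transfer (simp add: s ac_simps)
  show "u + v = v + u" by transfer (simp add: s ac_simps)
  show "0 + u = u" by transfer (simp add: s)
  show "- u + u = 0" by transfer (simp add: s)
  show "u - v = u + - v" by transfer (simp add: s)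
  show "r *\<^sub>R (u + v) = r *\<^sub>R u + r *\<^sub>R v" by transfer (simp add: s algebra_simps)
  show "(a + b) *\<^sub>R u = a *\<^sub>R u + b *\<^sub>R u" by transfer (simp add: s algebra_simps)
  show "a *\<^sub>R b *\<^sub>R u = (a * b) *\<^sub>R u" by transfer (simp add: s algebra_simps)
  show "1 *\<^sub>R u = u" by transfer (simp add: s)
qed

end

instantiation l2 :: (euclidean_space) real_inner
begin

lift_definition inner_l2 :: "'a l2 \<Rightarrow> 'a l2 \<Rightarrow> real" is "\<lambda>f g. \<integral>x. f x * g x \<partial>lebesgue"
proof -
  fix f f' g g' :: "'a \<Rightarrow> real"
  assume "l2_rel f f'" "l2_rel g g'"
  then show "(\<integral>x. f x * g x \<partial>lebesgue) = (\<integral>x. f' x * g' x \<partial>lebesgue)"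
    unfolding l2_rel_def by (intro integral_cong_AE) (auto simp: sq_integrable_def)
qed

definition norm_l2 :: "'a l2 \<Rightarrow> real" where
  "norm_l2 u = sqrt (u \<bullet> u)"
definition sgn_l2 :: "'a l2 \<Rightarrow> 'a l2" where
  "sgn_l2 u = u /\<^sub>R norm u"
definition dist_l2 :: "'a l2 \<Rightarrow> 'a l2 \<Rightarrow> real" where
  "dist_l2 u v = norm (u - v)"
definition uniformity_l2 :: "('a l2 \<times> 'a l2) filter" where
  "uniformity_l2 = (INF e\<in>{0<..}. principal {(u, v). dist u v < e})"
definition open_l2 :: "'a l2 set \<Rightarrow> bool" where
  "open_l2 U = (\<forall>u\<in>U. eventually (\<lambda>(u', v). u' = u \<longrightarrow> v \<in> U) uniformity)"

instance
proof
  fix u v w :: "'a l2" and r :: real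
  show "inner u v = inner v u" by transfer (simp add: ac_simps)
  show "inner (u + v) w = inner u w + inner v w"
  proof transfer
    fix u v w :: "'a \<Rightarrow> real"
    assume "l2_rel u u" "l2_rel v v" "l2_rel w w"
    then have "integrable lebesgue (\<lambda>x. u x * w x)" "integrable lebesgue (\<lambda>x. v x * w x)"
      by (auto simp: l2_rel_def intro: sq_integrable_mult)
    then show "(\<integral>x. (u x + v x) * w x \<partial>lebesgue) =
        (\<integral>x. u x * w x \<partial>lebesgue) + (\<integral>x. v x * w x \<partial>lebesgue)"
      by (simp add: distrib_right)
  qed
  show "inner (r *\<^sub>R u) v = r * inner u v" by transfer (simp add: mult.assoc)
  show "0 \<le> inner u u" by transfer simp
  show "inner u u = 0 \<longleftrightarrow> u = 0"
  proof transfer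
    fix u :: "'a \<Rightarrow> real"
    assume "l2_rel u u"
    then have u: "sq_integrable u" by (simp add: l2_rel_def)
    have "(\<integral>x. u x * u x \<partial>lebesgue) = 0 \<longleftrightarrow> (AE x in lebesgue. u x * u x = 0)"
      using sq_integrable_mult[OF u u] by (intro integral_nonneg_eq_0_iff_AE) auto
    then show "(\<integral>x. u x * u x \<partial>lebesgue) = 0 \<longleftrightarrow> l2_rel u (\<lambda>x. 0)"
      using u by (simp add: l2_rel_def sq_integrable_0)
  qed
  show "norm u = sqrt (inner u u)" by (rule norm_l2_def)
  show "sgn u = u /\<^sub>R norm u" by (rule sgn_l2_def)
  show "dist u v = norm (u - v)" by (rule dist_l2_def)
  show "(uniformity :: ('a l2 \<times> 'a l2) filter) = (INF e\<in>{0<..}. principal {(x, y). dist x y < e})"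
    by (rule uniformity_l2_def)
  show "open U = (\<forall>x\<in>U. \<forall>\<^sub>F (x', y) in uniformity. x' = x \<longrightarrow> y \<in> U)" for U :: "'a l2 set"
    by (rule open_l2_def)
qed

end

definition L2_on :: "'a::euclidean_space set \<Rightarrow> 'a l2 set" where
  "L2_on \<Omega> = {u. AE x in lebesgue. x \<notin> \<Omega> \<longrightarrow> rep_l2 u x = 0}"


section \<open>Operators and functionals on closed subspaces\<close>

definition bounded_linear_between ::
    "'a::real_normed_vector set \<Rightarrow> 'b::real_normed_vector set \<Rightarrow> ('a \<Rightarrow> 'b) \<Rightarrow> bool" where
  "bounded_linear_between U Y B \<longleftrightarrow>
     B ` U \<subseteq> Y \<and>
     (\<forall>u\<in>U. \<forall>v\<in>U. B (u + v) = B u + B v) \<and>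
     (\<forall>c. \<forall>u\<in>U. B (c *\<^sub>R u) = c *\<^sub>R B u) \<and>
     (\<exists>C. \<forall>u\<in>U. norm (B u) \<le> C * norm u)"

definition adjoint_between ::
    "'a::real_inner set \<Rightarrow> 'b::real_inner set \<Rightarrow> ('a \<Rightarrow> 'b) \<Rightarrow> ('b \<Rightarrow> 'a) \<Rightarrow> bool" where
  "adjoint_between U Y B Bs \<longleftrightarrow> Bs ` Y \<subseteq> U \<and> (\<forall>u\<in>U. \<forall>y\<in>Y. B u \<bullet> y = u \<bullet> Bs y)"

definition continuously_frechet_differentiable ::
    "'a::real_normed_vector set \<Rightarrow> ('a \<Rightarrow> real) \<Rightarrow> ('a \<Rightarrow> 'a \<Rightarrow>\<^sub>L real) \<Rightarrow> bool" where
  "continuously_frechet_differentiable U F DF \<longleftrightarrow>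
     (\<forall>u\<in>U. (F has_derivative blinfun_apply (DF u)) (at u within U)) \<and> continuous_on U DF"

text \<open>
  \<open>F u\<close> is the integral over \<open>\<Omega>\<close> of \<open>k x (u x)\<close>, its derivative \<open>DF u\<close> is the integral against
  \<open>k' x (u x)\<close>, where \<open>k' x\<close> is the derivative of \<open>k x\<close>, and \<open>dF u\<close> is the element of the
  space \<open>L2_on \<Omega>\<close> given by the function \<open>k' x (u x)\<close>, with which \<open>DF u\<close> is identified.
\<close>

definition integral_form ::
    "'a::euclidean_space set \<Rightarrow> ('a l2 \<Rightarrow> real) \<Rightarrow> ('a l2 \<Rightarrow> 'a l2 \<Rightarrow>\<^sub>L real) \<Rightarrow> ('a l2 \<Rightarrow> 'a l2) \<Rightarrow> bool" where
  "integral_form \<Omega> F DF dF \<longleftrightarrow>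
     (\<exists>k k'.
        (AE x in lebesgue. x \<in> \<Omega> \<longrightarrow> (\<forall>s. (k x has_real_derivative k' x s) (at s))) \<and>
        (\<forall>u\<in>L2_on \<Omega>.
           set_integrable lebesgue \<Omega> (\<lambda>x. k x (rep_l2 u x)) \<and>
           F u = (LINT x:\<Omega>|lebesgue. k x (rep_l2 u x)) \<and>
           sq_integrable (\<lambda>x. indicator \<Omega> x * k' x (rep_l2 u x)) \<and>
           dF u = abs_l2 (\<lambda>x. indicator \<Omega> x * k' x (rep_l2 u x)) \<and>
           (\<forall>v\<in>L2_on \<Omega>.
              blinfun_apply (DF u) v = (LINT x:\<Omega>|lebesgue. k' x (rep_l2 u x) * rep_l2 v x))))"

text \<open>
  The projection onto a closed convex set, defined as \<^const>\<open>closest_point\<close>, which the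
  library restricts to locally compact spaces.
\<close>

definition projection :: "'a::real_inner set \<Rightarrow> 'a \<Rightarrow> 'a" where
  "projection C v = (SOME p. p \<in> C \<and> (\<forall>q\<in>C. dist v p \<le> dist v q))"


section \<open>Sobolev spaces\<close>

definition partial_deriv :: "'n::finite \<Rightarrow> (real^'n \<Rightarrow> real) \<Rightarrow> real^'n \<Rightarrow> real" where
  "partial_deriv i f x = frechet_derivative f (at x) (axis i 1)"

definition grad :: "(real^'n \<Rightarrow> real) \<Rightarrow> real^'n::finite \<Rightarrow> real^'n" where
  "grad f x = (\<chi> i. partial_deriv i f x)"

primrec C_times :: "nat \<Rightarrow> (real^'n::finite \<Rightarrow> real) \<Rightarrow> bool" where
  "C_times 0 f = continuous_on UNIV f"
| "C_times (Suc k) f = ((\<forall>x. f differentiable at x) \<and> (\<forall>i. C_times k (partial_deriv i f)))"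

definition test_function :: "(real^'n::finite) set \<Rightarrow> (real^'n \<Rightarrow> real) \<Rightarrow> bool" where
  "test_function \<Omega> v \<longleftrightarrow>
     (\<forall>k. C_times k v) \<and> (\<exists>C. compact C \<and> C \<subseteq> \<Omega> \<and> (\<forall>x. x \<notin> C \<longrightarrow> v x = 0))"

definition weak_partial ::
    "(real^'n::finite) set \<Rightarrow> 'n \<Rightarrow> (real^'n \<Rightarrow> real) \<Rightarrow> (real^'n \<Rightarrow> real) \<Rightarrow> bool" where
  "weak_partial \<Omega> i f g \<longleftrightarrow>
     (\<forall>C. compact C \<and> C \<subseteq> \<Omega> \<longrightarrow> set_integrable lebesgue C f \<and> set_integrable lebesgue C g) \<and>
     (\<forall>v. test_function \<Omega> v \<longrightarrow>
        (LINT x:\<Omega>|lebesgue. f x * partial_deriv i v x) = - (LINT x:\<Omega>|lebesgue. g x * v x))"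

definition Linf :: "(real^'n::finite) set \<Rightarrow> (real^'n \<Rightarrow> real) \<Rightarrow> bool" where
  "Linf \<Omega> f \<longleftrightarrow>
     set_borel_measurable lebesgue \<Omega> f \<and> (\<exists>M. AE x in lebesgue. x \<in> \<Omega> \<longrightarrow> \<bar>f x\<bar> \<le> M)"

definition W1inf :: "(real^'n::finite) set \<Rightarrow> (real^'n \<Rightarrow> real) \<Rightarrow> bool" where
  "W1inf \<Omega> f \<longleftrightarrow> Linf \<Omega> f \<and> (\<forall>i. \<exists>g. weak_partial \<Omega> i f g \<and> Linf \<Omega> g)"

definition H2 :: "(real^'n::finite) set \<Rightarrow> (real^'n \<Rightarrow> real) \<Rightarrow> bool" where
  "H2 \<Omega> f \<longleftrightarrow>
     sq_integrable (\<lambda>x. indicator \<Omega> x * f x) \<and>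
     (\<forall>i. \<exists>g. weak_partial \<Omega> i f g \<and> sq_integrable (\<lambda>x. indicator \<Omega> x * g x) \<and>
        (\<forall>j. \<exists>h. weak_partial \<Omega> j g h \<and> sq_integrable (\<lambda>x. indicator \<Omega> x * h x)))"

text \<open>
  The space \<open>H^(3/2)\<close> on the boundary is the trace space of \<open>H^2\<close>.  In dimension at most three
  every \<open>H^2\<close> function on a convex domain has a representative continuous up to the boundary,
  and its trace is the restriction of that representative.
\<close>

definition H32_boundary :: "(real^'n::finite) set \<Rightarrow> (real^'n \<Rightarrow> real) \<Rightarrow> bool" where
  "H32_boundary \<Omega> \<phi> \<longleftrightarrow>
     (\<exists>G. continuous_on (closure \<Omega>) G \<and> H2 \<Omega> G \<and> (\<forall>x\<in>frontier \<Omega>. \<phi> x = G x))"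

definition convex_polyhedral_domain :: "(real^'n::finite) set \<Rightarrow> bool" where
  "convex_polyhedral_domain \<Omega> \<longleftrightarrow> open \<Omega> \<and> \<Omega> \<noteq> {} \<and> convex \<Omega> \<and> polytope (closure \<Omega>)"


section \<open>Meshes and surface integrals\<close>

definition simplicial_mesh :: "(real^'n::finite) set \<Rightarrow> (real^'n) set set \<Rightarrow> bool" where
  "simplicial_mesh \<Omega> T \<longleftrightarrow>
     triangulation T \<and> (\<forall>K\<in>T. int CARD('n) simplex K) \<and> \<Union>T = closure \<Omega>"

definition polytopal_mesh :: "(real^'n::finite) set \<Rightarrow> (real^'n) set set \<Rightarrow> bool" where
  "polytopal_mesh \<Omega> T \<longleftrightarrow>
     finite T \<and> (\<forall>K\<in>T. polytope K \<and> interior K \<noteq> {}) \<and>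
     pairwise (\<lambda>K K'. interior K \<inter> interior K' = {}) T \<and> \<Union>T = closure \<Omega>"

definition quasi_uniform :: "real \<Rightarrow> (real^'n::finite) set set \<Rightarrow> real \<Rightarrow> bool" where
  "quasi_uniform \<sigma> T h \<longleftrightarrow>
     0 < \<sigma> \<and> h = Max (diameter ` T) \<and> (\<forall>K\<in>T. \<exists>x. cball x (\<sigma> * h) \<subseteq> K)"

definition faces :: "(real^'n::finite) set set \<Rightarrow> (real^'n) set set" where
  "faces T = {e. \<exists>K\<in>T. e facet_of K}"

definition boundary_faces :: "(real^'n::finite) set \<Rightarrow> (real^'n) set set \<Rightarrow> (real^'n) set set" where
  "boundary_faces \<Omega> T = {e\<in>faces T. e \<subseteq> frontier \<Omega>}"

text \<open>The unit normal on a face \<open>e\<close> of the convex set \<open>K\<close>, pointing out of \<open>K\<close>.\<close>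

definition outward_normal :: "(real^'n::finite) set \<Rightarrow> (real^'n) set \<Rightarrow> real^'n" where
  "outward_normal K e =
     (THE \<nu>. norm \<nu> = 1 \<and> (\<exists>b. (\<forall>x\<in>e. \<nu> \<bullet> x = b) \<and> (\<forall>x\<in>K. \<nu> \<bullet> x \<le> b)))"

text \<open>
  Surface measure on the hyperplane \<open>a \<bullet> x = b\<close> with \<open>norm a = 1\<close>: the orthogonal projection
  onto the hyperplane of Lebesgue measure on the slab of thickness one based on it.
\<close>

definition hyperplane_measure :: "real^'n::finite \<Rightarrow> real \<Rightarrow> (real^'n) measure" where
  "hyperplane_measure a b =
     distr (restrict_space lborel {x. b \<le> a \<bullet> x \<and> a \<bullet> x \<le> b + 1}) borel
       (\<lambda>x. x - (a \<bullet> x - b) *\<^sub>R a)"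

definition face_measure :: "(real^'n::finite) set \<Rightarrow> (real^'n) measure" where
  "face_measure e =
     (SOME M. \<exists>a b. norm a = 1 \<and> e \<subseteq> {x. a \<bullet> x = b} \<and> M = hyperplane_measure a b)"

abbreviation face_integral :: "(real^'n::finite) set \<Rightarrow> (real^'n \<Rightarrow> real) \<Rightarrow> real" where
  "face_integral e f \<equiv> set_lebesgue_integral (face_measure e) e f"


section \<open>The reconstructed space\<close>

text \<open>Polynomial functions of total degree at most \<open>m\<close>; \<open>\<alpha>\<close> ranges over the multi-indices.\<close>

definition polys :: "nat \<Rightarrow> (real^'n::finite \<Rightarrow> real) set" where
  "polys m =
     {p. \<exists>c. p = (\<lambda>x. \<Sum>\<alpha> | (\<Sum>i\<in>UNIV. \<alpha> i) \<le> m. c \<alpha> * (\<Prod>i\<in>UNIV. (x $ i) ^ \<alpha> i))}"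

lemma finite_multi_indices: "finite {\<alpha> :: 'n::finite \<Rightarrow> nat. (\<Sum>i\<in>UNIV. \<alpha> i) \<le> m}"
proof (rule finite_subset)
  show "{\<alpha> :: 'n \<Rightarrow> nat. (\<Sum>i\<in>UNIV. \<alpha> i) \<le> m} \<subseteq> (\<Pi>\<^sub>E i\<in>UNIV. {..m})"
  proof
    fix \<alpha> :: "'n \<Rightarrow> nat" assume *: "\<alpha> \<in> {\<alpha>. (\<Sum>i\<in>UNIV. \<alpha> i) \<le> m}"
    have "\<alpha> i \<le> m" for i
      using member_le_sum[of i UNIV \<alpha>] * by simp
    then show "\<alpha> \<in> (\<Pi>\<^sub>E i\<in>UNIV. {..m})" by auto
  qed
  show "finite (\<Pi>\<^sub>E i\<in>(UNIV :: 'n set). {..m})"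
    by (intro finite_PiE) auto
qed

definition barycenter :: "(real^'n::finite) set \<Rightarrow> real^'n" where
  "barycenter K =
     (\<Sum>x | x extreme_point_of K. x) /\<^sub>R real (card {x. x extreme_point_of K})"

definition neighbours :: "(real^'n::finite) set set \<Rightarrow> (real^'n) set \<Rightarrow> (real^'n) set set" where
  "neighbours T K = {K'\<in>T. \<exists>e\<in>faces T. e \<subseteq> frontier K' \<inter> frontier K}"

primrec patch_layer ::
    "(real^'n::finite) set set \<Rightarrow> (real^'n) set \<Rightarrow> nat \<Rightarrow> (real^'n) set set" where
  "patch_layer T K 0 = {K}"
| "patch_layer T K (Suc t) = (\<Union>K'\<in>patch_layer T K t. neighbours T K')"

definition patch ::
    "(real^'n::finite) set set \<Rightarrow> nat \<Rightarrow> (real^'n) set \<Rightarrow> (real^'n) set set" where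
  "patch T N K = patch_layer T K (LEAST t. N \<le> card (patch_layer T K t))"

text \<open>
  Functions that are smooth on each element but may jump across faces are families of functions
  indexed by the elements, so that \<open>w K\<close> also provides the trace from the side of \<open>K\<close>.  A
  piecewise constant function is given by its values \<open>w K\<close>; since distinct elements have distinct
  barycenters, the least-squares functional is indexed by the elements of the patch.
\<close>

type_synonym 'n broken = "(real^'n) set \<Rightarrow> real^'n \<Rightarrow> real"

definition residual ::
    "(real^'n::finite) set set \<Rightarrow> nat \<Rightarrow> ((real^'n) set \<Rightarrow> real) \<Rightarrow> (real^'n) set \<Rightarrow>
     (real^'n \<Rightarrow> real) \<Rightarrow> real" where
  "residual T N w K p = (\<Sum>K'\<in>patch T N K. (p (barycenter K') - w K')\<^sup>2)"

definition is_reconstruction ::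
    "(real^'n::finite) set set \<Rightarrow> nat \<Rightarrow> nat \<Rightarrow> ((real^'n) set \<Rightarrow> real) \<Rightarrow> (real^'n) set \<Rightarrow>
     (real^'n \<Rightarrow> real) \<Rightarrow> bool" where
  "is_reconstruction T N m w K p \<longleftrightarrow>
     p \<in> polys m \<and> p (barycenter K) = w K \<and>
     (\<forall>q\<in>polys m. q (barycenter K) = w K \<longrightarrow> residual T N w K p \<le> residual T N w K q)"

definition reconstruction_well_defined :: "(real^'n::finite) set set \<Rightarrow> nat \<Rightarrow> nat \<Rightarrow> bool" where
  "reconstruction_well_defined T N m \<longleftrightarrow>
     (\<forall>K\<in>T. (\<exists>t. N \<le> card (patch_layer T K t)) \<and> (\<forall>w. \<exists>!p. is_reconstruction T N m w K p))"

definition reconstruct ::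
    "(real^'n::finite) set set \<Rightarrow> nat \<Rightarrow> nat \<Rightarrow> ((real^'n) set \<Rightarrow> real) \<Rightarrow> 'n broken" where
  "reconstruct T N m w =
     (\<lambda>K. if K \<in> T then THE p. is_reconstruction T N m w K p else (\<lambda>x. 0))"

definition reconstructed_space :: "(real^'n::finite) set set \<Rightarrow> nat \<Rightarrow> nat \<Rightarrow> 'n broken set" where
  "reconstructed_space T N m = range (reconstruct T N m)"

definition broken_l2 :: "(real^'n::finite) set set \<Rightarrow> 'n broken \<Rightarrow> (real^'n) l2" where
  "broken_l2 T w = abs_l2 (\<lambda>x. \<Sum>K\<in>T. indicator (interior K) x * w K x)"

definition piecewise_constants :: "(real^'n::finite) set set \<Rightarrow> (real^'n) l2 set" where
  "piecewise_constants T = {broken_l2 T (\<lambda>K x. c K) |c. True}"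


section \<open>The discontinuous Galerkin forms and norms\<close>

text \<open>
  An interior face has two adjacent elements, a boundary face one, so that the two definitions
  below give the usual jumps and averages on both kinds of faces.
\<close>

definition adjacent :: "(real^'n::finite) set set \<Rightarrow> (real^'n) set \<Rightarrow> (real^'n) set set" where
  "adjacent T e = {K\<in>T. e facet_of K}"

definition jump ::
    "(real^'n::finite) set set \<Rightarrow> 'n broken \<Rightarrow> (real^'n) set \<Rightarrow> real^'n \<Rightarrow> real^'n" where
  "jump T w e x = (\<Sum>K\<in>adjacent T e. w K x *\<^sub>R outward_normal K e)"

definition average ::
    "(real^'n::finite) set set \<Rightarrow> ((real^'n) set \<Rightarrow> real^'n \<Rightarrow> real^'n) \<Rightarrow> (real^'n) set \<Rightarrow>
     real^'n \<Rightarrow> real^'n" where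
  "average T \<tau> e x = (\<Sum>K\<in>adjacent T e. \<tau> K x) /\<^sub>R real (card (adjacent T e))"

definition flux :: "(real^'n \<Rightarrow> real^'n^'n) \<Rightarrow> 'n::finite broken \<Rightarrow> (real^'n) set \<Rightarrow> real^'n \<Rightarrow> real^'n" where
  "flux A w K x = A x *v grad (w K) x"

definition a_h ::
    "(real^'n::finite) set set \<Rightarrow> (real^'n \<Rightarrow> real^'n^'n) \<Rightarrow> real \<Rightarrow> 'n broken \<Rightarrow> 'n broken \<Rightarrow> real" where
  "a_h T A \<mu> y w =
     (\<Sum>K\<in>T. LINT x:K|lebesgue. flux A y K x \<bullet> grad (w K) x)
     - (\<Sum>e\<in>faces T. face_integral e (\<lambda>x. average T (flux A y) e x \<bullet> jump T w e x))
     - (\<Sum>e\<in>faces T. face_integral e (\<lambda>x. average T (flux A w) e x \<bullet> jump T y e x))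
     + \<mu> * (\<Sum>e\<in>faces T. inverse (diameter e) * face_integral e (\<lambda>x. jump T y e x \<bullet> jump T w e x))"

definition l_h ::
    "(real^'n::finite) set \<Rightarrow> (real^'n) set set \<Rightarrow> (real^'n \<Rightarrow> real^'n^'n) \<Rightarrow> real \<Rightarrow>
     (real^'n) l2 \<Rightarrow> (real^'n \<Rightarrow> real) \<Rightarrow> 'n broken \<Rightarrow> real" where
  "l_h \<Omega> T A \<mu> s \<phi> w =
     (\<Sum>K\<in>T. LINT x:K|lebesgue. rep_l2 s x * w K x)
     - (\<Sum>e\<in>boundary_faces \<Omega> T.
          face_integral e (\<lambda>x. (average T (flux A w) e x \<bullet> outward_normal (closure \<Omega>) e) * \<phi> x))
     + \<mu> * (\<Sum>e\<in>boundary_faces \<Omega> T.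
          inverse (diameter e) *
          face_integral e (\<lambda>x. (jump T w e x \<bullet> outward_normal (closure \<Omega>) e) * \<phi> x))"

definition dg_norm :: "(real^'n::finite) set set \<Rightarrow> real \<Rightarrow> 'n broken \<Rightarrow> real" where
  "dg_norm T \<mu> w = sqrt (
     (\<Sum>K\<in>T. LINT x:K|lebesgue. (norm (grad (w K) x))\<^sup>2) +
     (\<Sum>e\<in>faces T. inverse (diameter e / \<mu>) * face_integral e (\<lambda>x. (norm (jump T w e x))\<^sup>2)))"

definition dg_norm3 :: "(real^'n::finite) set set \<Rightarrow> real \<Rightarrow> 'n broken \<Rightarrow> real" where
  "dg_norm3 T \<mu> w = sqrt ((dg_norm T \<mu> w)\<^sup>2 +
     (\<Sum>e\<in>faces T. (diameter e / \<mu>) *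
        face_integral e (\<lambda>x. (norm (average T (\<lambda>K. grad (w K)) e x))\<^sup>2)))"

definition bounded_and_coercive ::
    "'v set \<Rightarrow> ('v \<Rightarrow> 'v \<Rightarrow> real) \<Rightarrow> ('v \<Rightarrow> real) \<Rightarrow> bool" where
  "bounded_and_coercive V a N \<longleftrightarrow>
     (\<exists>C. \<forall>y\<in>V. \<forall>w\<in>V. \<bar>a y w\<bar> \<le> C * N y * N w) \<and>
     (\<exists>c>0. \<forall>w\<in>V. c * (N w)\<^sup>2 \<le> a w w)"


section \<open>The discrete systems and the projected gradient iteration\<close>

definition discrete_state ::
    "(real^'n::finite) set \<Rightarrow> (real^'n) set set \<Rightarrow> (real^'n \<Rightarrow> real^'n^'n) \<Rightarrow> real \<Rightarrow> 'n broken set \<Rightarrow>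
     (real^'n) l2 \<Rightarrow> (real^'n \<Rightarrow> real) \<Rightarrow> 'n broken \<Rightarrow> bool" where
  "discrete_state \<Omega> T A \<mu> V s \<phi> y \<longleftrightarrow> y \<in> V \<and> (\<forall>w\<in>V. a_h T A \<mu> y w = l_h \<Omega> T A \<mu> s \<phi> w)"

definition discrete_adjoint ::
    "(real^'n::finite) set \<Rightarrow> (real^'n) set set \<Rightarrow> (real^'n \<Rightarrow> real^'n^'n) \<Rightarrow> real \<Rightarrow> 'n broken set \<Rightarrow>
     (real^'n) l2 \<Rightarrow> 'n broken \<Rightarrow> bool" where
  "discrete_adjoint \<Omega> T A \<mu> V s p \<longleftrightarrow>
     p \<in> V \<and> (\<forall>q\<in>V. a_h T A \<mu> q p = l_h \<Omega> T A \<mu> s (\<lambda>x. 0) q)"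

definition projected_gradient ::
    "(real^'n::finite) set \<Rightarrow> (real^'n) set set \<Rightarrow> (real^'n \<Rightarrow> real^'n^'n) \<Rightarrow> real \<Rightarrow> 'n broken set \<Rightarrow>
     (real^'n) l2 \<Rightarrow> (real^'n \<Rightarrow> real) \<Rightarrow>
     ((real^'n) l2 \<Rightarrow> (real^'n) l2) \<Rightarrow> ((real^'n) l2 \<Rightarrow> (real^'n) l2) \<Rightarrow>
     ((real^'n) l2 \<Rightarrow> (real^'n) l2) \<Rightarrow> ((real^'n) l2 \<Rightarrow> (real^'n) l2) \<Rightarrow>
     (real^'n) l2 set \<Rightarrow> (nat \<Rightarrow> real) \<Rightarrow> (real^'n) l2 \<Rightarrow>
     (nat \<Rightarrow> (real^'n) l2) \<Rightarrow> (nat \<Rightarrow> 'n broken) \<Rightarrow> (nat \<Rightarrow> 'n broken) \<Rightarrow> bool" where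
  "projected_gradient \<Omega> T A \<mu> V f \<phi> B Bs dg dj C \<rho> u0 u y p \<longleftrightarrow>
     u 0 = u0 \<and>
     (\<forall>n. discrete_state \<Omega> T A \<mu> V (f + B (u n)) \<phi> (y n) \<and>
          discrete_adjoint \<Omega> T A \<mu> V (dg (broken_l2 T (y n))) (p n) \<and>
          u (Suc n) = projection C (u n - \<rho> n *\<^sub>R (dj (u n) + Bs (broken_l2 T (p n)))))"

end

theory Submission
  imports Defs
begin

text \<open>
  On the finite-dimensional space \<open>V\<close> the triple norm is definite: if it vanishes on \<open>w\<close>, then \<open>w\<close>
  is constant on every element, and following a line that avoids the faces of codimension two from
  any element up to the boundary shows that the constants agree across facets and vanish at the
  last one.  Hence every functional on \<open>V\<close> is represented by the coercive form \<open>a_h\<close>, which solves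
  the discrete systems and bounds the norm of \<open>L^2\<close> by the triple norm.

  Writing \<open>e_u\<close>, \<open>e_y\<close>, \<open>e_p\<close> for the errors, the error equations give
  \<open>(B^* e_p, e_u) = a_h(e_y, e_p) = (g'(y_n) - g'(y_h), e_y) \<ge> 0\<close>, so the reduced gradient is
  \<open>\<alpha>\<close>-monotone, and it is Lipschitz with some constant \<open>M > \<alpha>\<close>.  With the step size \<open>\<alpha> / M^2\<close> the
  projected gradient map contracts the control error by the factor \<open>sqrt (1 - \<alpha>^2 / M^2)\<close>, and
  \<open>e_y\<close>, \<open>e_p\<close> are bounded by \<open>e_u\<close>; a small weight \<open>lam\<close> absorbs these bounds.
\<close>

text \<open>Coercivity bounds \<open>a_h\<close> below only by the square of
  \<open>dg_norm3\<close>, so solvability presupposes that this norm detects the nonzero elements of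
  \<open>V\<close>. Coordinates on \<open>V\<close> are the values at the barycenters, where the
  reconstruction interpolates; in them \<open>a_h\<close> becomes a positive definite matrix. The
  constants obtained in this way depend on the mesh, which is harmless because the mesh is fixed and
  \<eta> may depend on it. The normal, the surface measure and the projection are given by choice or
  description. Before they can be used, their values or their existence must be established: for
  faces by a local chart at a point lying on a single facet, for the projection by compactness
  inside a finite-dimensional span. The monotonicity of the reduced gradient rests on the position
  of the unknowns: the adjoint stands in the second slot of \<open>a_h\<close>, so the state
  equation tested with the adjoint error and the adjoint equation tested with the state error
  evaluate the same number.\<close>

section \<open>Linear systems, projections and contraction in abstract form\<close>

text \<open>Induction by bordering: the matrix on \<open>I\<close> inherits positivity by extending
  vectors by zero, and the new equation is met by adding a multiple of a direction that leaves the
  equations on \<open>I\<close> unchanged. Only the quadratic form is used, so the lemma applies to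
  a matrix and to its transpose alike.\<close>

lemma positive_definite_solvable:
  fixes a :: "'i \<Rightarrow> 'i \<Rightarrow> real"
  assumes "finite I"
    and "\<And>c. \<exists>i\<in>I. c i \<noteq> 0 \<Longrightarrow> 0 < (\<Sum>i\<in>I. \<Sum>j\<in>I. c i * c j * a i j)"
  shows "\<exists>c. \<forall>j\<in>I. (\<Sum>i\<in>I. c i * a i j) = l j"
  using assms
proof (induction I arbitrary: l rule: finite_induct)
  case empty
  then show ?case by simp
next
  case (insert b I)
  have upd: "(\<Sum>i\<in>I. if i = b then x else F i) = (\<Sum>i\<in>I. F i)" for x :: real and F
    using insert.hyps by (intro sum.cong) auto
  have pd: "0 < (\<Sum>i\<in>I. \<Sum>j\<in>I. c i * c j * a i j)" if "\<exists>i\<in>I. c i \<noteq> 0" for c :: "'i \<Rightarrow> real"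
  proof -
    have "0 < (\<Sum>i\<in>insert b I. \<Sum>j\<in>insert b I. (c(b := 0)) i * (c(b := 0)) j * a i j)"
      by (rule insert.prems) (use that insert.hyps in auto)
    also have "\<dots> = (\<Sum>i\<in>I. \<Sum>j\<in>I. (c(b := 0)) i * (c(b := 0)) j * a i j)"
      using insert.hyps by simp
    also have "\<dots> = (\<Sum>i\<in>I. \<Sum>j\<in>I. c i * c j * a i j)"
      using insert.hyps by (intro sum.cong) auto
    finally show ?thesis .
  qed
  obtain z where z: "\<And>j. j \<in> I \<Longrightarrow> (\<Sum>i\<in>I. z i * a i j) = a b j"
    using insert.IH[of "a b"] pd by blast
  obtain y where y: "\<And>j. j \<in> I \<Longrightarrow> (\<Sum>i\<in>I. y i * a i j) = l j"
    using insert.IH[of l] pd by blast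
  \<comment> \<open>\<open>d\<close> is the unit vector of \<open>b\<close> corrected by
    \<open>z\<close>, so that it annihilates every column \<open>j \<in> I\<close>. Hence
    \<open>s\<close>, the Schur complement of the block \<open>I\<close>, equals the quadratic form
    at \<open>d\<close>, and \<open>t\<close> is the multiple that repairs equation
    \<open>b\<close>.\<close>
  define d where "d = (\<lambda>i. if i = b then 1 else - z i)"
  define s where "s = (\<Sum>i\<in>insert b I. d i * a i b)"
  define t where "t = (l b - (\<Sum>i\<in>I. y i * a i b)) / s"
  have d_orth: "(\<Sum>i\<in>insert b I. d i * a i j) = 0" if "j \<in> I" for j
  proof -
    have "(\<Sum>i\<in>I. d i * a i j) = (\<Sum>i\<in>I. - (z i * a i j))"
      using insert.hyps by (intro sum.cong) (auto simp: d_def)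
    then show ?thesis
      using z[OF that] insert.hyps by (simp add: sum_negf) (simp add: d_def)
  qed
  have "0 < (\<Sum>i\<in>insert b I. \<Sum>j\<in>insert b I. d i * d j * a i j)"
    by (rule insert.prems) (simp add: d_def)
  also have "\<dots> = (\<Sum>j\<in>insert b I. d j * (\<Sum>i\<in>insert b I. d i * a i j))"
    by (subst sum.swap) (simp only: sum_distrib_left mult_ac)
  also have "\<dots> = s"
    using insert.hyps d_orth by (simp add: s_def) (simp add: d_def)
  finally have s: "0 < s" .
  define c where "c = (\<lambda>i. (if i = b then 0 else y i) + t * d i)"
  have c: "(\<Sum>i\<in>insert b I. c i * a i j) = (\<Sum>i\<in>I. y i * a i j) + t * (\<Sum>i\<in>insert b I. d i * a i j)" for j
  proof -
    have "(\<Sum>i\<in>insert b I. c i * a i j)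
        = (\<Sum>i\<in>insert b I. (if i = b then 0 else y i * a i j) + t * (d i * a i j))"
      by (intro sum.cong) (auto simp: c_def algebra_simps)
    also have "\<dots> = (\<Sum>i\<in>insert b I. if i = b then 0 else y i * a i j) + t * (\<Sum>i\<in>insert b I. d i * a i j)"
      by (simp only: sum.distrib sum_distrib_left)
    also have "(\<Sum>i\<in>insert b I. if i = b then 0 else y i * a i j) = (\<Sum>i\<in>I. y i * a i j)"
      using insert.hyps upd by simp
    finally show ?thesis .
  qed
  have "(\<Sum>i\<in>insert b I. c i * a i j) = l j" if "j \<in> insert b I" for j
  proof (cases "j = b")
    case True
    have "t * s = l b - (\<Sum>i\<in>I. y i * a i b)" using s by (simp add: t_def)
    then show ?thesis using c[of b] True by (simp only: s_def)
  next
    case False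
    then have "j \<in> I" using that by simp
    have "(\<Sum>i\<in>insert b I. c i * a i j) = l j + t * 0"
      unfolding c d_orth[OF \<open>j \<in> I\<close>] y[OF \<open>j \<in> I\<close>] ..
    then show ?thesis by (simp only: mult_zero_right add_0_right)
  qed
  then show ?case by blast
qed

text \<open>If the inner product were positive, a short step from the projection towards
  \<open>q\<close> would stay in \<open>C\<close> by convexity and come closer to \<open>v\<close>.
  Existence of a nearest point is a hypothesis here; finite dimension supplies it later.\<close>

lemma projection_mem_inner_le:
  fixes C :: "'a::real_inner set"
  assumes "convex C" and ex: "\<exists>p\<in>C. \<forall>q\<in>C. dist v p \<le> dist v q"
  shows "projection C v \<in> C" "\<And>q. q \<in> C \<Longrightarrow> (v - projection C v) \<bullet> (q - projection C v) \<le> 0"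
proof -
  define p where "p = projection C v"
  have "p \<in> C \<and> (\<forall>q\<in>C. dist v p \<le> dist v q)"
    unfolding p_def projection_def by (rule someI_ex) (use ex in blast)
  then have p: "p \<in> C" and min: "\<And>q. q \<in> C \<Longrightarrow> dist v p \<le> dist v q" by auto
  show "projection C v \<in> C" using p by (simp add: p_def)
  fix q assume q: "q \<in> C"
  show "(v - projection C v) \<bullet> (q - projection C v) \<le> 0"
  proof (rule ccontr)
    assume "\<not> ?thesis"
    then have k: "0 < (v - p) \<bullet> (q - p)" by (simp add: p_def)
    obtain t where t: "0 < t" "t \<le> 1" "dist (p + t *\<^sub>R (q - p)) v < dist p v"
      using closer_point_lemma[OF k] by blast
    have "(1 - t) *\<^sub>R p + t *\<^sub>R q \<in> C"
      using \<open>convex C\<close> p q t by (intro convexD) auto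
    moreover have "(1 - t) *\<^sub>R p + t *\<^sub>R q = p + t *\<^sub>R (q - p)" by (simp add: algebra_simps)
    ultimately show False using min t by (fastforce simp: dist_commute)
  qed
qed

text \<open>The variational inequality of the projection, tested with \<open>ub\<close>, and the
  optimality of \<open>ub\<close>, tested with the projection, add up to
  \<open>norm (p - ub) \<le> norm w\<close>. Expanding the square of \<open>norm w\<close> gives the
  factor \<open>1 - 2 * \<rho> * \<alpha> + \<rho>\<^sup>2 * M\<^sup>2\<close>, which
  \<open>\<rho> = \<alpha> / M\<^sup>2\<close> minimizes.\<close>

lemma projected_gradient_step_contraction:
  fixes u :: "'a::real_inner"
  assumes "convex C" "\<exists>p\<in>C. \<forall>q\<in>C. dist (u - \<rho> *\<^sub>R d) p \<le> dist (u - \<rho> *\<^sub>R d) q"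
    and "ub \<in> C" and opt: "\<And>v. v \<in> C \<Longrightarrow> 0 \<le> db \<bullet> (v - ub)"
    and mono: "\<alpha> * (norm (u - ub))\<^sup>2 \<le> (d - db) \<bullet> (u - ub)"
    and lip: "norm (d - db) \<le> M * norm (u - ub)"
    and "0 < \<alpha>" "\<alpha> < M" "\<rho> = \<alpha> / M\<^sup>2"
  shows "norm (projection C (u - \<rho> *\<^sub>R d) - ub) \<le> sqrt (1 - \<alpha>\<^sup>2 / M\<^sup>2) * norm (u - ub)"
proof -
  define p where "p = projection C (u - \<rho> *\<^sub>R d)"
  have "0 < \<rho>" "0 < M" using assms by auto
  have p: "p \<in> C" "(u - \<rho> *\<^sub>R d - p) \<bullet> (ub - p) \<le> 0"
    using projection_mem_inner_le[OF assms(1,2)] \<open>ub \<in> C\<close> by (auto simp: p_def)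
  define w where "w = (u - ub) - \<rho> *\<^sub>R (d - db)"
  have "0 \<le> \<rho> * (db \<bullet> (p - ub))"
    using opt[OF p(1)] \<open>0 < \<rho>\<close> by simp
  then have "(p - ub) \<bullet> (p - ub) \<le> w \<bullet> (p - ub)"
    using p(2) by (simp add: w_def algebra_simps inner_commute)
  also have "\<dots> \<le> norm w * norm (p - ub)" by (rule norm_cauchy_schwarz)
  finally have 1: "norm (p - ub) \<le> norm w"
    by (cases "p = ub")
      (simp_all add: power2_norm_eq_inner[symmetric] power2_eq_square mult_le_cancel_right)
  have "(norm w)\<^sup>2 = (norm (u - ub))\<^sup>2 - 2 * \<rho> * ((d - db) \<bullet> (u - ub)) + \<rho>\<^sup>2 * (norm (d - db))\<^sup>2"
    unfolding w_def power2_norm_eq_inner inner_diff_left inner_diff_right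
    by (simp add: algebra_simps inner_commute power2_eq_square)
  also have "\<dots> \<le> (norm (u - ub))\<^sup>2 - 2 * \<rho> * (\<alpha> * (norm (u - ub))\<^sup>2) + \<rho>\<^sup>2 * (M * norm (u - ub))\<^sup>2"
    using mono lip \<open>0 < \<rho>\<close> by (intro add_mono diff_mono mult_left_mono power_mono) auto
  also have "\<dots> = (1 - \<alpha>\<^sup>2 / M\<^sup>2) * (norm (u - ub))\<^sup>2"
    using \<open>0 < M\<close> by (simp add: \<open>\<rho> = \<alpha> / M\<^sup>2\<close> field_simps power2_eq_square)
  finally have "norm w \<le> sqrt ((1 - \<alpha>\<^sup>2 / M\<^sup>2) * (norm (u - ub))\<^sup>2)"
    by (rule real_le_rsqrt)
  also have "\<dots> = sqrt (1 - \<alpha>\<^sup>2 / M\<^sup>2) * norm (u - ub)"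
    by (simp add: real_sqrt_mult)
  finally show ?thesis using 1 by (simp add: p_def)
qed

text \<open>At \<open>n = 0\<close> both sides agree; for \<open>n > 0\<close> one of the
  \<open>n\<close> factors \<theta> is spent on absorbing \<open>1 + lam * C\<close> into \<eta>.
  \<open>E\<close> need only be dominated by \<open>e\<close>, not decrease by itself.\<close>

lemma geometric_decay_weighted:
  fixes e E :: "nat \<Rightarrow> real"
  assumes "0 \<le> \<theta>" "\<theta> < 1" "0 \<le> C"
    and e: "\<And>n. 0 \<le> e n" "\<And>n. e (Suc n) \<le> \<theta> * e n"
    and E: "\<And>n. 0 \<le> E n" "\<And>n. E n \<le> C * e n"
  obtains \<eta> lam where "0 < \<eta>" "\<eta> < 1" "0 < lam" "\<And>n. e n + lam * E n \<le> \<eta> ^ n * (e 0 + lam * E 0)"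
proof -
  define \<eta> where "\<eta> = (1 + \<theta>) / 2"
  have \<eta>: "0 < \<eta>" "\<eta> < 1" "\<theta> < \<eta>" using assms by (auto simp: \<eta>_def)
  \<comment> \<open>Chosen so that \<open>\<theta> + lam * C \<le> \<eta>\<close>; the denominator
    \<open>C + 1\<close> also covers \<open>C = 0\<close>.\<close>
  define lam where "lam = (\<eta> - \<theta>) / (C + 1)"
  have lam: "0 < lam" using \<eta> assms by (simp add: lam_def)
  have "lam * C \<le> \<eta> - \<theta>"
    using \<eta> assms by (simp add: lam_def field_simps)
  moreover have "lam * C * \<theta> \<le> lam * C" using lam assms by (intro mult_left_le) auto
  ultimately have key: "(1 + lam * C) * \<theta> \<le> \<eta>" by (simp add: algebra_simps)
  have en: "e n \<le> \<theta> ^ n * e 0" for n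
  proof (induction n)
    case (Suc n)
    have "e (Suc n) \<le> \<theta> * e n" by (rule e)
    also have "\<dots> \<le> \<theta> * (\<theta> ^ n * e 0)" using Suc assms by (intro mult_left_mono) auto
    finally show ?case by simp
  qed simp
  have "e n + lam * E n \<le> \<eta> ^ n * (e 0 + lam * E 0)" for n
  proof (cases n)
    case (Suc k)
    have "e n + lam * E n \<le> e n + lam * (C * e n)"
      using E lam by (intro add_left_mono mult_left_mono) auto
    also have "\<dots> = (1 + lam * C) * e n" by (simp add: algebra_simps)
    also have "\<dots> \<le> (1 + lam * C) * (\<theta> ^ n * e 0)"
      using en lam assms by (intro mult_left_mono) auto
    also have "\<dots> = ((1 + lam * C) * \<theta>) * (\<theta> ^ k * e 0)" by (simp add: Suc)
    also have "\<dots> \<le> \<eta> * (\<eta> ^ k * e 0)"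
      using key \<eta> assms by (intro mult_mono power_mono mult_right_mono) auto
    also have "\<dots> = \<eta> ^ n * e 0" by (simp add: Suc)
    also have "\<dots> \<le> \<eta> ^ n * (e 0 + lam * E 0)"
      using \<eta> lam E by (intro mult_left_mono) auto
    finally show ?thesis .
  qed simp
  then show ?thesis using that \<eta> lam by blast
qed

subsection \<open>Continuously differentiable functions and the reconstructed space\<close>

text \<open>This is what the forms need of a polynomial: a genuine linear differential and a
  continuous gradient, hence integrable integrands on compact elements and faces. The zero function
  attached to sets outside the mesh belongs to the class, so it can be required of
  \<open>w K\<close> for every \<open>K\<close>.\<close>

definition C1_fun :: "(real^'n::finite \<Rightarrow> real) \<Rightarrow> bool" where
  "C1_fun p \<longleftrightarrow> (\<forall>x. p differentiable at x) \<and> continuous_on UNIV (grad p)"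

lemma grad_eqI:
  assumes "(p has_derivative (\<lambda>h. q \<bullet> h)) (at x)"
  shows "grad p x = q"
proof -
  have "frechet_derivative p (at x) = (\<lambda>h. q \<bullet> h)"
    using frechet_derivative_at[OF assms] by simp
  then show ?thesis
    by (simp add: grad_def partial_deriv_def inner_axis vec_eq_iff)
qed

lemma has_derivative_grad:
  assumes "p differentiable at x"
  shows "(p has_derivative (\<lambda>h. grad p x \<bullet> h)) (at x)"
proof -
  have D: "(p has_derivative frechet_derivative p (at x)) (at x)"
    using assms frechet_derivative_works by blast
  then interpret linear "frechet_derivative p (at x)"
    by (rule has_derivative_linear)
  have "frechet_derivative p (at x) h = grad p x \<bullet> h" for h
  proof -
    have "frechet_derivative p (at x) h = frechet_derivative p (at x) (\<Sum>i\<in>UNIV. h $ i *\<^sub>R axis i 1)"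
      by (simp add: basis_expansion scalar_mult_eq_scaleR[symmetric])
    also have "\<dots> = (\<Sum>i\<in>UNIV. h $ i * frechet_derivative p (at x) (axis i 1))"
      by (simp add: sum scale)
    also have "\<dots> = grad p x \<bullet> h"
      by (simp add: grad_def partial_deriv_def inner_vec_def mult.commute)
    finally show ?thesis .
  qed
  then show ?thesis using D by presburger
qed

lemma C1_funI:
  assumes "\<And>x. (p has_derivative (\<lambda>h. q x \<bullet> h)) (at x)" "continuous_on UNIV q"
  shows "C1_fun p"
proof -
  have "grad p = q" using grad_eqI[OF assms(1)] by blast
  then show ?thesis using assms unfolding C1_fun_def differentiable_def by blast
qed

lemma C1_fun_grad: "C1_fun p \<Longrightarrow> (p has_derivative (\<lambda>h. grad p x \<bullet> h)) (at x)"
  by (simp add: C1_fun_def has_derivative_grad)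

lemma C1_fun_continuous_on:
  assumes "C1_fun p"
  shows "continuous_on S p" "continuous_on S (grad p)"
proof -
  have "continuous_on UNIV p"
    using C1_fun_grad[OF assms] has_derivative_continuous by (fastforce intro: continuous_at_imp_continuous_on)
  then show "continuous_on S p" by (rule continuous_on_subset) auto
  show "continuous_on S (grad p)" using assms unfolding C1_fun_def by (metis continuous_on_subset subset_UNIV)
qed

lemma C1_fun_const: "C1_fun (\<lambda>x. c)"
  by (rule C1_funI[where q = "\<lambda>x. 0"]) auto

lemma C1_fun_nth: "C1_fun (\<lambda>x :: real^'n::finite. x $ i)"
proof (rule C1_funI[where q = "\<lambda>x. axis i 1"])
  have "(\<lambda>h :: real^'n. axis i 1 \<bullet> h) = (\<lambda>h. h $ i)" by (simp add: inner_axis' fun_eq_iff)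
  then show "((\<lambda>x. x $ i) has_derivative (\<lambda>h. axis i 1 \<bullet> h)) (at x)" for x :: "real^'n"
    using bounded_linear_imp_has_derivative[OF bounded_linear_vec_nth] by simp
qed auto

text \<open>Linearity is expressed throughout by the combination \<open>y + t * z\<close>:
  \<open>t = 1\<close> gives sums, \<open>t = - 1\<close> differences, and \<open>y = z\<close> with
  \<open>t = - 1\<close> the value at zero.\<close>

lemma has_derivative_axpy:
  assumes "C1_fun p" "C1_fun q"
  shows "((\<lambda>x. p x + c * q x) has_derivative (\<lambda>h. (grad p x + c *\<^sub>R grad q x) \<bullet> h)) (at x)"
  using C1_fun_grad[OF assms(1), of x] C1_fun_grad[OF assms(2), of x]
  by (auto intro!: derivative_eq_intros simp: inner_add_left)

lemma grad_axpy:
  "C1_fun p \<Longrightarrow> C1_fun q \<Longrightarrow> grad (\<lambda>x. p x + c * q x) = (\<lambda>x. grad p x + c *\<^sub>R grad q x)"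
  using grad_eqI[OF has_derivative_axpy] by blast

lemma C1_fun_axpy: "C1_fun p \<Longrightarrow> C1_fun q \<Longrightarrow> C1_fun (\<lambda>x. p x + c * q x)"
  by (rule C1_funI[OF has_derivative_axpy])
     (auto intro!: continuous_intros C1_fun_continuous_on)

lemma C1_fun_mult:
  assumes "C1_fun p" "C1_fun q"
  shows "C1_fun (\<lambda>x. p x * q x)"
proof (rule C1_funI[where q = "\<lambda>x. p x *\<^sub>R grad q x + q x *\<^sub>R grad p x"])
  show "((\<lambda>x. p x * q x) has_derivative (\<lambda>h. (p x *\<^sub>R grad q x + q x *\<^sub>R grad p x) \<bullet> h)) (at x)" for x
    using C1_fun_grad[OF assms(1), of x] C1_fun_grad[OF assms(2), of x]
    by (auto intro!: derivative_eq_intros simp: inner_add_left)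
qed (auto intro!: continuous_intros C1_fun_continuous_on assms)

lemma C1_fun_sum:
  assumes "\<And>i. i \<in> I \<Longrightarrow> C1_fun (p i)"
  shows "C1_fun (\<lambda>x. \<Sum>i\<in>I. p i x)"
  using assms
proof (induction I rule: infinite_finite_induct)
  case (insert i I)
  then show ?case using C1_fun_axpy[of "p i" "\<lambda>x. \<Sum>i\<in>I. p i x" 1] by simp
qed (auto intro: C1_fun_const)

lemma C1_fun_prod:
  assumes "\<And>i. i \<in> I \<Longrightarrow> C1_fun (p i)"
  shows "C1_fun (\<lambda>x. \<Prod>i\<in>I. p i x)"
  using assms
  by (induction I rule: infinite_finite_induct) (auto intro: C1_fun_const C1_fun_mult)

lemma C1_fun_power: "C1_fun p \<Longrightarrow> C1_fun (\<lambda>x. p x ^ k)"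
  by (induction k) (auto intro: C1_fun_const C1_fun_mult)

lemma C1_fun_polys: "p \<in> polys m \<Longrightarrow> C1_fun p"
  unfolding polys_def
  by (auto intro!: C1_fun_sum C1_fun_mult[OF C1_fun_const] C1_fun_prod C1_fun_power C1_fun_nth)

section \<open>The least-squares reconstruction as a linear map\<close>

lemma polys_axpy:
  assumes "p \<in> polys m" "q \<in> polys m"
  shows "(\<lambda>x. p x + t * q x) \<in> polys m"
proof -
  obtain c where c: "p = (\<lambda>x. \<Sum>\<alpha> | (\<Sum>i\<in>UNIV. \<alpha> i) \<le> m. c \<alpha> * (\<Prod>i\<in>UNIV. (x $ i) ^ \<alpha> i))"
    using assms(1) by (auto simp: polys_def)
  obtain d where d: "q = (\<lambda>x. \<Sum>\<alpha> | (\<Sum>i\<in>UNIV. \<alpha> i) \<le> m. d \<alpha> * (\<Prod>i\<in>UNIV. (x $ i) ^ \<alpha> i))"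
    using assms(2) by (auto simp: polys_def)
  have "(\<lambda>x. p x + t * q x)
      = (\<lambda>x. \<Sum>\<alpha> | (\<Sum>i\<in>UNIV. \<alpha> i) \<le> m. (c \<alpha> + t * d \<alpha>) * (\<Prod>i\<in>UNIV. (x $ i) ^ \<alpha> i))"
    by (simp add: c d sum_distrib_left sum.distrib[symmetric] distrib_right mult.assoc)
  then show ?thesis unfolding polys_def by (auto intro!: exI)
qed

lemma residual_axpy:
  "residual T N w K (\<lambda>x. p x + t * q x) = residual T N w K p
    + 2 * t * (\<Sum>K'\<in>patch T N K. (p (barycenter K') - w K') * q (barycenter K'))
    + t\<^sup>2 * (\<Sum>K'\<in>patch T N K. (q (barycenter K'))\<^sup>2)"
  unfolding residual_def sum_distrib_left sum.distrib[symmetric]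
  by (intro sum.cong) (auto simp: power2_eq_square algebra_simps)

text \<open>These are the normal equations. They replace minimality by conditions linear in the pair
  of \<open>w\<close> and \<open>p\<close>, which is why the reconstruction is linear although it is
  defined by minimization.\<close>

lemma is_reconstruction_iff_orthogonal:
  "is_reconstruction T N m w K p \<longleftrightarrow>
     p \<in> polys m \<and> p (barycenter K) = w K \<and>
     (\<forall>q\<in>polys m. q (barycenter K) = 0 \<longrightarrow>
        (\<Sum>K'\<in>patch T N K. (p (barycenter K') - w K') * q (barycenter K')) = 0)"
proof (intro iffI conjI ballI impI)
  assume R: "is_reconstruction T N m w K p"
  then show "p \<in> polys m" "p (barycenter K) = w K" by (auto simp: is_reconstruction_def)
  fix q assume q: "q \<in> polys m" "q (barycenter K) = 0"
  define b where "b = (\<Sum>K'\<in>patch T N K. (p (barycenter K') - w K') * q (barycenter K'))"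
  define s where "s = (\<Sum>K'\<in>patch T N K. (q (barycenter K'))\<^sup>2)"
  have s: "0 \<le> s" by (simp add: s_def sum_nonneg)
  have min: "0 \<le> 2 * t * b + t\<^sup>2 * s" for t
  proof -
    have "residual T N w K p \<le> residual T N w K (\<lambda>x. p x + t * q x)"
      using R q polys_axpy[of p m q t] by (auto simp: is_reconstruction_def)
    then show ?thesis by (simp add: residual_axpy b_def s_def)
  qed
  \<comment> \<open>The exact minimizer would be \<open>t = - b / s\<close>; the denominator
    \<open>s + 1\<close> avoids the case \<open>s = 0\<close> and still makes the quadratic negative
    unless \<open>b = 0\<close>.\<close>
  have "2 * (- b / (s + 1)) * b + (- b / (s + 1))\<^sup>2 * s = - (b\<^sup>2 * (s + 2)) / (s + 1)\<^sup>2"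
    using s by (simp add: divide_simps) (simp add: power2_eq_square algebra_simps)
  then have "0 \<le> - (b\<^sup>2 * (s + 2)) / (s + 1)\<^sup>2" using min[of "- b / (s + 1)"] by simp
  then have "b\<^sup>2 * (s + 2) \<le> 0" using s by (simp add: divide_le_0_iff)
  then have "b = 0" using s by (simp add: mult_le_0_iff)
  then show "(\<Sum>K'\<in>patch T N K. (p (barycenter K') - w K') * q (barycenter K')) = 0"
    by (simp add: b_def)
next
  assume *: "p \<in> polys m \<and> p (barycenter K) = w K \<and>
     (\<forall>q\<in>polys m. q (barycenter K) = 0 \<longrightarrow>
        (\<Sum>K'\<in>patch T N K. (p (barycenter K') - w K') * q (barycenter K')) = 0)"
  show "is_reconstruction T N m w K p"
    unfolding is_reconstruction_def
  proof (intro conjI ballI impI)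
    fix q assume q: "q \<in> polys m" "q (barycenter K) = w K"
    define r where "r = (\<lambda>x. q x + (- 1) * p x)"
    have r: "r \<in> polys m" "r (barycenter K) = 0"
      using q * polys_axpy[of q m p "- 1"] by (auto simp: r_def)
    have "residual T N w K q = residual T N w K (\<lambda>x. p x + 1 * r x)" by (simp add: r_def)
    also have "\<dots> = residual T N w K p + (\<Sum>K'\<in>patch T N K. (r (barycenter K'))\<^sup>2)"
      unfolding residual_axpy using r * by auto
    finally show "residual T N w K p \<le> residual T N w K q" by (simp add: sum_nonneg)
  qed (use * in auto)
qed

lemma is_reconstruction_axpy:
  assumes "is_reconstruction T N m w K p" "is_reconstruction T N m w' K p'"
  shows "is_reconstruction T N m (\<lambda>K. w K + t * w' K) K (\<lambda>x. p x + t * p' x)"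
proof -
  have "(\<Sum>K'\<in>patch T N K. (p (barycenter K') + t * p' (barycenter K') - (w K' + t * w' K')) * q (barycenter K'))
     = (\<Sum>K'\<in>patch T N K. (p (barycenter K') - w K') * q (barycenter K'))
       + t * (\<Sum>K'\<in>patch T N K. (p' (barycenter K') - w' K') * q (barycenter K'))" for q
    unfolding sum_distrib_left sum.distrib[symmetric] by (intro sum.cong) (auto simp: algebra_simps)
  then show ?thesis
    using assms unfolding is_reconstruction_iff_orthogonal by (auto intro: polys_axpy)
qed

lemma patch_subset: "K \<in> T \<Longrightarrow> patch T N K \<subseteq> T"
proof -
  have "patch_layer T K t \<subseteq> T" if "K \<in> T" for t
    using that by (induction t) (auto simp: neighbours_def)
  then show "K \<in> T \<Longrightarrow> patch T N K \<subseteq> T" by (simp add: patch_def)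
qed

text \<open>The patch of an element of \<open>T\<close> stays inside \<open>T\<close>, so values of
  \<open>w\<close> at other sets never enter a residual.\<close>

lemma reconstruct_cong:
  assumes "\<And>K. K \<in> T \<Longrightarrow> w K = w' K"
  shows "reconstruct T N m w = reconstruct T N m w'"
proof -
  have "residual T N w K = residual T N w' K" if "K \<in> T" for K
    unfolding residual_def using patch_subset[OF that] assms by (fastforce intro!: sum.cong)
  then have "is_reconstruction T N m w K = is_reconstruction T N m w' K" if "K \<in> T" for K
    using assms that by (simp add: is_reconstruction_def fun_eq_iff)
  then show ?thesis by (auto simp: reconstruct_def)
qed

context
  fixes T :: "(real^'n::finite) set set" and N m :: nat
  assumes wd: "reconstruction_well_defined T N m"
begin

lemma is_reconstruction_reconstruct:
  "K \<in> T \<Longrightarrow> is_reconstruction T N m w K (reconstruct T N m w K)"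
  using wd theI'[of "is_reconstruction T N m w K"]
  by (simp add: reconstruct_def reconstruction_well_defined_def)

lemma reconstruct_eqI:
  "K \<in> T \<Longrightarrow> is_reconstruction T N m w K p \<Longrightarrow> reconstruct T N m w K = p"
  using wd is_reconstruction_reconstruct[of K w] unfolding reconstruction_well_defined_def by blast

lemma reconstruct_barycenter: "K \<in> T \<Longrightarrow> reconstruct T N m w K (barycenter K) = w K"
  using is_reconstruction_reconstruct by (auto simp: is_reconstruction_def)

lemma C1_fun_reconstruct: "C1_fun (reconstruct T N m w K)"
proof (cases "K \<in> T")
  case True
  then show ?thesis
    using is_reconstruction_reconstruct C1_fun_polys unfolding is_reconstruction_def by blast
qed (simp add: reconstruct_def C1_fun_const)

lemma reconstruct_axpy:
  "reconstruct T N m (\<lambda>K. w K + t * w' K)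
     = (\<lambda>K x. reconstruct T N m w K x + t * reconstruct T N m w' K x)"
proof
  fix K
  show "reconstruct T N m (\<lambda>K. w K + t * w' K) K
     = (\<lambda>x. reconstruct T N m w K x + t * reconstruct T N m w' K x)"
  proof (cases "K \<in> T")
    case True
    then show ?thesis
      by (intro reconstruct_eqI is_reconstruction_axpy is_reconstruction_reconstruct)
  qed (simp add: reconstruct_def)
qed

lemma reconstructed_space_axpy:
  assumes "y \<in> reconstructed_space T N m" "z \<in> reconstructed_space T N m"
  shows "(\<lambda>K x. y K x + t * z K x) \<in> reconstructed_space T N m"
proof -
  obtain w w' where "y = reconstruct T N m w" "z = reconstruct T N m w'"
    using assms by (auto simp: reconstructed_space_def)
  then show ?thesis
    using reconstruct_axpy[of w t w', symmetric] by (simp add: reconstructed_space_def)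
qed

lemma reconstructed_space_diff:
  assumes "y \<in> reconstructed_space T N m" "z \<in> reconstructed_space T N m"
  shows "(\<lambda>K x. y K x - z K x) \<in> reconstructed_space T N m"
  using reconstructed_space_axpy[OF assms, of "- 1"] by simp

lemma C1_fun_reconstructed_space: "w \<in> reconstructed_space T N m \<Longrightarrow> C1_fun (w K)"
  using C1_fun_reconstruct by (auto simp: reconstructed_space_def)

lemma zero_reconstructed_space: "(\<lambda>K x. 0) \<in> reconstructed_space T N m"
proof -
  have "reconstruct T N m (\<lambda>K. 0) \<in> reconstructed_space T N m"
    by (simp add: reconstructed_space_def)
  from reconstructed_space_axpy[OF this this, of "- 1"] show ?thesis by simp
qed

lemma reconstruct_sum:
  "finite I \<Longrightarrow> reconstruct T N m (\<lambda>K. \<Sum>i\<in>I. c i * w i K)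
     = (\<lambda>K x. \<Sum>i\<in>I. c i * reconstruct T N m (w i) K x)"
proof (induction I rule: finite_induct)
  case empty
  \<comment> \<open>Zero data minus zero data is zero data, so the reconstruction of zero equals its
    difference with itself.\<close>
  show ?case using reconstruct_axpy[of "\<lambda>K. 0" "- 1" "\<lambda>K. 0"] by simp
next
  case (insert i I)
  then show ?case
    using reconstruct_axpy[of "\<lambda>K. \<Sum>i\<in>I. c i * w i K" "c i" "w i"] by (simp add: add.commute)
qed

text \<open>The constraint at the barycenter makes \<open>w K' (barycenter K')\<close> the
  coefficient of the function reconstructed from the indicator of \<open>K'\<close>.\<close>

lemma reconstructed_space_expansion:
  assumes "finite T" "w \<in> reconstructed_space T N m"
  shows "w = (\<lambda>K x. \<Sum>K'\<in>T. w K' (barycenter K') * reconstruct T N m (\<lambda>K. if K' = K then 1 else 0) K x)"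
proof -
  obtain c where c: "w = reconstruct T N m c" using assms by (auto simp: reconstructed_space_def)
  have "w = reconstruct T N m (\<lambda>K. \<Sum>K'\<in>T. c K' * (if K' = K then 1 else 0))"
    unfolding c using assms(1) by (intro reconstruct_cong) (simp add: if_distrib cong: if_cong)
  also have "\<dots> = (\<lambda>K x. \<Sum>K'\<in>T. c K' * reconstruct T N m (\<lambda>K. if K' = K then 1 else 0) K x)"
    by (rule reconstruct_sum[OF assms(1)])
  finally have e: "w = (\<lambda>K x. \<Sum>K'\<in>T. c K' * reconstruct T N m (\<lambda>K. if K' = K then 1 else 0) K x)" .
  have "w K' (barycenter K') = c K'" if "K' \<in> T" for K'
    using reconstruct_barycenter[OF that] by (simp add: c)
  then have "(\<lambda>K x. \<Sum>K'\<in>T. w K' (barycenter K') * reconstruct T N m (\<lambda>K. if K' = K then 1 else 0) K x)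
      = (\<lambda>K x. \<Sum>K'\<in>T. c K' * reconstruct T N m (\<lambda>K. if K' = K then 1 else 0) K x)"
    by (intro ext sum.cong) auto
  then show ?thesis using e by argo
qed

end

text \<open>\<open>V\<close> is arbitrary because the lemma serves both the reconstructed space and
  the families of continuous functions behind \<open>piecewise_constants\<close>.\<close>

lemma linear_on_broken_sum:
  fixes F :: "'n::finite broken \<Rightarrow> 'b::real_vector"
  assumes V: "\<And>y z t. y \<in> V \<Longrightarrow> z \<in> V \<Longrightarrow> (\<lambda>K x. y K x + t * z K x) \<in> V" "(\<lambda>K x. 0) \<in> V"
    and F: "\<And>y z t. y \<in> V \<Longrightarrow> z \<in> V \<Longrightarrow> F (\<lambda>K x. y K x + t * z K x) = F y + t *\<^sub>R F z"
    and "finite I" "\<And>i. i \<in> I \<Longrightarrow> e i \<in> V"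
  shows "(\<lambda>K x. \<Sum>i\<in>I. c i * e i K x) \<in> V"
    and "F (\<lambda>K x. \<Sum>i\<in>I. c i * e i K x) = (\<Sum>i\<in>I. c i *\<^sub>R F (e i))"
proof -
  have "(\<lambda>K x. \<Sum>i\<in>I. c i * e i K x) \<in> V \<and> F (\<lambda>K x. \<Sum>i\<in>I. c i * e i K x) = (\<Sum>i\<in>I. c i *\<^sub>R F (e i))"
    using assms(4,5)
  proof (induction I rule: finite_induct)
    case empty
    show ?case using F[OF V(2) V(2), of "- 1"] V(2) by simp
  next
    case (insert i I)
    then have *: "(\<lambda>K x. \<Sum>i\<in>I. c i * e i K x) \<in> V" "e i \<in> V" by auto
    have "(\<lambda>K x. \<Sum>i\<in>insert i I. c i * e i K x) = (\<lambda>K x. (\<Sum>i\<in>I. c i * e i K x) + c i * e i K x)"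
      using insert.hyps by (simp add: add.commute)
    then show ?case using V(1)[OF *] F[OF *] insert by simp
  qed
  then show "(\<lambda>K x. \<Sum>i\<in>I. c i * e i K x) \<in> V"
    "F (\<lambda>K x. \<Sum>i\<in>I. c i * e i K x) = (\<Sum>i\<in>I. c i *\<^sub>R F (e i))" by auto
qed

subsection \<open>Integrals over elements and faces\<close>

text \<open>The measure is kept general enough to cover Lebesgue measure on elements, which has more
  measurable sets than the Borel ones, and the hyperplane measures on faces.\<close>

lemma set_integrable_compact_continuous:
  fixes f :: "'a::{second_countable_topology,t2_space} \<Rightarrow> 'b::{banach,second_countable_topology}"
  assumes M: "sets borel \<subseteq> sets M" "space M = UNIV" "emeasure M S < \<infinity>"
    and S: "compact S" "continuous_on S f"
  shows "set_integrable M S f"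
proof -
  have bS: "S \<in> sets borel" using S by (simp add: borel_compact)
  obtain B where B: "\<And>x. x \<in> S \<Longrightarrow> norm (f x) \<le> B"
    using compact_imp_bounded[OF compact_continuous_image[OF S(2,1)]] by (auto simp: bounded_iff)
  have "(\<lambda>x. indicator S x *\<^sub>R f x) \<in> borel_measurable borel"
    by (rule borel_measurable_continuous_on_indicator[OF bS S(2)])
  then have "(\<lambda>x. indicator S x *\<^sub>R f x) \<in> borel_measurable M"
    using M(1,2) unfolding measurable_def by auto
  then show ?thesis
    unfolding set_integrable_def
    by (intro integrableI_bounded_set[where A = S and B = "max B 0"])
       (use M bS in \<open>auto simp: indicator_def intro!: AE_I2 max.coboundedI1 B\<close>)
qed

lemma set_integrable_lebesgue_compact:
  fixes f :: "'a::euclidean_space \<Rightarrow> real"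
  assumes "compact S" "continuous_on S f"
  shows "set_integrable lebesgue S f"
  using assms emeasure_bounded_finite[OF compact_imp_bounded[OF assms(1)]]
  by (intro set_integrable_compact_continuous) (auto simp: borel_compact)

lemma emeasure_hyperplane_measure:
  assumes "E \<in> sets borel"
  shows "emeasure (hyperplane_measure a b) E
    = emeasure lborel {x. b \<le> a \<bullet> x \<and> a \<bullet> x \<le> b + 1 \<and> x - (a \<bullet> x - b) *\<^sub>R a \<in> E}"
proof -
  define S where "S = {x. b \<le> a \<bullet> x \<and> a \<bullet> x \<le> b + 1}"
  define P where "P = (\<lambda>x. x - (a \<bullet> x - b) *\<^sub>R a)"
  have S: "S \<in> sets borel"
    unfolding S_def by measurable
  have P: "P \<in> borel_measurable borel"
    unfolding P_def by measurable
  have "emeasure (hyperplane_measure a b) E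
      = emeasure (restrict_space lborel S) (P -` E \<inter> space (restrict_space lborel S))"
    unfolding hyperplane_measure_def S_def[symmetric] P_def[symmetric]
    using P assms by (intro emeasure_distr) (auto intro!: measurable_restrict_space1)
  also have "\<dots> = emeasure lborel (P -` E \<inter> S)"
    using S by (subst emeasure_restrict_space) (auto simp: space_restrict_space)
  also have "P -` E \<inter> S = {x. b \<le> a \<bullet> x \<and> a \<bullet> x \<le> b + 1 \<and> x - (a \<bullet> x - b) *\<^sub>R a \<in> E}"
    by (auto simp: S_def P_def)
  finally show ?thesis .
qed

text \<open>The slab has thickness one, so a point of it projecting into \<open>E\<close> is within
  distance one of \<open>E\<close>, and the preimage is bounded.\<close>

lemma emeasure_hyperplane_measure_finite:
  assumes "compact E" "norm a = 1"
  shows "emeasure (hyperplane_measure a b) E < \<infinity>"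
proof -
  obtain B where B: "\<And>x. x \<in> E \<Longrightarrow> norm x \<le> B"
    using compact_imp_bounded[OF assms(1)] by (auto simp: bounded_iff)
  have "norm x \<le> B + 1" if "b \<le> a \<bullet> x" "a \<bullet> x \<le> b + 1" "x - (a \<bullet> x - b) *\<^sub>R a \<in> E" for x
  proof -
    have "norm x \<le> norm (x - (a \<bullet> x - b) *\<^sub>R a) + norm ((a \<bullet> x - b) *\<^sub>R a)"
      by (metis diff_add_cancel norm_triangle_ineq)
    also have "\<dots> \<le> B + 1" using B[OF that(3)] that assms(2) by (intro add_mono) auto
    finally show ?thesis .
  qed
  then have "bounded {x. b \<le> a \<bullet> x \<and> a \<bullet> x \<le> b + 1 \<and> x - (a \<bullet> x - b) *\<^sub>R a \<in> E}"
    by (auto simp: bounded_iff)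
  then show ?thesis
    using assms emeasure_bounded_finite by (subst emeasure_hyperplane_measure) (auto simp: borel_compact)
qed

text \<open>The choice in \<open>face_measure\<close> does not prescribe the orientation of the
  normal, and reversing it moves the slab to the other side. Later facts therefore have to hold for
  whichever pair was chosen.\<close>

lemma face_measure_cases:
  assumes "norm a = 1" "e \<subseteq> {x. a \<bullet> x = b}"
  obtains a' b' where "norm a' = 1" "e \<subseteq> {x. a' \<bullet> x = b'}" "face_measure e = hyperplane_measure a' b'"
proof -
  have "\<exists>a b. norm a = 1 \<and> e \<subseteq> {x. a \<bullet> x = b} \<and> face_measure e = hyperplane_measure a b"
    unfolding face_measure_def
    by (rule someI_ex[where P = "\<lambda>M. \<exists>a b. norm a = 1 \<and> e \<subseteq> {x. a \<bullet> x = b} \<and> M = hyperplane_measure a b"])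
       (use assms in blast)
  then show ?thesis using that by blast
qed

lemma set_integrable_face:
  fixes f :: "real^'n::finite \<Rightarrow> real"
  assumes "norm a = 1" "e \<subseteq> {x. a \<bullet> x = b}" "compact e" "continuous_on e f"
  shows "set_integrable (face_measure e) e f"
proof -
  obtain a' b' where *: "norm a' = 1" "face_measure e = hyperplane_measure a' b'"
    using face_measure_cases[OF assms(1,2)] by metis
  show ?thesis
    unfolding *(2) using assms(3,4) emeasure_hyperplane_measure_finite[OF assms(3) *(1)]
    by (intro set_integrable_compact_continuous) (auto simp: hyperplane_measure_def)
qed

lemma facet_of_polytope_hyperplane:
  fixes K :: "'a::euclidean_space set"
  assumes "polytope K" "e facet_of K"
  obtains a b where "norm a = 1" "e \<subseteq> {x. a \<bullet> x = b}"
proof -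
  obtain a b where ab: "a \<noteq> 0" "e = K \<inter> {x. a \<bullet> x = b}"
    using facet_of_polyhedron[OF polytope_imp_polyhedron[OF assms(1)] assms(2)] by metis
  have "norm (a /\<^sub>R norm a) = 1" "e \<subseteq> {x. (a /\<^sub>R norm a) \<bullet> x = b / norm a}"
    using ab by (auto simp: divide_inverse)
  then show ?thesis using that by blast
qed

lemma set_integral_axpy:
  fixes f g :: "'a \<Rightarrow> real"
  assumes "set_integrable M S f" "set_integrable M S g"
  shows "(LINT x:S|M. f x + t * g x) = (LINT x:S|M. f x) + t * (LINT x:S|M. g x)"
  using assms by (simp add: set_integral_add set_integrable_mult_right)

subsection \<open>Square-integrable representatives\<close>

lemma sq_integrable_rep_l2: "sq_integrable (rep_l2 u)"
  using Quotient3_rep_reflp[OF Quotient3_l2, of u] by (simp add: l2_rel_def)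

lemma AE_rep_abs_l2: "sq_integrable f \<Longrightarrow> AE x in lebesgue. rep_l2 (abs_l2 f) x = f x"
  using Quotient3_rep_abs[OF Quotient3_l2, of f] by (simp add: l2_rel_def)

lemma inner_abs_l2: "sq_integrable f \<Longrightarrow> u \<bullet> abs_l2 f = (\<integral>x. rep_l2 u x * f x \<partial>lebesgue)"
  using inner_l2.abs_eq[of "rep_l2 u" f] Quotient3_abs_rep[OF Quotient3_l2, of u]
  by (simp add: l2_rel_def sq_integrable_rep_l2)

lemma sq_integrable_sum:
  "(\<And>i. i \<in> I \<Longrightarrow> sq_integrable (f i)) \<Longrightarrow> sq_integrable (\<lambda>x. \<Sum>i\<in>I. f i x)"
  by (induction I rule: infinite_finite_induct) (auto simp: sq_integrable_0 sq_integrable_add)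

lemma sq_integrable_indicator_interior:
  fixes f :: "'a::euclidean_space \<Rightarrow> real"
  assumes "compact K" "continuous_on K f"
  shows "sq_integrable (\<lambda>x. indicator (interior K) x * f x)"
proof -
  have 1: "continuous_on (interior K) f"
    using assms(2) interior_subset by (rule continuous_on_subset)
  have "(\<lambda>x. indicator (interior K) x *\<^sub>R f x) \<in> borel_measurable borel"
    by (rule borel_measurable_continuous_on_indicator[OF _ 1]) auto
  then have m: "(\<lambda>x. indicator (interior K) x * f x) \<in> borel_measurable lebesgue"
    by (simp add: measurable_completion)
  have "set_integrable lebesgue K (\<lambda>x. (f x)\<^sup>2)"
    using assms by (intro set_integrable_lebesgue_compact continuous_intros)
  then have "integrable lebesgue (\<lambda>x. (indicator (interior K) x * f x)\<^sup>2)"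
    unfolding set_integrable_def
    by (rule Bochner_Integration.integrable_bound)
       (use m interior_subset[of K] in \<open>auto simp: indicator_def power2_eq_square\<close>)
  then show ?thesis using m by (simp add: sq_integrable_def)
qed

lemma sq_integrable_broken:
  assumes "\<And>K. K \<in> T \<Longrightarrow> compact K" "\<And>K. K \<in> T \<Longrightarrow> continuous_on K (w K)"
  shows "sq_integrable (\<lambda>x. \<Sum>K\<in>T. indicator (interior K) x * w K x)"
  using assms by (intro sq_integrable_sum sq_integrable_indicator_interior)

lemma broken_l2_axpy:
  assumes "\<And>K. K \<in> T \<Longrightarrow> compact K"
    "\<And>K. K \<in> T \<Longrightarrow> continuous_on K (y K)" "\<And>K. K \<in> T \<Longrightarrow> continuous_on K (z K)"
  shows "broken_l2 T (\<lambda>K x. y K x + t * z K x) = broken_l2 T y + t *\<^sub>R broken_l2 T z"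
proof -
  have "(\<lambda>x. \<Sum>K\<in>T. indicator (interior K) x * (y K x + t * z K x))
    = (\<lambda>x. (\<Sum>K\<in>T. indicator (interior K) x * y K x) + t * (\<Sum>K\<in>T. indicator (interior K) x * z K x))"
    by (simp add: sum_distrib_left sum.distrib[symmetric] algebra_simps)
  then show ?thesis
    using sq_integrable_broken[of T y] sq_integrable_broken[of T z] assms
    by (simp add: broken_l2_def plus_l2.abs_eq scaleR_l2.abs_eq l2_rel_def sq_integrable_scale)
qed

text \<open>The interiors of the elements lie in \<Omega>, since an open convex set is the interior
  of its closure.\<close>

lemma broken_l2_mem_L2_on:
  assumes "\<And>K. K \<in> T \<Longrightarrow> compact K" "\<And>K. K \<in> T \<Longrightarrow> continuous_on K (w K)"
    and "\<Union>T = closure \<Omega>" "open \<Omega>" "convex \<Omega>"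
  shows "broken_l2 T w \<in> L2_on \<Omega>"
proof -
  have "interior K \<subseteq> \<Omega>" if "K \<in> T" for K
  proof -
    have "interior K \<subseteq> interior (closure \<Omega>)" using that assms(3) by (intro interior_mono) auto
    then show ?thesis using assms by (simp add: convex_interior_closure interior_open)
  qed
  then have "x \<notin> \<Omega> \<longrightarrow> (\<Sum>K\<in>T. indicator (interior K) x * w K x) = 0" for x
    by (intro impI sum.neutral) (auto simp: indicator_def)
  with AE_rep_abs_l2[OF sq_integrable_broken[of T w]] assms show ?thesis
    by (auto simp: L2_on_def broken_l2_def)
qed

lemma L2_on_diff:
  assumes "u \<in> L2_on \<Omega>" "v \<in> L2_on \<Omega>"
  shows "u - v \<in> L2_on \<Omega>"
proof -
  have "u - v = abs_l2 (\<lambda>x. rep_l2 u x - rep_l2 v x)"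
    using minus_l2.abs_eq[of "rep_l2 u" "rep_l2 v"]
    by (simp add: l2_rel_def sq_integrable_rep_l2 Quotient3_abs_rep[OF Quotient3_l2])
  moreover have "sq_integrable (\<lambda>x. rep_l2 u x - rep_l2 v x)"
    using sq_integrable_add[OF sq_integrable_rep_l2[of u] sq_integrable_scale[OF sq_integrable_rep_l2[of v], of "- 1"]]
    by simp
  ultimately have "AE x in lebesgue. rep_l2 (u - v) x = rep_l2 u x - rep_l2 v x"
    using AE_rep_abs_l2 by simp
  with assms show ?thesis by (auto simp: L2_on_def)
qed

text \<open>\<open>broken_l2\<close> uses the interiors of the elements, the load term the closed
  elements; they differ by frontiers of convex sets, which are negligible.\<close>

lemma inner_broken_l2:
  assumes K: "\<And>K. K \<in> T \<Longrightarrow> compact K" "\<And>K. K \<in> T \<Longrightarrow> convex K"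
    and w: "\<And>K. K \<in> T \<Longrightarrow> continuous_on K (w K)"
  shows "s \<bullet> broken_l2 T w = (\<Sum>K\<in>T. LINT x:K|lebesgue. rep_l2 s x * w K x)"
proof -
  have "s \<bullet> broken_l2 T w = (\<integral>x. (\<Sum>K\<in>T. rep_l2 s x * (indicator (interior K) x * w K x)) \<partial>lebesgue)"
    using sq_integrable_broken[of T w] K w by (simp add: broken_l2_def inner_abs_l2 sum_distrib_left)
  also have "\<dots> = (\<Sum>K\<in>T. \<integral>x. rep_l2 s x * (indicator (interior K) x * w K x) \<partial>lebesgue)"
    using K w by (intro Bochner_Integration.integral_sum sq_integrable_mult sq_integrable_rep_l2
        sq_integrable_indicator_interior)
  also have "\<dots> = (\<Sum>K\<in>T. LINT x:K|lebesgue. rep_l2 s x * w K x)"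
  proof (rule sum.cong[OF refl])
    fix k assume k: "k \<in> T"
    have rep: "rep_l2 s \<in> borel_measurable lebesgue"
      using sq_integrable_rep_l2[of s] by (simp add: sq_integrable_def)
    have "(\<lambda>x. indicator k x *\<^sub>R w k x) \<in> borel_measurable borel"
      using K(1)[OF k] w[OF k] by (intro borel_measurable_continuous_on_indicator) (auto simp: borel_compact)
    then have wm: "(\<lambda>x. indicator k x * w k x) \<in> borel_measurable lebesgue"
      by (simp add: measurable_completion)
    have "frontier k \<in> null_sets lebesgue"
      using negligible_convex_frontier[OF K(2)[OF k]] negligible_iff_null_sets by blast
    then have "AE x in lebesgue. x \<notin> frontier k" by (rule AE_not_in)
    then have "AE x in lebesgue. rep_l2 s x * (indicator (interior k) x * w k x)
        = rep_l2 s x * (indicator k x * w k x)"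
      by eventually_elim
        (use K(1)[OF k] interior_subset[of k] in \<open>auto simp: indicator_def frontier_def compact_imp_closed\<close>)
    moreover have "(\<lambda>x. rep_l2 s x * (indicator (interior k) x * w k x)) \<in> borel_measurable lebesgue"
      using sq_integrable_mult[OF sq_integrable_rep_l2 sq_integrable_indicator_interior[OF K(1)[OF k] w[OF k]], of s]
      by (rule borel_measurable_integrable)
    ultimately have "(\<integral>x. rep_l2 s x * (indicator (interior k) x * w k x) \<partial>lebesgue)
        = (\<integral>x. rep_l2 s x * (indicator k x * w k x) \<partial>lebesgue)"
      using rep wm by (intro integral_cong_AE) auto
    then show "(\<integral>x. rep_l2 s x * (indicator (interior k) x * w k x) \<partial>lebesgue)
        = (LINT x:k|lebesgue. rep_l2 s x * w k x)"
      by (simp add: set_lebesgue_integral_def mult_ac)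
  qed
  finally show ?thesis .
qed

subsection \<open>Bilinearity of the discontinuous Galerkin form\<close>

lemma jump_axpy: "jump T (\<lambda>K x. y K x + t * z K x) e x = jump T y e x + t *\<^sub>R jump T z e x"
  by (simp add: jump_def scaleR_sum_right sum.distrib[symmetric] algebra_simps)

lemma average_axpy:
  assumes "\<And>K. \<tau> K x = \<sigma> K x + t *\<^sub>R \<upsilon> K x"
  shows "average T \<tau> e x = average T \<sigma> e x + t *\<^sub>R average T \<upsilon> e x"
  by (simp add: average_def assms sum.distrib scaleR_sum_right[symmetric] algebra_simps)

lemma flux_axpy:
  assumes "C1_fun (y K)" "C1_fun (z K)"
  shows "flux A (\<lambda>K x. y K x + t * z K x) K x = flux A y K x + t *\<^sub>R flux A z K x"
  using grad_axpy[OF assms, of t]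
  by (simp add: flux_def matrix_vector_right_distrib matrix_vector_mult_scaleR)

lemma average_flux_axpy:
  assumes "\<And>K. C1_fun (y K)" "\<And>K. C1_fun (z K)"
  shows "average T (flux A (\<lambda>K x. y K x + t * z K x)) e x
    = average T (flux A y) e x + t *\<^sub>R average T (flux A z) e x"
  by (rule average_axpy) (rule flux_axpy[OF assms])

lemma continuous_on_jump: "(\<And>K. C1_fun (w K)) \<Longrightarrow> continuous_on S (jump T w e)"
  unfolding jump_def by (auto intro!: continuous_intros C1_fun_continuous_on)

lemma continuous_on_flux:
  assumes "continuous_on S A" "C1_fun (w K)"
  shows "continuous_on S (flux A w K)"
  unfolding flux_def[abs_def] matrix_vector_mult_def
  by (intro continuous_intros continuous_on_component assms C1_fun_continuous_on)

lemma continuous_on_average: "(\<And>K. continuous_on S (\<tau> K)) \<Longrightarrow> continuous_on S (average T \<tau> e)"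
  unfolding average_def by (auto intro!: continuous_intros)

text \<open>Face integrals evaluate \<open>A\<close> on sets of volume zero and so depend on its
  representative; continuity up to the boundary selects one and makes the face integrands
  integrable.\<close>

locale dg_setting =
  fixes \<Omega> :: "(real^'n::finite) set" and T :: "(real^'n) set set" and A :: "real^'n \<Rightarrow> real^'n^'n"
  assumes domain: "convex_polyhedral_domain \<Omega>" and mesh: "simplicial_mesh \<Omega> T"
    and A_cont: "continuous_on (closure \<Omega>) A"
begin

lemma finite_T: "finite T"
  using mesh by (simp add: simplicial_mesh_def triangulation_def)

lemma element:
  assumes "K \<in> T"
  shows "polytope K" "compact K" "convex K" "interior K \<noteq> {}" "K \<subseteq> closure \<Omega>"
proof -
  have s: "int CARD('n) simplex K" using assms mesh by (simp add: simplicial_mesh_def)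
  show p: "polytope K" using s by (rule simplex_imp_polytope)
  show "compact K" "convex K" using p by (simp_all add: polytope_imp_compact polytope_imp_convex)
  have "aff_dim K = int DIM(real^'n)" using aff_dim_simplex[OF s] by simp
  then have "affine hull K = UNIV" by (simp only: aff_dim_eq_full)
  moreover have "rel_interior K \<noteq> {}"
    using \<open>convex K\<close> \<open>affine hull K = UNIV\<close> by (auto simp: rel_interior_eq_empty)
  ultimately show "interior K \<noteq> {}" by (simp add: rel_interior_interior)
  show "K \<subseteq> closure \<Omega>" using assms mesh by (auto simp: simplicial_mesh_def)
qed

lemma face:
  assumes "e \<in> faces T"
  shows "compact e" "e \<subseteq> closure \<Omega>" "\<exists>a b. norm a = 1 \<and> e \<subseteq> {x. a \<bullet> x = b}"
proof -
  obtain K where K: "K \<in> T" "e facet_of K" using assms by (auto simp: faces_def)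
  note k = element[OF K(1)]
  have "e face_of K" using K(2) by (rule facet_of_imp_face_of)
  then show "compact e" using k face_of_imp_compact by blast
  show "e \<subseteq> closure \<Omega>" using k(5) facet_of_imp_subset[OF K(2)] by blast
  show "\<exists>a b. norm a = 1 \<and> e \<subseteq> {x. a \<bullet> x = b}"
    using facet_of_polytope_hyperplane[OF k(1) K(2)] by metis
qed

lemma set_integrable_faces:
  fixes f :: "real^'n \<Rightarrow> real"
  shows "e \<in> faces T \<Longrightarrow> continuous_on e f \<Longrightarrow> set_integrable (face_measure e) e f"
  using face set_integrable_face by metis

lemma A_cont_on: "K \<in> T \<Longrightarrow> continuous_on K A" "e \<in> faces T \<Longrightarrow> continuous_on e A"
  using continuous_on_subset[OF A_cont] element(5) face(2) by simp_all

text \<open>Additivity of the integral needs integrability of each part, which comes from continuity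
  of the integrands on compact elements and faces.\<close>

lemma a_h_axpy_left:
  assumes "\<And>K. C1_fun (y K)" "\<And>K. C1_fun (z K)" "\<And>K. C1_fun (w K)"
  shows "a_h T A \<mu> (\<lambda>K x. y K x + t * z K x) w = a_h T A \<mu> y w + t * a_h T A \<mu> z w"
proof -
  note c = continuous_on_jump continuous_on_average continuous_on_flux A_cont_on assms C1_fun_continuous_on
  have 1: "(LINT x:K|lebesgue. flux A (\<lambda>K x. y K x + t * z K x) K x \<bullet> grad (w K) x)
      = (LINT x:K|lebesgue. flux A y K x \<bullet> grad (w K) x) + t * (LINT x:K|lebesgue. flux A z K x \<bullet> grad (w K) x)"
    if "K \<in> T" for K
    unfolding flux_axpy[OF assms(1,2)] inner_add_left inner_scaleR_left
    by (intro set_integral_axpy set_integrable_lebesgue_compact element that continuous_intros c)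
  have 2: "face_integral e (\<lambda>x. average T (flux A (\<lambda>K x. y K x + t * z K x)) e x \<bullet> jump T w e x)
      = face_integral e (\<lambda>x. average T (flux A y) e x \<bullet> jump T w e x)
        + t * face_integral e (\<lambda>x. average T (flux A z) e x \<bullet> jump T w e x)" if "e \<in> faces T" for e
    unfolding average_flux_axpy[OF assms(1,2)]
      inner_add_left inner_scaleR_left
    by (intro set_integral_axpy set_integrable_faces that continuous_intros c)
  have 3: "face_integral e (\<lambda>x. average T (flux A w) e x \<bullet> jump T (\<lambda>K x. y K x + t * z K x) e x)
      = face_integral e (\<lambda>x. average T (flux A w) e x \<bullet> jump T y e x)
        + t * face_integral e (\<lambda>x. average T (flux A w) e x \<bullet> jump T z e x)" if "e \<in> faces T" for e
    unfolding jump_axpy inner_add_right inner_scaleR_right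
    by (intro set_integral_axpy set_integrable_faces that continuous_intros c)
  have 4: "face_integral e (\<lambda>x. jump T (\<lambda>K x. y K x + t * z K x) e x \<bullet> jump T w e x)
      = face_integral e (\<lambda>x. jump T y e x \<bullet> jump T w e x)
        + t * face_integral e (\<lambda>x. jump T z e x \<bullet> jump T w e x)" if "e \<in> faces T" for e
    unfolding jump_axpy inner_add_left inner_scaleR_left
    by (intro set_integral_axpy set_integrable_faces that continuous_intros c)
  show ?thesis
    unfolding a_h_def by (simp add: 1 2 3 4 sum.distrib sum_distrib_left algebra_simps)
qed

lemma a_h_axpy_right:
  assumes "\<And>K. C1_fun (y K)" "\<And>K. C1_fun (z K)" "\<And>K. C1_fun (w K)"
  shows "a_h T A \<mu> w (\<lambda>K x. y K x + t * z K x) = a_h T A \<mu> w y + t * a_h T A \<mu> w z"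
proof -
  note c = continuous_on_jump continuous_on_average continuous_on_flux A_cont_on assms C1_fun_continuous_on
  have 1: "(LINT x:K|lebesgue. flux A w K x \<bullet> grad (\<lambda>x. y K x + t * z K x) x)
      = (LINT x:K|lebesgue. flux A w K x \<bullet> grad (y K) x) + t * (LINT x:K|lebesgue. flux A w K x \<bullet> grad (z K) x)"
    if "K \<in> T" for K
    unfolding grad_axpy[OF assms(1,2)] inner_add_right inner_scaleR_right
    by (intro set_integral_axpy set_integrable_lebesgue_compact element that continuous_intros c)
  have 2: "face_integral e (\<lambda>x. average T (flux A (\<lambda>K x. y K x + t * z K x)) e x \<bullet> jump T w e x)
      = face_integral e (\<lambda>x. average T (flux A y) e x \<bullet> jump T w e x)
        + t * face_integral e (\<lambda>x. average T (flux A z) e x \<bullet> jump T w e x)" if "e \<in> faces T" for e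
    unfolding average_flux_axpy[OF assms(1,2)]
      inner_add_left inner_scaleR_left
    by (intro set_integral_axpy set_integrable_faces that continuous_intros c)
  have 3: "face_integral e (\<lambda>x. average T (flux A w) e x \<bullet> jump T (\<lambda>K x. y K x + t * z K x) e x)
      = face_integral e (\<lambda>x. average T (flux A w) e x \<bullet> jump T y e x)
        + t * face_integral e (\<lambda>x. average T (flux A w) e x \<bullet> jump T z e x)" if "e \<in> faces T" for e
    unfolding jump_axpy inner_add_right inner_scaleR_right
    by (intro set_integral_axpy set_integrable_faces that continuous_intros c)
  have 4: "face_integral e (\<lambda>x. jump T w e x \<bullet> jump T (\<lambda>K x. y K x + t * z K x) e x)
      = face_integral e (\<lambda>x. jump T w e x \<bullet> jump T y e x)
        + t * face_integral e (\<lambda>x. jump T w e x \<bullet> jump T z e x)" if "e \<in> faces T" for e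
    unfolding jump_axpy inner_add_right inner_scaleR_right
    by (intro set_integral_axpy set_integrable_faces that continuous_intros c)
  show ?thesis
    unfolding a_h_def by (simp add: 1 2 3 4 sum.distrib sum_distrib_left algebra_simps)
qed

text \<open>Separates the source from the boundary data, so that the latter cancel when two problems
  with the same \<phi> are subtracted.\<close>

lemma l_h_eq_inner:
  assumes "\<And>K. C1_fun (w K)"
  shows "l_h \<Omega> T A \<mu> s \<phi> w = s \<bullet> broken_l2 T w + l_h \<Omega> T A \<mu> 0 \<phi> w"
proof -
  have "r \<bullet> broken_l2 T w = (\<Sum>K\<in>T. LINT x:K|lebesgue. rep_l2 r x * w K x)" for r
    using element assms by (intro inner_broken_l2 C1_fun_continuous_on)
  from this[of s] this[of 0] show ?thesis by (simp add: l_h_def)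
qed

lemma broken_l2_axpy':
  assumes "\<And>K. C1_fun (y K)" "\<And>K. C1_fun (z K)"
  shows "broken_l2 T (\<lambda>K x. y K x + t * z K x) = broken_l2 T y + t *\<^sub>R broken_l2 T z"
  using element assms by (intro broken_l2_axpy C1_fun_continuous_on)

lemma l_h_axpy:
  assumes "continuous_on (frontier \<Omega>) \<phi>" "\<And>K. C1_fun (y K)" "\<And>K. C1_fun (z K)"
  shows "l_h \<Omega> T A \<mu> s \<phi> (\<lambda>K x. y K x + t * z K x) = l_h \<Omega> T A \<mu> s \<phi> y + t * l_h \<Omega> T A \<mu> s \<phi> z"
proof -
  note c = continuous_on_jump continuous_on_average continuous_on_flux A_cont_on assms(2,3) C1_fun_continuous_on
  have f: "continuous_on e \<phi>" "e \<in> faces T" if "e \<in> boundary_faces \<Omega> T" for e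
    using that assms(1) continuous_on_subset by (auto simp: boundary_faces_def)
  let ?n = "outward_normal (closure \<Omega>)"
  have 1: "face_integral e (\<lambda>x. (average T (flux A (\<lambda>K x. y K x + t * z K x)) e x \<bullet> ?n e) * \<phi> x)
      = face_integral e (\<lambda>x. (average T (flux A y) e x \<bullet> ?n e) * \<phi> x)
        + t * face_integral e (\<lambda>x. (average T (flux A z) e x \<bullet> ?n e) * \<phi> x)" if "e \<in> boundary_faces \<Omega> T" for e
    unfolding average_flux_axpy[OF assms(2,3)]
      inner_add_left inner_scaleR_left distrib_right mult.assoc
    by (intro set_integral_axpy set_integrable_faces continuous_intros c f that)
  have 2: "face_integral e (\<lambda>x. (jump T (\<lambda>K x. y K x + t * z K x) e x \<bullet> ?n e) * \<phi> x)
      = face_integral e (\<lambda>x. (jump T y e x \<bullet> ?n e) * \<phi> x)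
        + t * face_integral e (\<lambda>x. (jump T z e x \<bullet> ?n e) * \<phi> x)" if "e \<in> boundary_faces \<Omega> T" for e
    unfolding jump_axpy inner_add_left inner_scaleR_left distrib_right mult.assoc
    by (intro set_integral_axpy set_integrable_faces continuous_intros c f that)
  have "r \<bullet> broken_l2 T w = (\<Sum>K\<in>T. LINT x:K|lebesgue. rep_l2 r x * w K x)" if "\<And>K. C1_fun (w K)" for r w
    using element that by (intro inner_broken_l2 C1_fun_continuous_on)
  from this[of "\<lambda>K x. y K x + t * z K x" s] this[of y s] this[of z s]
  have 3: "(\<Sum>K\<in>T. LINT x:K|lebesgue. rep_l2 s x * (y K x + t * z K x))
     = (\<Sum>K\<in>T. LINT x:K|lebesgue. rep_l2 s x * y K x) + t * (\<Sum>K\<in>T. LINT x:K|lebesgue. rep_l2 s x * z K x)"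
    using assms broken_l2_axpy'[of y z t] by (simp add: C1_fun_axpy inner_add_right)
  show ?thesis
    unfolding l_h_def 3
    by (simp only: 1 2 cong: sum.cong) (simp add: sum.distrib sum_distrib_left algebra_simps)
qed

end

subsection \<open>Definiteness of the discontinuous Galerkin norm\<close>

text \<open>Inside the ball the element is exactly one side of the hyperplane of \<open>e\<close>.
  From such a chart follow the value of the outward normal, the positive surface measure of
  \<open>e\<close> and the position of a neighbouring element.\<close>

definition facet_chart ::
    "'a::euclidean_space set \<Rightarrow> 'a set \<Rightarrow> 'a \<Rightarrow> 'a \<Rightarrow> real \<Rightarrow> bool" where
  "facet_chart K e z \<nu> r \<longleftrightarrow> norm \<nu> = 1 \<and> 0 < r \<and> z \<in> e \<and>
     K \<subseteq> {x. \<nu> \<bullet> x \<le> \<nu> \<bullet> z} \<and> e = K \<inter> {x. \<nu> \<bullet> x = \<nu> \<bullet> z} \<and>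
     (\<forall>x\<in>ball z r. \<nu> \<bullet> x \<le> \<nu> \<bullet> z \<longrightarrow> x \<in> K)"

text \<open>In an irredundant description of \<open>K\<close> by half-spaces, each half-space cuts
  out a facet. As \<open>z\<close> lies on no facet but \<open>e\<close>, all inequalities except
  that of \<open>e\<close> are strict at \<open>z\<close> and stay strict on a ball, where
  membership in \<open>K\<close> is then decided by one half-space.\<close>

lemma facet_chart_exists:
  fixes K :: "'a::euclidean_space set"
  assumes "polytope K" "interior K \<noteq> {}" "e facet_of K" "z \<in> e"
    and only: "\<And>e'. e' facet_of K \<Longrightarrow> z \<in> e' \<Longrightarrow> e' = e"
  obtains \<nu> r where "facet_chart K e z \<nu> r"
proof -
  have aff: "affine hull K = UNIV" using assms(2) by (rule affine_hull_nonempty_interior)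
  obtain F where "finite F" and K: "K = affine hull K \<inter> \<Inter>F"
    and "\<forall>h\<in>F. \<exists>a b. a \<noteq> 0 \<and> h = {x. a \<bullet> x \<le> b}"
    and min: "\<And>F'. F' \<subset> F \<Longrightarrow> K \<subset> affine hull K \<inter> \<Inter>F'"
    using polytope_imp_polyhedron[OF assms(1)] unfolding polyhedron_Int_affine_minimal by meson
  then obtain a b where ab: "\<And>h. h \<in> F \<Longrightarrow> a h \<noteq> 0 \<and> h = {x. a h \<bullet> x \<le> b h}" by metis
  note facets = facet_of_polyhedron_explicit[OF \<open>finite F\<close> K ab min]
  have KF: "x \<in> K \<longleftrightarrow> (\<forall>h\<in>F. a h \<bullet> x \<le> b h)" for x
  proof -
    have "x \<in> K \<longleftrightarrow> (\<forall>h\<in>F. x \<in> h)" by (subst K) (simp add: aff)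
    also have "\<dots> \<longleftrightarrow> (\<forall>h\<in>F. a h \<bullet> x \<le> b h)" using ab by blast
    finally show ?thesis .
  qed
  obtain h where h: "h \<in> F" "e = K \<inter> {x. a h \<bullet> x = b h}" using assms(3) facets by blast
  have zK: "z \<in> K" "a h \<bullet> z = b h" using assms(4) h by auto
  define U where "U = (\<Inter>h'\<in>F - {h}. {x. a h' \<bullet> x < b h'})"
  have "a h' \<bullet> z < b h'" if h': "h' \<in> F - {h}" for h'
  proof -
    have "a h' \<bullet> z \<le> b h'" using zK(1) h' KF by auto
    moreover have "a h' \<bullet> z \<noteq> b h'"
    proof
      assume "a h' \<bullet> z = b h'"
      then have e: "K \<inter> {x. a h' \<bullet> x = b h'} = e" using only[of "K \<inter> {x. a h' \<bullet> x = b h'}"] facets h' zK by blast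
      \<comment> \<open>Two irredundant half-spaces cannot cut out the same facet: dropping \<open>h'\<close> would
        otherwise leave a point outside \<open>h'\<close>, and the segment to an interior point meets the
        boundary of \<open>h'\<close> off \<open>h\<close>.\<close>
      have "F - {h'} \<subset> F" using h' by blast
      from min[OF this] obtain y where y0: "y \<notin> K" "y \<in> \<Inter>(F - {h'})" by blast
      have y: "y \<notin> K" "\<And>g. g \<in> F - {h'} \<Longrightarrow> a g \<bullet> y \<le> b g"
        using y0 ab by blast+
      then have yh': "b h' < a h' \<bullet> y" using KF[of y] by force
      obtain c where c: "c \<in> interior K" using assms(2) by blast
      have cK: "a g \<bullet> c < b g" if "g \<in> F" for g
      proof -
        have "a g \<noteq> 0" using ab[OF that] by blast
        have "interior K \<subseteq> interior {x. a g \<bullet> x \<le> b g}" using KF that by (intro interior_mono) auto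
        then show ?thesis using c \<open>a g \<noteq> 0\<close> by auto
      qed
      define s where "s = (b h' - a h' \<bullet> c) / (a h' \<bullet> y - a h' \<bullet> c)"
      have s: "0 < s" "s < 1" using cK[of h'] yh' h' by (auto simp: s_def field_simps)
      define p where "p = (1 - s) *\<^sub>R c + s *\<^sub>R y"
      have ap: "a g \<bullet> p = (1 - s) * (a g \<bullet> c) + s * (a g \<bullet> y)" for g
        by (simp add: p_def inner_add_right)
      have "a h' \<bullet> p = a h' \<bullet> c + s * (a h' \<bullet> y - a h' \<bullet> c)" by (simp add: ap algebra_simps)
      also have "s * (a h' \<bullet> y - a h' \<bullet> c) = b h' - a h' \<bullet> c"
        using cK[of h'] yh' h' by (simp add: s_def)
      finally have p1: "a h' \<bullet> p = b h'" by simp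
      have p2: "a g \<bullet> p < b g" if "g \<in> F - {h'}" for g
      proof -
        have "(1 - s) * (a g \<bullet> c) < (1 - s) * b g" using cK that s by simp
        moreover have "s * (a g \<bullet> y) \<le> s * b g" using y(2)[OF that] s by simp
        ultimately show ?thesis unfolding ap by (simp add: algebra_simps)
      qed
      have "p \<in> K" unfolding KF using p1 p2 by fastforce
      then have "p \<in> e" using p1 e by blast
      then have "a h \<bullet> p = b h" using h by blast
      then show False using p2[of h] h h' by auto
    qed
    ultimately show ?thesis by simp
  qed
  then have "z \<in> U" by (auto simp: U_def)
  moreover have "open U" unfolding U_def using \<open>finite F\<close> by (intro open_INT) (auto simp: open_halfspace_lt)
  ultimately obtain r where r: "0 < r" "ball z r \<subseteq> U" using openE by metis
  define \<nu> where "\<nu> = a h /\<^sub>R norm (a h)"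
  have n0: "0 < norm (a h)" using ab[OF h(1)] by simp
  have \<nu>: "\<nu> \<bullet> x \<le> \<nu> \<bullet> z \<longleftrightarrow> a h \<bullet> x \<le> b h" "\<nu> \<bullet> x = \<nu> \<bullet> z \<longleftrightarrow> a h \<bullet> x = b h" for x
    using n0 zK(2) by (auto simp: \<nu>_def divide_simps)
  have "x \<in> K" if "x \<in> ball z r" "\<nu> \<bullet> x \<le> \<nu> \<bullet> z" for x
    unfolding KF
  proof
    fix g assume g: "g \<in> F"
    have "x \<in> U" using that(1) r(2) by blast
    then show "a g \<bullet> x \<le> b g"
      using g that(2) \<nu>(1) by (cases "g = h") (auto simp: U_def less_imp_le)
  qed
  moreover have "K \<subseteq> {x. \<nu> \<bullet> x \<le> \<nu> \<bullet> z}" using KF h(1) \<nu>(1) by blast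
  ultimately have "facet_chart K e z \<nu> r"
    unfolding facet_chart_def using r(1) n0 assms(4) h(2) \<nu>(2) by (auto simp: \<nu>_def)
  then show ?thesis by (rule that)
qed

lemma facet_chart_hyperplane:
  "facet_chart K e z \<nu> r \<Longrightarrow> x \<in> ball z r \<Longrightarrow> \<nu> \<bullet> x = \<nu> \<bullet> z \<Longrightarrow> x \<in> e"
  by (auto simp: facet_chart_def)

text \<open>The component \<open>d\<close> of \<xi> orthogonal to \<nu> is a direction inside the
  disc, on which \<xi> is constant; hence \<open>\<xi> \<bullet> d = 0\<close>, which forces
  \<open>d = 0\<close>.\<close>

lemma unit_normal_unique:
  fixes \<nu> \<xi> :: "'a::euclidean_space"
  assumes "norm \<nu> = 1" "norm \<xi> = 1" "0 < r"
    and *: "\<And>x. x \<in> ball z r \<Longrightarrow> \<nu> \<bullet> x = \<nu> \<bullet> z \<Longrightarrow> \<xi> \<bullet> x = \<xi> \<bullet> z"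
  shows "\<xi> = \<nu> \<or> \<xi> = - \<nu>"
proof -
  define d where "d = \<xi> - (\<xi> \<bullet> \<nu>) *\<^sub>R \<nu>"
  have nn: "\<nu> \<bullet> \<nu> = 1" using assms(1) by (simp add: norm_eq_1)
  have dn: "\<nu> \<bullet> d = 0" by (simp add: d_def inner_diff_right nn inner_commute)
  \<comment> \<open>Scaled to keep \<open>z + s *\<^sub>R d\<close> in the ball; the
    \<open>+ 1\<close> covers \<open>d = 0\<close>.\<close>
  define s where "s = r / (2 * (norm d + 1))"
  have s: "0 < s" using assms(3) by (simp add: s_def add_nonneg_pos)
  have "s * norm d < r"
  proof -
    have "norm d + 1 > 0" by (simp add: add_nonneg_pos)
    then have "s * (norm d + 1) = r / 2" unfolding s_def by (simp add: divide_simps)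
    then show ?thesis using s assms(3) by (simp add: distrib_left)
  qed
  then have "z + s *\<^sub>R d \<in> ball z r" using s by (simp add: dist_norm)
  from *[OF this] have xd: "\<xi> \<bullet> d = 0" using s dn by (simp add: inner_add_right)
  have "d \<bullet> d = \<xi> \<bullet> d - (\<xi> \<bullet> \<nu>) * (\<nu> \<bullet> d)" by (simp add: d_def inner_diff_left)
  then have "d = 0" using xd dn by simp
  then have x: "\<xi> = (\<xi> \<bullet> \<nu>) *\<^sub>R \<nu>" by (simp add: d_def)
  then have "norm \<xi> = \<bar>\<xi> \<bullet> \<nu>\<bar> * norm \<nu>" by (metis norm_scaleR)
  then have "\<xi> \<bullet> \<nu> = 1 \<or> \<xi> \<bullet> \<nu> = - 1" using assms by auto
  then show ?thesis using x by auto
qed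

lemma facet_chart_inner:
  assumes "facet_chart K e z \<nu> r" "0 < s" "s < r"
  shows "z - s *\<^sub>R \<nu> \<in> ball z r" "\<nu> \<bullet> (z - s *\<^sub>R \<nu>) < \<nu> \<bullet> z"
proof -
  have "norm \<nu> = 1" "\<nu> \<bullet> \<nu> = 1" using assms(1) by (auto simp: facet_chart_def norm_eq_1)
  then show "z - s *\<^sub>R \<nu> \<in> ball z r" "\<nu> \<bullet> (z - s *\<^sub>R \<nu>) < \<nu> \<bullet> z"
    using assms by (auto simp: dist_norm inner_diff_right)
qed

text \<open>The disc around \<open>z\<close> in \<open>e\<close> leaves only \<nu> and its negative
  as candidates, and the points of \<open>K\<close> below the disc exclude the negative, so the
  definite description denotes \<nu>.\<close>

lemma outward_normal_facet_chart:
  assumes c: "facet_chart K e z \<nu> r"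
  shows "outward_normal K e = \<nu>"
  unfolding outward_normal_def
proof (rule the_equality)
  show "norm \<nu> = 1 \<and> (\<exists>b. (\<forall>x\<in>e. \<nu> \<bullet> x = b) \<and> (\<forall>x\<in>K. \<nu> \<bullet> x \<le> b))"
    using c unfolding facet_chart_def by blast
  fix \<xi> assume "norm \<xi> = 1 \<and> (\<exists>b. (\<forall>x\<in>e. \<xi> \<bullet> x = b) \<and> (\<forall>x\<in>K. \<xi> \<bullet> x \<le> b))"
  then obtain b where \<xi>: "norm \<xi> = 1" "\<And>x. x \<in> e \<Longrightarrow> \<xi> \<bullet> x = b" "\<And>x. x \<in> K \<Longrightarrow> \<xi> \<bullet> x \<le> b" by blast
  have z: "z \<in> e" "norm \<nu> = 1" "0 < r" using c by (auto simp: facet_chart_def)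
  have "\<xi> = \<nu> \<or> \<xi> = - \<nu>"
    using \<xi>(2) facet_chart_hyperplane[OF c] z by (intro unit_normal_unique[OF z(2) \<xi>(1) z(3), of z]) metis
  moreover have "\<xi> \<noteq> - \<nu>"
  proof
    assume x: "\<xi> = - \<nu>"
    have "z - (r/2) *\<^sub>R \<nu> \<in> K"
      using facet_chart_inner[OF c, of "r/2"] c z(3) unfolding facet_chart_def by (auto simp del: mem_ball)
    then show False
      using \<xi>(3)[of "z - (r/2) *\<^sub>R \<nu>"] \<xi>(2)[OF z(1)] facet_chart_inner(2)[OF c, of "r/2"] z(3) by (simp add: x)
  qed
  ultimately show "\<xi> = \<nu>" by blast
qed

text \<open>Equal normals would place the same open half-ball inside both elements.\<close>

lemma facet_charts_opposite:
  assumes c: "facet_chart K e z \<nu> r" "facet_chart K' e z \<nu>' r'"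
    and dis: "interior K \<inter> interior K' = {}"
  shows "\<nu>' = - \<nu>"
proof -
  have z: "norm \<nu> = 1" "norm \<nu>' = 1" "0 < r" "0 < r'" using c by (auto simp: facet_chart_def)
  have "\<nu>' = \<nu> \<or> \<nu>' = - \<nu>"
    using facet_chart_hyperplane[OF c(1)] c(2)
    by (intro unit_normal_unique[OF z(1,2,3), of z]) (auto simp: facet_chart_def)
  moreover have "\<nu>' \<noteq> \<nu>"
  proof
    assume eq: "\<nu>' = \<nu>"
    define s where "s = min r r'"
    have s: "0 < s" "s \<le> r" "s \<le> r'" using z by (auto simp: s_def)
    define W where "W = ball z s \<inter> {x. \<nu> \<bullet> x < \<nu> \<bullet> z}"
    have "open W" unfolding W_def by (intro open_Int open_ball open_halfspace_lt)
    moreover have "W \<subseteq> K" "W \<subseteq> K'"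
      using c s eq by (auto simp: W_def facet_chart_def less_imp_le)
    ultimately have "W \<subseteq> interior K \<inter> interior K'" by (simp add: interior_maximal)
    moreover have "z - (s/2) *\<^sub>R \<nu> \<in> W"
      using s z(1) facet_chart_inner(2)[OF c(1), of "s/2"] by (auto simp: W_def dist_norm)
    ultimately show False using dis by blast
  qed
  ultimately show ?thesis by blast
qed

text \<open>The disc around \<open>z\<close> in \<open>e\<close> identifies the chosen normal
  \<open>a\<close> up to sign, and a small ball in the middle of the slab projects into that
  disc.\<close>

lemma measure_face_pos:
  assumes c: "facet_chart K e z \<nu> r" and "compact e"
  shows "0 < measure (face_measure e) e"
proof -
  have z: "z \<in> e" "norm \<nu> = 1" "0 < r" "e \<subseteq> {x. \<nu> \<bullet> x = \<nu> \<bullet> z}" using c by (auto simp: facet_chart_def)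
  obtain a b where a: "norm a = 1" "e \<subseteq> {x. a \<bullet> x = b}" "face_measure e = hyperplane_measure a b"
    using face_measure_cases[OF z(2,4)] by metis
  have az: "a \<bullet> z = b" using a(2) z(1) by auto
  have "a = \<nu> \<or> a = - \<nu>"
  proof (rule unit_normal_unique[OF z(2) a(1) z(3), of z])
    fix x assume "x \<in> ball z r" "\<nu> \<bullet> x = \<nu> \<bullet> z"
    then have "x \<in> e" by (rule facet_chart_hyperplane[OF c])
    then show "a \<bullet> x = a \<bullet> z" using a(2) z(1) by auto
  qed
  then have disc: "x \<in> e" if "x \<in> ball z r" "a \<bullet> x = b" for x
    using facet_chart_hyperplane[OF c that(1)] that(2) az by auto
  have aa: "a \<bullet> a = 1" using a(1) by (simp add: norm_eq_1)
  define q where "q = z + (1/2) *\<^sub>R a"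
  \<comment> \<open>The bound \<open>1/2\<close> keeps the ball in the slab; the bound
    \<open>r/2\<close> is needed because the distance of a projected point to \<open>z\<close> is
    estimated by \<open>2 * s\<close>.\<close>
  define s where "s = min (1/2) (r/2)"
  have s: "0 < s" "s \<le> 1/2" "s \<le> r/2" using z(3) by (auto simp: s_def)
  have sub: "ball q s \<subseteq> {x. b \<le> a \<bullet> x \<and> a \<bullet> x \<le> b + 1 \<and> x - (a \<bullet> x - b) *\<^sub>R a \<in> e}"
  proof
    fix x assume "x \<in> ball q s"
    then have d: "norm (x - q) < s" by (simp add: dist_norm norm_minus_commute)
    have "\<bar>a \<bullet> (x - q)\<bar> \<le> norm a * norm (x - q)" by (rule Cauchy_Schwarz_ineq2)
    then have ax: "\<bar>a \<bullet> (x - q)\<bar> < s" using d a(1) by simp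
    have e: "a \<bullet> x = b + 1/2 + a \<bullet> (x - q)" by (simp add: q_def inner_diff_right inner_add_right az aa)
    have "x - (a \<bullet> x - b) *\<^sub>R a - z = (x - q) - (a \<bullet> (x - q)) *\<^sub>R a"
      unfolding e by (simp add: q_def algebra_simps)
    moreover have "norm ((x - q) - (a \<bullet> (x - q)) *\<^sub>R a) \<le> norm (x - q) + \<bar>a \<bullet> (x - q)\<bar>"
      using norm_triangle_ineq4[of "x - q" "(a \<bullet> (x - q)) *\<^sub>R a"] a(1) by simp
    ultimately have "norm (x - (a \<bullet> x - b) *\<^sub>R a - z) \<le> norm (x - q) + \<bar>a \<bullet> (x - q)\<bar>"
      by metis
    also have "\<dots> < r" using d ax s by linarith
    finally have "x - (a \<bullet> x - b) *\<^sub>R a \<in> ball z r" by (simp add: dist_norm norm_minus_commute)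
    moreover have "a \<bullet> (x - (a \<bullet> x - b) *\<^sub>R a) = b" by (simp add: inner_diff_right aa)
    ultimately have "x - (a \<bullet> x - b) *\<^sub>R a \<in> e" by (rule disc)
    then show "x \<in> {x. b \<le> a \<bullet> x \<and> a \<bullet> x \<le> b + 1 \<and> x - (a \<bullet> x - b) *\<^sub>R a \<in> e}"
      using e ax s by auto
  qed
  have eb: "e \<in> sets borel" using assms(2) by (simp add: borel_compact)
  have fin: "emeasure (hyperplane_measure a b) e < \<infinity>"
    using emeasure_hyperplane_measure_finite[OF assms(2) a(1)] .
  have ms: "{x. b \<le> a \<bullet> x \<and> a \<bullet> x \<le> b + 1 \<and> x - (a \<bullet> x - b) *\<^sub>R a \<in> e} \<in> sets borel"
    using eb by measurable
  have "0 < emeasure lborel (ball q s)"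
    using content_ball_pos[OF s(1), of q] by (simp add: measure_def enn2real_positive_iff)
  also have "\<dots> \<le> emeasure (hyperplane_measure a b) e"
    unfolding emeasure_hyperplane_measure[OF eb] using sub ms by (intro emeasure_mono) auto
  finally show ?thesis
    using fin by (simp add: a(3) measure_def enn2real_positive_iff)
qed

text \<open>If the line through \<open>x\<close> meets \<open>f\<close>, then \<open>x\<close> lies
  in a translate of the span of \<open>v\<close> and the directions of \<open>f\<close>. That span
  is one dimension larger than \<open>f\<close> at most, hence a proper subspace, so the bad base
  points are negligible and cannot fill \<open>U\<close>.\<close>

lemma exists_line_avoiding:
  fixes U :: "'a::euclidean_space set"
  assumes "finite F" "open U" "U \<noteq> {}" and F: "\<And>f. f \<in> F \<Longrightarrow> aff_dim f \<le> int DIM('a) - 2"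
  obtains x where "x \<in> U" "\<And>f t. f \<in> F \<Longrightarrow> x + t *\<^sub>R v \<notin> f"
proof -
  have neg: "negligible {x. \<exists>t. x + t *\<^sub>R v \<in> f}" if f: "f \<in> F" for f
  proof (cases "f = {}")
    case False
    then obtain y where y: "y \<in> f" by blast
    let ?S = "insert v ((+) (- y) ` f)"
    have "int (dim ((+) (- y) ` f)) \<le> int DIM('a) - 2"
      using F[OF f] aff_dim_eq_dim[OF hull_inc[OF y]] by simp
    moreover have "dim ?S \<le> dim ((+) (- y) ` f) + 1" by (simp add: dim_insert)
    ultimately have "dim (span ?S) < DIM('a)" unfolding dim_span by linarith
    then have "negligible ((+) y ` span ?S)" by (intro negligible_translation negligible_lowdim)
    moreover have "{x. \<exists>t. x + t *\<^sub>R v \<in> f} \<subseteq> (+) y ` span ?S"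
    proof
      fix x assume "x \<in> {x. \<exists>t. x + t *\<^sub>R v \<in> f}"
      then obtain t where t: "x + t *\<^sub>R v \<in> f" by blast
      have "(- y + (x + t *\<^sub>R v)) - t *\<^sub>R v \<in> span ?S"
        using t by (intro span_diff span_scale span_base) auto
      then show "x \<in> (+) y ` span ?S" by (intro image_eqI[where x = "- y + x"]) auto
    qed
    ultimately show ?thesis by (rule negligible_subset)
  qed simp
  have "negligible (\<Union>f\<in>F. {x. \<exists>t. x + t *\<^sub>R v \<in> f})"
    using assms(1) neg by (intro negligible_Union) auto
  then have "\<not> U \<subseteq> (\<Union>f\<in>F. {x. \<exists>t. x + t *\<^sub>R v \<in> f})"
    using open_not_negligible[OF assms(2,3)] negligible_subset by blast
  then show ?thesis using that by blast
qed

text \<open>The intersection is a face of both facets and a proper one of at least one of them, so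
  the dimension drops a second time.\<close>

lemma aff_dim_Int_facets:
  fixes K :: "'a::euclidean_space set"
  assumes "e facet_of K" "e' facet_of K" "e \<noteq> e'"
  shows "aff_dim (e \<inter> e') \<le> aff_dim K - 2"
proof -
  have f: "e face_of K" "e' face_of K" "aff_dim e = aff_dim K - 1" "aff_dim e' = aff_dim K - 1"
    using assms by (auto simp: facet_of_def)
  have "(e \<inter> e') face_of e" "(e \<inter> e') face_of e'"
    using face_of_Int[OF f(1,2)] f(1,2) face_of_face by blast+
  moreover have "e \<inter> e' \<noteq> e \<or> e \<inter> e' \<noteq> e'" using assms(3) by blast
  ultimately have "aff_dim (e \<inter> e') < aff_dim K - 1"
    using face_of_aff_dim_lt f face_of_imp_convex by metis
  then show ?thesis by simp
qed

section \<open>Vanishing jumps and vanishing gradients on the mesh\<close>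

context dg_setting
begin

text \<open>In a triangulation two elements meet in a common face, and a face that meets the
  interior is the whole element.\<close>

lemma interiors_disjoint:
  assumes "K \<in> T" "K' \<in> T" "K \<noteq> K'"
  shows "interior K \<inter> interior K' = {}"
proof (rule ccontr)
  assume ne: "interior K \<inter> interior K' \<noteq> {}"
  have "K \<inter> K' face_of K" "K' \<inter> K face_of K'"
    using mesh assms by (auto simp: simplicial_mesh_def triangulation_def)
  moreover have "(K \<inter> K') \<inter> interior K \<noteq> {}" "(K' \<inter> K) \<inter> interior K' \<noteq> {}"
    using ne interior_subset by blast+
  ultimately have "K \<inter> K' = K" "K' \<inter> K = K'"
    using face_of_disjoint_interior by blast+
  then show False using assms by blast
qed

text \<open>The walk along the line becomes an extremal argument: \<open>S\<close> collects all
  elements carrying the constant of \<open>K0\<close>, and \<open>z\<close> is the last point of the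
  line in \<open>S\<close>. A neighbour across the facet at \<open>z\<close> would carry the same
  constant and extend \<open>S\<close> past \<open>z\<close>. So the facet has a single adjacent
  element, and its jump is the constant times the normal.\<close>

lemma piecewise_constant_zero:
  assumes const: "\<And>K x. K \<in> T \<Longrightarrow> x \<in> K \<Longrightarrow> w K x = c K"
    and jump0: "\<And>e. e \<in> faces T \<Longrightarrow> face_integral e (\<lambda>x. (norm (jump T w e x))\<^sup>2) = 0"
    and K0: "K0 \<in> T"
  shows "c K0 = 0"
proof -
  \<comment> \<open>Intersections of two facets of one element. Off these sets a point lies on at
    most one facet of each element, as a chart requires.\<close>
  define F where "F = (\<lambda>(e, e'). e \<inter> e') ` {(e, e'). e \<noteq> e' \<and> (\<exists>K\<in>T. e facet_of K \<and> e' facet_of K)}"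
  have "{(e, e'). e \<noteq> e' \<and> (\<exists>K\<in>T. e facet_of K \<and> e' facet_of K)}
      \<subseteq> (\<Union>K\<in>T. {e. e facet_of K} \<times> {e. e facet_of K})" by auto
  then have "finite F"
    unfolding F_def using finite_T element(1)
    by (intro finite_imageI) (erule finite_subset, auto intro!: finite_polytope_facets)
  have F_dim: "aff_dim f \<le> int DIM(real^'n) - 2" if "f \<in> F" for f
  proof -
    obtain K e e' where K: "K \<in> T" "e facet_of K" "e' facet_of K" "e \<noteq> e'" "f = e \<inter> e'"
      using \<open>f \<in> F\<close> by (auto simp: F_def)
    then show ?thesis using aff_dim_Int_facets[OF K(2-4)] aff_dim_le_DIM[of K] by simp
  qed
  define v :: "real^'n" where "v = axis (SOME i. True) 1"
  have v: "norm v = 1" by (simp add: v_def)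
  obtain x where x: "x \<in> interior K0" and avoid: "\<And>f t. f \<in> F \<Longrightarrow> x + t *\<^sub>R v \<notin> f"
    using exists_line_avoiding[OF \<open>finite F\<close> open_interior element(4)[OF K0] F_dim] by metis
  define S where "S = \<Union>{K\<in>T. c K = c K0}"
  have "compact S" unfolding S_def using finite_T element(2) by (intro compact_Union) auto
  define I where "I = (\<lambda>t. x + t *\<^sub>R v) -` S"
  have "closed I"
    unfolding I_def by (intro closed_vimage compact_imp_closed \<open>compact S\<close> continuous_intros)
  moreover have "bounded I"
  proof -
    obtain B where B: "\<And>y. y \<in> S \<Longrightarrow> norm y \<le> B"
      using compact_imp_bounded[OF \<open>compact S\<close>] by (auto simp: bounded_iff)
    have "norm t \<le> B + norm x" if "t \<in> I" for t
    proof -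
      have "norm (t *\<^sub>R v) \<le> norm (x + t *\<^sub>R v) + norm x"
        by (metis add_diff_cancel_left' norm_triangle_ineq4)
      then show ?thesis using B[of "x + t *\<^sub>R v"] that v by (simp add: I_def)
    qed
    then show ?thesis by (auto simp: bounded_iff)
  qed
  moreover have "0 \<in> I" using x interior_subset K0 by (auto simp: I_def S_def)
  ultimately obtain t where t: "t \<in> I" and tmax: "\<And>s. s \<in> I \<Longrightarrow> s \<le> t"
    using compact_attains_sup[of I] by (auto simp: compact_eq_bounded_closed)
  define z where "z = x + t *\<^sub>R v"
  \<comment> \<open>A ball around \<open>z\<close> inside \<open>S\<close> would contain a later
    point of the line.\<close>
  have escape: False if "0 < r" "ball z r \<subseteq> S" for r
  proof -
    have "z + (r/2) *\<^sub>R v \<in> ball z r" using that v by (simp add: dist_norm)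
    then have "t + r/2 \<in> I" using that by (auto simp: I_def z_def algebra_simps)
    then show False using tmax[of "t + r/2"] that by simp
  qed
  have "z \<in> S" using t by (simp add: I_def z_def)
  then obtain K where K: "K \<in> T" "z \<in> K" "c K = c K0" by (auto simp: S_def)
  have "K \<subseteq> S" using K by (auto simp: S_def)
  have "z \<notin> interior K"
  proof
    assume "z \<in> interior K"
    then obtain r where "0 < r" "ball z r \<subseteq> K" by (auto simp: mem_interior)
    then show False using escape \<open>K \<subseteq> S\<close> by blast
  qed
  then have "z \<in> rel_frontier K"
    using K(2) element(2,4)[OF K(1)]
    by (simp add: rel_frontier_nonempty_interior frontier_def compact_imp_closed)
  then obtain e where e: "e facet_of K" "z \<in> e"
    using element(1)[OF K(1)] by (auto simp: rel_frontier_of_polyhedron polytope_imp_polyhedron)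
  have chart: "\<exists>\<nu> r. facet_chart K' e z \<nu> r" if K': "K' \<in> T" "e facet_of K'" for K'
  proof -
    have "e' = e" if "e' facet_of K'" "z \<in> e'" for e'
    proof (rule ccontr)
      assume "e' \<noteq> e"
      then have "e \<inter> e' \<in> F" using K' that(1) by (force simp: F_def)
      then show False using avoid[of "e \<inter> e'" t] e(2) that(2) by (simp add: z_def)
    qed
    then show ?thesis
      using facet_chart_exists[OF element(1,4)[OF K'(1)] K'(2) e(2)] by metis
  qed
  obtain \<nu> r where cK: "facet_chart K e z \<nu> r" using chart K(1) e(1) by blast
  have ef: "e \<in> faces T" using K(1) e(1) by (auto simp: faces_def)
  have \<nu>0: "norm \<nu> = 1" using cK by (simp add: facet_chart_def)
  \<comment> \<open>The jump is the same vector \<open>J\<close> at all points of \<open>e\<close>;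
    since \<open>e\<close> has positive surface measure, the vanishing integral gives
    \<open>J = 0\<close>.\<close>
  define J where "J = (\<Sum>K\<in>adjacent T e. c K *\<^sub>R outward_normal K e)"
  have jump: "jump T w e y = J" if "y \<in> e" for y
    unfolding jump_def J_def
  proof (rule sum.cong[OF refl])
    fix K assume "K \<in> adjacent T e"
    then have "K \<in> T" "y \<in> K" using that facet_of_imp_subset by (auto simp: adjacent_def)
    then show "w K y *\<^sub>R outward_normal K e = c K *\<^sub>R outward_normal K e" using const by simp
  qed
  have eM: "e \<in> sets (face_measure e)" "emeasure (face_measure e) e < \<infinity>"
  proof -
    obtain a b where "norm a = 1" "e \<subseteq> {x. a \<bullet> x = b}" using face(3)[OF ef] by blast
    then obtain a b where a: "norm a = 1" "face_measure e = hyperplane_measure a b"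
      using face_measure_cases by metis
    show "emeasure (face_measure e) e < \<infinity>"
      unfolding a(2) using face(1)[OF ef] a(1) by (rule emeasure_hyperplane_measure_finite)
    show "e \<in> sets (face_measure e)"
      unfolding a(2) using face(1)[OF ef] by (simp add: hyperplane_measure_def borel_compact)
  qed
  have "0 = face_integral e (\<lambda>x. (norm J)\<^sup>2)"
    unfolding jump0[OF ef, symmetric] using jump eM by (intro set_lebesgue_integral_cong) auto
  also have "\<dots> = measure (face_measure e) e * (norm J)\<^sup>2"
    using eM by (simp add: set_lebesgue_integral_def)
  finally have J0: "J = 0" using measure_face_pos[OF cK face(1)[OF ef]] by simp
  show ?thesis
  proof (cases "\<exists>K'\<in>T. e facet_of K' \<and> K' \<noteq> K")
    case False
    then have "adjacent T e = {K}" unfolding adjacent_def using K(1) e(1) by blast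
    then have "c K *\<^sub>R \<nu> = 0" using J0 by (simp add: J_def outward_normal_facet_chart[OF cK])
    then show ?thesis using \<nu>0 K(3) by auto
  next
    case True
    then obtain K' where K': "K' \<in> T" "e facet_of K'" "K' \<noteq> K" by blast
    obtain \<nu>' r' where cK': "facet_chart K' e z \<nu>' r'" using chart K' by blast
    have \<nu>': "\<nu>' = - \<nu>"
      using facet_charts_opposite[OF cK cK'] interiors_disjoint[OF K(1) K'(1)] K'(3) by blast
    \<comment> \<open>The normal of a third element would be opposite to both \<nu> and its
      negative, which is impossible for a unit vector.\<close>
    have "K'' = K \<or> K'' = K'" if K'': "K'' \<in> T" "e facet_of K''" for K''
    proof (rule ccontr)
      assume n: "\<not> ?thesis"
      obtain \<nu>'' r'' where cK'': "facet_chart K'' e z \<nu>'' r''" using chart K'' by blast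
      have "\<nu>'' = - \<nu>" "\<nu>'' = - \<nu>'"
        using facet_charts_opposite[OF cK cK''] facet_charts_opposite[OF cK' cK'']
          interiors_disjoint[OF K(1) K''(1)] interiors_disjoint[OF K'(1) K''(1)] n by blast+
      then have "\<nu> = - \<nu>" using \<nu>' by (metis minus_minus)
      then have "2 *\<^sub>R \<nu> = 0" by (metis add.right_inverse scaleR_2)
      then show False using \<nu>0 by auto
    qed
    then have "adjacent T e = {K, K'}" unfolding adjacent_def using K(1) e(1) K' by blast
    then have "(c K - c K') *\<^sub>R \<nu> = 0"
      using J0 K'(3) \<nu>'
      by (simp add: J_def outward_normal_facet_chart[OF cK] outward_normal_facet_chart[OF cK'] algebra_simps)
    then have "c K' = c K0" using \<nu>0 K(3) by auto
    then have "K' \<subseteq> S" using K'(1) by (auto simp: S_def)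
    have "ball z (min r r') \<subseteq> K \<union> K'"
    proof
      fix y assume "y \<in> ball z (min r r')"
      then have "y \<in> ball z r" "y \<in> ball z r'" by auto
      then show "y \<in> K \<union> K'"
        using cK cK' \<nu>' unfolding facet_chart_def by (cases "\<nu> \<bullet> y \<le> \<nu> \<bullet> z") auto
    qed
    then have "ball z (min r r') \<subseteq> S" using \<open>K \<subseteq> S\<close> \<open>K' \<subseteq> S\<close> by blast
    moreover have "0 < min r r'" using cK cK' by (auto simp: facet_chart_def)
    ultimately show ?thesis using escape by blast
  qed
qed

text \<open>The gradient vanishes almost everywhere, and the part of the interior where it does not
  is open, so that part is empty. Convexity then gives a constant on the interior, and continuity
  extends it to the whole element.\<close>

lemma C1_fun_constant_on_element:
  assumes "K \<in> T" "C1_fun p" and int0: "(LINT x:K|lebesgue. (norm (grad p x))\<^sup>2) = 0"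
  obtains c where "\<And>x. x \<in> K \<Longrightarrow> p x = c"
proof -
  note k = element[OF assms(1)]
  have cg: "continuous_on S (grad p)" for S by (rule C1_fun_continuous_on[OF assms(2)])
  have "set_integrable lebesgue K (\<lambda>x. (norm (grad p x))\<^sup>2)"
    using k by (intro set_integrable_lebesgue_compact continuous_intros cg)
  then have "AE x in lebesgue. indicator K x *\<^sub>R (norm (grad p x))\<^sup>2 = 0"
    using int0 unfolding set_lebesgue_integral_def set_integrable_def
    by (subst integral_nonneg_eq_0_iff_AE[symmetric]) auto
  then have "AE x in lebesgue. \<not> (x \<in> K \<and> grad p x \<noteq> 0)"
    by eventually_elim (auto simp: indicator_def)
  then obtain N where "{x \<in> space lebesgue. \<not> \<not> (x \<in> K \<and> grad p x \<noteq> 0)} \<subseteq> N"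
    "emeasure lebesgue N = 0" "N \<in> sets lebesgue" by (rule AE_E)
  then have "{x. x \<in> K \<and> grad p x \<noteq> 0} \<subseteq> N" "negligible N"
    by (auto simp: negligible_iff_null_sets null_sets_def)
  then have "negligible {x. x \<in> K \<and> grad p x \<noteq> 0}" using negligible_subset by blast
  then have "negligible (interior K \<inter> {x. grad p x \<noteq> 0})"
    by (rule negligible_subset) (use interior_subset in blast)
  moreover have "open (interior K \<inter> {x. grad p x \<noteq> 0})"
    using open_Collect_neq[OF cg continuous_on_const] by (intro open_Int) auto
  ultimately have g0: "grad p x = 0" if "x \<in> interior K" for x
    using open_not_negligible that by blast
  obtain c where c: "\<And>x. x \<in> interior K \<Longrightarrow> p x = c"
  proof -
    have "(p has_derivative (\<lambda>h. 0)) (at x within interior K)" if "x \<in> interior K" for x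
      using C1_fun_grad[OF assms(2), of x] g0[OF that] by (simp add: has_derivative_at_withinI)
    then show ?thesis
      using has_derivative_zero_constant[OF convex_interior[OF k(3)], of p] that by metis
  qed
  have "p x = c" if "x \<in> K" for x
  proof -
    have "x \<in> closure (interior K)"
      using convex_closure_interior[OF k(3,4)] k(2) that by (simp add: compact_imp_closed)
    then show ?thesis
      using continuous_constant_on_closure[OF C1_fun_continuous_on(1)[OF assms(2)] c] by blast
  qed
  then show ?thesis by (rule that)
qed

text \<open>In dimension one a face is a point of diameter \<open>0\<close>, and
  \<open>inverse 0 = 0\<close> would erase the jumps from the norm. From dimension two on, a facet
  contains two distinct points.\<close>

lemma diameter_face_pos:
  assumes "2 \<le> CARD('n)" "e \<in> faces T"
  shows "0 < diameter e"
proof -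
  obtain K where K: "K \<in> T" "e facet_of K" using assms by (auto simp: faces_def)
  have "aff_dim K = int CARD('n)"
    using affine_hull_nonempty_interior[OF element(4)[OF K(1)]] by (simp add: aff_dim_eq_full[symmetric])
  then have d: "1 \<le> aff_dim e" "e \<noteq> {}" using K(2) assms(1) by (auto simp: facet_of_def)
  then obtain x where "x \<in> e" by blast
  moreover have "e \<noteq> {x}" using d by auto
  ultimately obtain y where "y \<in> e" "y \<noteq> x" by blast
  then show ?thesis
    using diameter_bounded_bound[OF compact_imp_bounded[OF face(1)[OF assms(2)]], of x y] \<open>x \<in> e\<close>
    by (metis dist_nz less_le_trans)
qed

lemma dg_norm3_eq_0D:
  assumes "2 \<le> CARD('n)" "0 < \<mu>" "\<And>K. C1_fun (w K)" "dg_norm3 T \<mu> w = 0" "K \<in> T" "x \<in> K"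
  shows "w K x = 0"
proof -
  define G where "G = (\<lambda>K. LINT x:K|lebesgue. (norm (grad (w K) x))\<^sup>2)"
  define J where "J = (\<lambda>e. inverse (diameter e / \<mu>) * face_integral e (\<lambda>x. (norm (jump T w e x))\<^sup>2))"
  have fin: "finite (faces T)"
  proof -
    have "faces T = (\<Union>K\<in>T. {e. e facet_of K})" by (auto simp: faces_def)
    then show ?thesis using finite_T element(1) finite_polytope_facets by auto
  qed
  have nonneg: "0 \<le> set_lebesgue_integral M S (\<lambda>x. (norm (f x))\<^sup>2)" for M :: "(real^'n) measure" and S and f :: "real^'n \<Rightarrow> real^'n"
    unfolding set_lebesgue_integral_def by (intro integral_nonneg_AE) auto
  have G: "0 \<le> G K" for K unfolding G_def by (rule nonneg)
  have J: "0 \<le> J e" if "e \<in> faces T" for e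
    unfolding J_def using diameter_face_pos[OF assms(1) that] assms(2) nonneg by simp
  have avg: "0 \<le> (\<Sum>e\<in>faces T. (diameter e / \<mu>) * face_integral e (\<lambda>x. (norm (average T (\<lambda>K. grad (w K)) e x))\<^sup>2))"
    using diameter_face_pos[OF assms(1)] assms(2) nonneg by (intro sum_nonneg mult_nonneg_nonneg) (auto simp: less_imp_le)
  have "dg_norm T \<mu> w = 0"
    using assms(4) avg unfolding dg_norm3_def by (simp add: add_nonneg_eq_0_iff)
  then have "(\<Sum>K\<in>T. G K) + (\<Sum>e\<in>faces T. J e) = 0"
    unfolding dg_norm_def G_def J_def by simp
  moreover have "0 \<le> (\<Sum>K\<in>T. G K)" "0 \<le> (\<Sum>e\<in>faces T. J e)" using G J by (auto intro: sum_nonneg)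
  ultimately have "(\<Sum>K\<in>T. G K) = 0" "(\<Sum>e\<in>faces T. J e) = 0" by linarith+
  then have G0: "\<And>K. K \<in> T \<Longrightarrow> G K = 0" and J0: "\<And>e. e \<in> faces T \<Longrightarrow> J e = 0"
    using G J finite_T fin by (auto simp: sum_nonneg_eq_0_iff)
  have "\<exists>c. \<forall>x\<in>K. w K x = c" if "K \<in> T" for K
    using C1_fun_constant_on_element[OF that assms(3)] G0[OF that] unfolding G_def by metis
  then obtain c where c: "\<And>K x. K \<in> T \<Longrightarrow> x \<in> K \<Longrightarrow> w K x = c K" by metis
  have "face_integral e (\<lambda>x. (norm (jump T w e x))\<^sup>2) = 0" if "e \<in> faces T" for e
    using J0[OF that] diameter_face_pos[OF assms(1) that] assms(2) by (simp add: J_def)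
  from piecewise_constant_zero[OF c this assms(5)] c assms(5,6) show ?thesis by simp
qed

end

subsection \<open>Solvability and stability of the discrete systems\<close>

lemma barycenter_mem:
  assumes "polytope K" "K \<noteq> {}"
  shows "barycenter K \<in> K"
proof -
  define S where "S = {x. x extreme_point_of K}"
  have "finite S"
    unfolding S_def using assms(1) by (simp add: finite_polyhedron_extreme_points polytope_imp_polyhedron)
  have "S \<subseteq> K" by (auto simp: S_def extreme_point_of_def)
  have "S \<noteq> {}"
    using extreme_point_exists_convex[of K] assms
    by (auto simp: S_def polytope_imp_compact polytope_imp_convex)
  with \<open>finite S\<close> have "0 < card S" by (simp add: card_gt_0_iff)
  then have "(\<Sum>x\<in>S. (1 / real (card S)) *\<^sub>R x) \<in> K"
    using \<open>finite S\<close> assms(1) \<open>S \<subseteq> K\<close> by (intro convex_sum) (auto simp: polytope_imp_convex)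
  then show ?thesis
    by (simp add: barycenter_def S_def scaleR_sum_right divide_inverse)
qed

lemma (in dg_setting) dg_norm3_nonneg:
  assumes "2 \<le> CARD('n)" "0 < \<mu>"
  shows "0 \<le> dg_norm3 T \<mu> w"
proof -
  have "0 \<le> (\<Sum>e\<in>faces T. (diameter e / \<mu>) * face_integral e (\<lambda>x. (norm (average T (\<lambda>K. grad (w K)) e x))\<^sup>2))"
    using diameter_face_pos[OF assms(1)] assms(2)
    by (intro sum_nonneg mult_nonneg_nonneg)
      (auto simp: less_imp_le set_lebesgue_integral_def intro!: integral_nonneg_AE)
  then show ?thesis by (simp add: dg_norm3_def)
qed

text \<open>The witnesses of \<open>bounded_and_coercive\<close> become parameters in which later
  bounds are written. The sign of \<open>C\<close> is left open, whence the absolute value of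
  \<open>C\<close> below.\<close>

locale dg_discrete = dg_setting \<Omega> T A
  for \<Omega> :: "(real^'n::finite) set" and T :: "(real^'n) set set" and A :: "real^'n \<Rightarrow> real^'n^'n" +
  fixes N m :: nat and \<mu> :: real and V :: "'n broken set" and C c :: real
  assumes dim: "2 \<le> CARD('n)" and \<mu>: "0 < \<mu>"
    and wd: "reconstruction_well_defined T N m" and V_def: "V = reconstructed_space T N m"
    and bounded: "\<And>y w. y \<in> V \<Longrightarrow> w \<in> V \<Longrightarrow> \<bar>a_h T A \<mu> y w\<bar> \<le> C * dg_norm3 T \<mu> y * dg_norm3 T \<mu> w"
    and c_pos: "0 < c"
    and coercive: "\<And>w. w \<in> V \<Longrightarrow> c * (dg_norm3 T \<mu> w)\<^sup>2 \<le> a_h T A \<mu> w w"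
begin

lemmas V_axpy = reconstructed_space_axpy[OF wd, folded V_def]
  and V_zero = zero_reconstructed_space[OF wd, folded V_def]
  and V_diff = reconstructed_space_diff[OF wd, folded V_def]
  and V_C1 = C1_fun_reconstructed_space[OF wd, folded V_def]
  and nonneg = dg_norm3_nonneg[OF dim \<mu>]

text \<open>The nodal basis dual to the barycenter values.\<close>

definition basis :: "(real^'n) set \<Rightarrow> 'n broken" where
  "basis K = reconstruct T N m (\<lambda>K'. if K = K' then 1 else 0)"

lemma basis_mem: "basis K \<in> V"
  by (simp add: basis_def V_def reconstructed_space_def)

lemma basis_barycenter: "K' \<in> T \<Longrightarrow> basis K K' (barycenter K') = (if K = K' then 1 else 0)"
  by (simp add: basis_def reconstruct_barycenter[OF wd])

lemma V_expansion: "w \<in> V \<Longrightarrow> w = (\<lambda>K x. \<Sum>K'\<in>T. w K' (barycenter K') * basis K' K x)"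
  unfolding basis_def V_def by (rule reconstructed_space_expansion[OF wd finite_T])

lemma functional_sum:
  fixes F :: "'n broken \<Rightarrow> 'b::real_vector"
  assumes F: "\<And>y z t. y \<in> V \<Longrightarrow> z \<in> V \<Longrightarrow> F (\<lambda>K x. y K x + t * z K x) = F y + t *\<^sub>R F z"
  shows "F (\<lambda>K x. \<Sum>i\<in>T. b i * basis i K x) = (\<Sum>i\<in>T. b i *\<^sub>R F (basis i))"
  by (rule linear_on_broken_sum(2)[where V = V]) (auto intro: V_axpy V_zero F finite_T basis_mem)

text \<open>The target is a general vector space because the expansion is applied both to real
  functionals and to \<open>broken_l2\<close>.\<close>

lemma functional_expansion:
  fixes F :: "'n broken \<Rightarrow> 'b::real_vector"
  assumes "\<And>y z t. y \<in> V \<Longrightarrow> z \<in> V \<Longrightarrow> F (\<lambda>K x. y K x + t * z K x) = F y + t *\<^sub>R F z"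
    and "w \<in> V"
  shows "F w = (\<Sum>i\<in>T. w i (barycenter i) *\<^sub>R F (basis i))"
  by (subst V_expansion[OF assms(2)]) (rule functional_sum[OF assms(1)])

lemma basis_sum:
  "(\<lambda>K x. \<Sum>i\<in>T. b i * basis i K x) \<in> V"
  "j \<in> T \<Longrightarrow> (\<Sum>i\<in>T. b i * basis i j (barycenter j)) = b j"
proof -
  show "(\<lambda>K x. \<Sum>i\<in>T. b i * basis i K x) \<in> V"
    by (rule linear_on_broken_sum(1)[where V = V and F = "\<lambda>w. 0 :: real"])
      (simp_all add: V_axpy V_zero finite_T basis_mem)
  show "j \<in> T \<Longrightarrow> (\<Sum>i\<in>T. b i * basis i j (barycenter j)) = b j"
    using finite_T by (simp add: basis_barycenter if_distrib cong: if_cong)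
qed

lemma a_left: "w \<in> V \<Longrightarrow> y \<in> V \<Longrightarrow> z \<in> V \<Longrightarrow>
    a_h T A \<mu> (\<lambda>K x. y K x + t * z K x) w = a_h T A \<mu> y w + t *\<^sub>R a_h T A \<mu> z w"
  using a_h_axpy_left V_C1 by simp

lemma a_right: "w \<in> V \<Longrightarrow> y \<in> V \<Longrightarrow> z \<in> V \<Longrightarrow>
    a_h T A \<mu> w (\<lambda>K x. y K x + t * z K x) = a_h T A \<mu> w y + t *\<^sub>R a_h T A \<mu> w z"
  using a_h_axpy_right V_C1 by simp

text \<open>This is where definiteness enters: the barycenter lies in the element, so a nonzero
  value there makes the norm nonzero and the coercivity bound strictly positive.\<close>

lemma a_pos:
  assumes "w \<in> V" "K \<in> T" "w K (barycenter K) \<noteq> 0"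
  shows "0 < a_h T A \<mu> w w"
proof -
  have "barycenter K \<in> K"
    using element[OF assms(2)] interior_subset[of K] by (intro barycenter_mem) auto
  then have "dg_norm3 T \<mu> w \<noteq> 0"
    using dg_norm3_eq_0D[where w = w, OF dim \<mu> V_C1[OF assms(1)] _ assms(2)] assms(3) by blast
  then have "0 < c * (dg_norm3 T \<mu> w)\<^sup>2" using c_pos by simp
  then show ?thesis using coercive[OF assms(1)] by linarith
qed

lemma matrix_pos:
  assumes "\<exists>i\<in>T. b i \<noteq> 0"
  shows "0 < (\<Sum>i\<in>T. \<Sum>j\<in>T. b i * b j * a_h T A \<mu> (basis i) (basis j))"
proof -
  define w where "w = (\<lambda>K x. \<Sum>i\<in>T. b i * basis i K x)"
  have w: "w \<in> V" unfolding w_def by (rule basis_sum)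
  have wb: "w j (barycenter j) = b j" if "j \<in> T" for j unfolding w_def by (rule basis_sum(2)[OF that])
  obtain i where "i \<in> T" "b i \<noteq> 0" using assms by blast
  then have "0 < a_h T A \<mu> w w" using a_pos[OF w] wb[of i] by simp
  also have "a_h T A \<mu> w w = (\<Sum>i\<in>T. b i * a_h T A \<mu> (basis i) w)"
    using functional_expansion[where F = "\<lambda>y. a_h T A \<mu> y w" and w = w] a_left[OF w] w
    by (simp add: wb)
  also have "\<dots> = (\<Sum>i\<in>T. b i * (\<Sum>j\<in>T. b j * a_h T A \<mu> (basis i) (basis j)))"
    using functional_expansion[where F = "a_h T A \<mu> (basis i)" and w = w for i] a_right[OF basis_mem] w
    by (simp add: wb)
  finally show ?thesis by (simp add: sum_distrib_left mult.assoc)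
qed

lemma riesz_left:
  assumes l: "\<And>y z t. y \<in> V \<Longrightarrow> z \<in> V \<Longrightarrow> l (\<lambda>K x. y K x + t * z K x) = l y + t *\<^sub>R l z"
  shows "\<exists>y\<in>V. \<forall>w\<in>V. a_h T A \<mu> y w = l w"
proof -
  obtain b where b: "\<And>j. j \<in> T \<Longrightarrow> (\<Sum>i\<in>T. b i * a_h T A \<mu> (basis i) (basis j)) = l (basis j)"
    using positive_definite_solvable[where l = "\<lambda>j. l (basis j)", OF finite_T matrix_pos] by blast
  define y where "y = (\<lambda>K x. \<Sum>i\<in>T. b i * basis i K x)"
  have y: "y \<in> V" unfolding y_def by (rule basis_sum)
  have yb: "a_h T A \<mu> y (basis j) = l (basis j)" if "j \<in> T" for j
  proof -
    have "a_h T A \<mu> y (basis j) = (\<Sum>i\<in>T. b i *\<^sub>R a_h T A \<mu> (basis i) (basis j))"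
      unfolding y_def
      by (rule functional_sum[where F = "\<lambda>y. a_h T A \<mu> y (basis j)"]) (rule a_left[OF basis_mem])
    then show ?thesis using b[OF that] by simp
  qed
  have "a_h T A \<mu> y w = l w" if "w \<in> V" for w
    using functional_expansion[where F = "a_h T A \<mu> y" and w = w] a_right[OF y]
      functional_expansion[where F = l and w = w] l that by (simp add: yb)
  then show ?thesis using y by blast
qed

text \<open>With the unknown in the second slot the matrix is transposed, which leaves its quadratic
  form unchanged.\<close>

lemma riesz_right:
  assumes l: "\<And>y z t. y \<in> V \<Longrightarrow> z \<in> V \<Longrightarrow> l (\<lambda>K x. y K x + t * z K x) = l y + t *\<^sub>R l z"
  shows "\<exists>p\<in>V. \<forall>q\<in>V. a_h T A \<mu> q p = l q"
proof -
  have "\<exists>b. \<forall>j\<in>T. (\<Sum>i\<in>T. b i * a_h T A \<mu> (basis j) (basis i)) = l (basis j)"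
  proof (rule positive_definite_solvable[OF finite_T])
    fix b :: "(real^'n) set \<Rightarrow> real" assume "\<exists>i\<in>T. b i \<noteq> 0"
    from matrix_pos[OF this] show "0 < (\<Sum>i\<in>T. \<Sum>j\<in>T. b i * b j * a_h T A \<mu> (basis j) (basis i))"
      by (subst sum.swap) (simp add: mult_ac)
  qed
  then obtain b where b: "\<And>j. j \<in> T \<Longrightarrow> (\<Sum>i\<in>T. b i * a_h T A \<mu> (basis j) (basis i)) = l (basis j)"
    by blast
  define p where "p = (\<lambda>K x. \<Sum>i\<in>T. b i * basis i K x)"
  have p: "p \<in> V" unfolding p_def by (rule basis_sum)
  have pb: "a_h T A \<mu> (basis j) p = l (basis j)" if "j \<in> T" for j
  proof -
    have "a_h T A \<mu> (basis j) p = (\<Sum>i\<in>T. b i *\<^sub>R a_h T A \<mu> (basis j) (basis i))"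
      unfolding p_def by (rule functional_sum) (rule a_right[OF basis_mem])
    then show ?thesis using b[OF that] by simp
  qed
  have "a_h T A \<mu> q p = l q" if "q \<in> V" for q
    using functional_expansion[where F = "\<lambda>q. a_h T A \<mu> q p" and w = q] a_left[OF p]
      functional_expansion[where F = l and w = q] l that by (simp add: pb)
  then show ?thesis using p by blast
qed

lemma broken_l2_linear: "y \<in> V \<Longrightarrow> z \<in> V \<Longrightarrow>
    broken_l2 T (\<lambda>K x. y K x + t * z K x) = broken_l2 T y + t *\<^sub>R broken_l2 T z"
  using broken_l2_axpy' V_C1 by blast

lemma broken_l2_diff: "y \<in> V \<Longrightarrow> z \<in> V \<Longrightarrow>
    broken_l2 T (\<lambda>K x. y K x - z K x) = broken_l2 T y - broken_l2 T z"
  using broken_l2_linear[of y z "- 1"] by simp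

lemma broken_l2_mem: "w \<in> V \<Longrightarrow> broken_l2 T w \<in> L2_on \<Omega>"
  using domain mesh element(2) V_C1
  by (intro broken_l2_mem_L2_on C1_fun_continuous_on)
     (auto simp: convex_polyhedral_domain_def simplicial_mesh_def)

text \<open>A linear functional on \<open>V\<close> is \<open>a_h y\<close> for some \<open>y\<close>, so the boundedness of \<open>a_h\<close>
  bounds it by the discontinuous Galerkin norm; applied to the coordinates this replaces a
  discrete Poincare inequality.\<close>

lemma norm_broken_l2_le:
  obtains P where "0 \<le> P" "\<And>w. w \<in> V \<Longrightarrow> norm (broken_l2 T w) \<le> P * dg_norm3 T \<mu> w"
proof -
  have "\<exists>y. y \<in> V \<and> (\<forall>w\<in>V. a_h T A \<mu> y w = w K (barycenter K))" for K
    using riesz_left[where l = "\<lambda>w. w K (barycenter K)"] by (simp add: Bex_def)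
  then obtain Y where Y: "\<And>K. Y K \<in> V" "\<And>K w. w \<in> V \<Longrightarrow> a_h T A \<mu> (Y K) w = w K (barycenter K)"
    by metis
  \<comment> \<open>\<open>Y K\<close> represents the barycenter value on \<open>K\<close>, so the
    first factor bounds that functional by the norm; the second is the size of the corresponding
    basis function.\<close>
  define P where "P = (\<Sum>K\<in>T. (\<bar>C\<bar> * dg_norm3 T \<mu> (Y K)) * norm (broken_l2 T (basis K)))"
  have "norm (broken_l2 T w) \<le> P * dg_norm3 T \<mu> w" if w: "w \<in> V" for w
  proof -
    have "norm (broken_l2 T w) = norm (\<Sum>K\<in>T. w K (barycenter K) *\<^sub>R broken_l2 T (basis K))"
      by (rule arg_cong[OF functional_expansion[OF broken_l2_linear w]])
    also have "\<dots> \<le> (\<Sum>K\<in>T. \<bar>w K (barycenter K)\<bar> * norm (broken_l2 T (basis K)))"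
      by (rule order_trans[OF norm_sum]) simp
    also have "\<dots> \<le> (\<Sum>K\<in>T. (\<bar>C\<bar> * dg_norm3 T \<mu> (Y K) * dg_norm3 T \<mu> w) * norm (broken_l2 T (basis K)))"
    proof (intro sum_mono mult_right_mono)
      fix K
      have "\<bar>w K (barycenter K)\<bar> \<le> C * dg_norm3 T \<mu> (Y K) * dg_norm3 T \<mu> w"
        using bounded[OF Y(1) w, of K] Y(2)[OF w] by simp
      also have "\<dots> \<le> \<bar>C\<bar> * dg_norm3 T \<mu> (Y K) * dg_norm3 T \<mu> w"
        by (intro mult_right_mono nonneg) simp
      finally show "\<bar>w K (barycenter K)\<bar> \<le> \<bar>C\<bar> * dg_norm3 T \<mu> (Y K) * dg_norm3 T \<mu> w" .
    qed simp
    also have "\<dots> = P * dg_norm3 T \<mu> w" by (simp add: P_def sum_distrib_left mult_ac)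
    finally show ?thesis .
  qed
  moreover have "0 \<le> P" unfolding P_def by (intro sum_nonneg mult_nonneg_nonneg nonneg) auto
  ultimately show ?thesis using that by blast
qed

lemma discrete_state_exists:
  assumes "continuous_on (frontier \<Omega>) \<phi>"
  shows "\<exists>y. discrete_state \<Omega> T A \<mu> V s \<phi> y"
proof -
  have "l_h \<Omega> T A \<mu> s \<phi> (\<lambda>K x. y K x + t * z K x) = l_h \<Omega> T A \<mu> s \<phi> y + t *\<^sub>R l_h \<Omega> T A \<mu> s \<phi> z"
    if "y \<in> V" "z \<in> V" for y z t
    using l_h_axpy[OF assms] V_C1 that by simp
  then show ?thesis
    using riesz_left[where l = "l_h \<Omega> T A \<mu> s \<phi>"] unfolding discrete_state_def by blast
qed

lemma discrete_adjoint_exists: "\<exists>p. discrete_adjoint \<Omega> T A \<mu> V s p"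
proof -
  have "l_h \<Omega> T A \<mu> s (\<lambda>x. 0) (\<lambda>K x. y K x + t * z K x)
      = l_h \<Omega> T A \<mu> s (\<lambda>x. 0) y + t *\<^sub>R l_h \<Omega> T A \<mu> s (\<lambda>x. 0) z"
    if "y \<in> V" "z \<in> V" for y z t
    using l_h_axpy[of "\<lambda>x. 0"] V_C1 that by simp
  then show ?thesis
    using riesz_right[where l = "l_h \<Omega> T A \<mu> s (\<lambda>x. 0)"] unfolding discrete_adjoint_def by blast
qed

lemma discrete_state_diff:
  assumes "discrete_state \<Omega> T A \<mu> V s \<phi> y" "discrete_state \<Omega> T A \<mu> V s' \<phi> y'" "w \<in> V"
  shows "a_h T A \<mu> (\<lambda>K x. y K x - y' K x) w = (s - s') \<bullet> broken_l2 T w"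
proof -
  have y: "y \<in> V" "y' \<in> V" using assms by (auto simp: discrete_state_def)
  have "a_h T A \<mu> (\<lambda>K x. y K x - y' K x) w = a_h T A \<mu> y w - a_h T A \<mu> y' w"
    using a_left[OF assms(3) y, of "- 1"] by simp
  then show ?thesis
    using assms l_h_eq_inner[of w \<mu> s \<phi>] l_h_eq_inner[of w \<mu> s' \<phi>] V_C1
    by (simp add: discrete_state_def inner_diff_left)
qed

lemma discrete_adjoint_diff:
  assumes "discrete_adjoint \<Omega> T A \<mu> V s p" "discrete_adjoint \<Omega> T A \<mu> V s' p'" "q \<in> V"
  shows "a_h T A \<mu> q (\<lambda>K x. p K x - p' K x) = (s - s') \<bullet> broken_l2 T q"
proof -
  have p: "p \<in> V" "p' \<in> V" using assms by (auto simp: discrete_adjoint_def)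
  have "a_h T A \<mu> q (\<lambda>K x. p K x - p' K x) = a_h T A \<mu> q p - a_h T A \<mu> q p'"
    using a_right[OF assms(3) p, of "- 1"] by simp
  then show ?thesis
    using assms l_h_eq_inner[of q \<mu> s "\<lambda>x. 0"] l_h_eq_inner[of q \<mu> s' "\<lambda>x. 0"] V_C1
    by (simp add: discrete_adjoint_def inner_diff_left)
qed

text \<open>Only the value of \<open>a_h\<close> at the pair of \<open>e\<close> with itself occurs,
  so the same bound serves the state and the adjoint error, each equation being tested with its own
  error.\<close>

lemma dg_norm3_le_of_energy:
  assumes P: "0 \<le> P" "\<And>w. w \<in> V \<Longrightarrow> norm (broken_l2 T w) \<le> P * dg_norm3 T \<mu> w"
    and e: "e \<in> V" "a_h T A \<mu> e e = s \<bullet> broken_l2 T e"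
  shows "dg_norm3 T \<mu> e \<le> (P / c) * norm s"
proof -
  have "c * (dg_norm3 T \<mu> e)\<^sup>2 \<le> s \<bullet> broken_l2 T e" using coercive[OF e(1)] e(2) by simp
  also have "\<dots> \<le> norm s * norm (broken_l2 T e)" by (rule norm_cauchy_schwarz)
  also have "\<dots> \<le> norm s * (P * dg_norm3 T \<mu> e)" using P(2)[OF e(1)] by (rule mult_left_mono) simp
  finally have *: "dg_norm3 T \<mu> e * (c * dg_norm3 T \<mu> e) \<le> dg_norm3 T \<mu> e * (P * norm s)"
    by (simp add: power2_eq_square mult_ac)
  show ?thesis
  proof (cases "dg_norm3 T \<mu> e = 0")
    case True
    then show ?thesis using P(1) c_pos by simp
  next
    case False
    then have "0 < dg_norm3 T \<mu> e" using nonneg[of e] by linarith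
    then have "c * dg_norm3 T \<mu> e \<le> P * norm s" using * by (simp add: mult_le_cancel_left)
    then show ?thesis using c_pos by (simp add: field_simps)
  qed
qed

end

subsection \<open>Projection onto the discrete admissible set and convergence\<close>

text \<open>Points of norm above \<open>R\<close> are farther from \<open>v\<close> than
  \<open>u\<close> is, so the search can be confined to \<open>D \<inter> Q\<close>, where
  \<open>Q\<close> is the compact image of a box of coefficients.\<close>

lemma closest_point_exists_span:
  fixes D :: "'a::real_inner set"
  assumes "finite S" "closed D" "u \<in> D \<inter> span S"
  shows "\<exists>p\<in>D \<inter> span S. \<forall>q\<in>D \<inter> span S. dist v p \<le> dist v q"
proof -
  obtain B where B: "finite B" "span B = span S" "pairwise orthogonal B"
    using basis_orthogonal[OF assms(1)] by blast
  define R where "R = norm v + dist v u"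
  \<comment> \<open>By Cauchy-Schwarz a vector of norm at most \<open>R\<close> has coefficient at
    most \<open>R / norm b\<close> along the orthogonal vector \<open>b\<close>. All other
    coefficients are pinned to \<open>0\<close>, so the box is a product of compact intervals over
    the whole type.\<close>
  define r where "r = (\<lambda>b :: 'a. if b \<in> B \<and> b \<noteq> 0 then R / norm b else 0)"
  define \<Phi> where "\<Phi> = (\<lambda>c :: 'a \<Rightarrow> real. \<Sum>b\<in>B. c b *\<^sub>R b)"
  define Q where "Q = \<Phi> ` (\<Pi>\<^sub>E b\<in>UNIV. {- r b..r b})"
  have "compactin (product_topology (\<lambda>b :: 'a. euclidean :: real topology) UNIV) (\<Pi>\<^sub>E b\<in>UNIV. {- r b..r b})"
    by (simp add: compactin_PiE)
  then have "compact (\<Pi>\<^sub>E b\<in>(UNIV :: 'a set). {- r b..r b})"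
    by (simp add: euclidean_product_topology)
  moreover have "continuous_on X \<Phi>" for X
    unfolding \<Phi>_def
    by (intro continuous_intros continuous_on_subset[OF continuous_on_product_coordinates]) auto
  ultimately have "compact Q" unfolding Q_def by (intro compact_continuous_image)
  have Q_span: "Q \<subseteq> span S"
    unfolding Q_def \<Phi>_def B(2)[symmetric] by (auto intro: span_sum span_scale span_base)
  have Q_mem: "x \<in> Q" if x: "x \<in> span S" "norm x \<le> R" for x
  proof -
    obtain k where k: "x = (\<Sum>b\<in>B. k b *\<^sub>R b)"
      using x(1) unfolding B(2)[symmetric] span_finite[OF B(1)] by auto
    define c where "c = (\<lambda>b. if b \<in> B \<and> b \<noteq> 0 then k b else 0)"
    have "\<bar>k b\<bar> \<le> R / norm b" if b: "b \<in> B" "b \<noteq> 0" for b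
    proof -
      have "x \<bullet> b = (\<Sum>b'\<in>B. k b' * (b' \<bullet> b))" by (simp add: k inner_sum_left)
      also have "\<dots> = (\<Sum>b'\<in>B. if b' = b then k b * (b \<bullet> b) else 0)"
        using B(3) b by (intro sum.cong) (auto simp: pairwise_def orthogonal_def)
      also have "\<dots> = k b * (norm b)\<^sup>2" using b B(1) by (simp add: power2_norm_eq_inner)
      finally have "\<bar>k b\<bar> * (norm b)\<^sup>2 = \<bar>x \<bullet> b\<bar>" by (simp add: abs_mult)
      also have "\<dots> \<le> R * norm b"
        using Cauchy_Schwarz_ineq2[of x b] x(2) by (meson mult_right_mono norm_ge_zero order_trans)
      finally show ?thesis using b by (simp add: field_simps power2_eq_square)
    qed
    then have "- (R / norm b) \<le> k b \<and> k b \<le> R / norm b" if "b \<in> B" "b \<noteq> 0" for b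
      using that by (simp add: abs_le_iff minus_le_iff)
    then have "c \<in> (\<Pi>\<^sub>E b\<in>UNIV. {- r b..r b})" by (auto simp: c_def r_def)
    moreover have "x = \<Phi> c" unfolding k \<Phi>_def by (intro sum.cong) (auto simp: c_def)
    ultimately show ?thesis by (auto simp: Q_def)
  qed
  have "norm u \<le> R"
    using norm_triangle_sub[of u v] by (simp add: R_def dist_norm norm_minus_commute)
  then have "u \<in> D \<inter> Q" using assms(3) Q_mem by auto
  moreover have "compact (D \<inter> Q)" using assms(2) \<open>compact Q\<close> by (rule closed_Int_compact)
  moreover have "continuous_on (D \<inter> Q) (dist v)" by (intro continuous_intros)
  ultimately obtain p where p: "p \<in> D \<inter> Q" "\<And>q. q \<in> D \<inter> Q \<Longrightarrow> dist v p \<le> dist v q"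
    using continuous_attains_inf[of "D \<inter> Q" "dist v"] by blast
  have "dist v p \<le> dist v q" if q: "q \<in> D \<inter> span S" for q
  proof (cases "norm q \<le> R")
    case True
    then show ?thesis using q Q_mem p(2) by auto
  next
    case False
    then have "dist v u \<le> dist v q"
      using norm_triangle_sub[of q v] by (simp add: R_def dist_norm norm_minus_commute)
    then show ?thesis using p(2)[OF \<open>u \<in> D \<inter> Q\<close>] by simp
  qed
  then show ?thesis using p(1) Q_span by blast
qed

text \<open>The generators are the classes of the indicators of the element interiors. The span
  places \<open>Uadh\<close> in finite dimension, where nearest points exist.\<close>

lemma piecewise_constants_eq_span:
  assumes "finite T" "\<And>K. K \<in> T \<Longrightarrow> compact K"
  obtains S where "finite S" "piecewise_constants T = span S"
proof -
  define ind where "ind = (\<lambda>K. broken_l2 T (\<lambda>K' x. if K' = K then 1 else 0))"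
  define S where "S = ind ` T"
  define W :: "'a broken set" where "W = {w. \<forall>K. continuous_on UNIV (w K)}"
  have cont: "continuous_on X (w K)" if "w \<in> W" for X K w
    using that by (auto simp: W_def intro: continuous_on_subset)
  have lin: "broken_l2 T (\<lambda>K x. y K x + t * z K x) = broken_l2 T y + t *\<^sub>R broken_l2 T z"
    if "y \<in> W" "z \<in> W" for y z t
    using assms(2) cont that by (intro broken_l2_axpy) auto
  have expand: "broken_l2 T (\<lambda>K x. c K) = (\<Sum>K\<in>T. c K *\<^sub>R ind K)" for c
  proof -
    have "(\<Sum>K'\<in>T. c K' * (if K = K' then 1 else 0)) = c K" if "K \<in> T" for K
      using assms(1) that by (simp add: if_distrib cong: if_cong)
    then have "broken_l2 T (\<lambda>K x. c K) = broken_l2 T (\<lambda>K x. \<Sum>K'\<in>T. c K' * (if K = K' then 1 else 0))"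
      unfolding broken_l2_def by (intro arg_cong[where f = abs_l2] ext sum.cong) simp_all
    also have "\<dots> = (\<Sum>K\<in>T. c K *\<^sub>R ind K)"
      unfolding ind_def
      by (rule linear_on_broken_sum(2)[where V = W and e = "\<lambda>K K' x. if K' = K then 1 else 0"])
         (use lin assms(1) in \<open>auto simp: W_def intro!: continuous_intros\<close>)
    finally show ?thesis .
  qed
  have "finite S" using assms(1) by (simp add: S_def)
  moreover have "piecewise_constants T = span S"
  proof
    have "ind K \<in> span S" if "K \<in> T" for K
      using that by (auto simp: S_def intro: span_base)
    then show "piecewise_constants T \<subseteq> span S"
      unfolding piecewise_constants_def by (auto simp: expand intro!: span_sum span_scale)
    have "subspace (piecewise_constants T)"
    proof (rule subspaceI)
      show "0 \<in> piecewise_constants T"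
        using expand[of "\<lambda>K. 0"] by (force simp: piecewise_constants_def)
      fix x y r assume "x \<in> piecewise_constants T"
      then obtain c where c: "x = broken_l2 T (\<lambda>K x. c K)" by (auto simp: piecewise_constants_def)
      then have "r *\<^sub>R x = broken_l2 T (\<lambda>K x. r * c K)"
        by (simp add: expand scaleR_sum_right)
      then show "r *\<^sub>R x \<in> piecewise_constants T" by (auto simp: piecewise_constants_def)
      assume "y \<in> piecewise_constants T"
      then obtain d where d: "y = broken_l2 T (\<lambda>K x. d K)" by (auto simp: piecewise_constants_def)
      have "x + y = broken_l2 T (\<lambda>K x. c K + d K)"
        by (simp add: c d expand sum.distrib scaleR_add_left)
      then show "x + y \<in> piecewise_constants T" by (auto simp: piecewise_constants_def)
    qed
    moreover have "S \<subseteq> piecewise_constants T"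
    proof
      fix s assume "s \<in> S"
      then obtain K where "s = broken_l2 T (\<lambda>K' x. if K' = K then 1 else 0)" by (auto simp: S_def ind_def)
      then show "s \<in> piecewise_constants T"
        unfolding piecewise_constants_def by (intro CollectI exI[of _ "\<lambda>K'. if K' = K then 1 else 0"]) simp
    qed
    ultimately show "span S \<subseteq> piecewise_constants T" by (rule span_minimal[rotated])
  qed
  ultimately show ?thesis using that by blast
qed

section \<open>Bounds for the control operator and its adjoint, and convergence of the
  iteration\<close>

lemma bounded_linear_between_lipschitz:
  assumes B: "bounded_linear_between (L2_on \<Omega>) Y B"
  obtains C where "0 \<le> C" "\<And>u. u \<in> L2_on \<Omega> \<Longrightarrow> norm (B u) \<le> C * norm u"
    "\<And>u v. u \<in> L2_on \<Omega> \<Longrightarrow> v \<in> L2_on \<Omega> \<Longrightarrow> B (u - v) = B u - B v"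
proof -
  obtain C where C: "\<And>u. u \<in> L2_on \<Omega> \<Longrightarrow> norm (B u) \<le> C * norm u"
    using B unfolding bounded_linear_between_def by blast
  have "norm (B u) \<le> \<bar>C\<bar> * norm u" if "u \<in> L2_on \<Omega>" for u
    using C[OF that] by (rule order_trans) (simp add: mult_right_mono)
  moreover have "B (u - v) = B u - B v" if "u \<in> L2_on \<Omega>" "v \<in> L2_on \<Omega>" for u v
  proof -
    have "B ((u - v) + v) = B (u - v) + B v"
      using B that L2_on_diff[OF that] unfolding bounded_linear_between_def by blast
    then show ?thesis by simp
  qed
  ultimately show ?thesis using that[of "\<bar>C\<bar>"] by simp
qed

text \<open>About \<open>Bs\<close> only the adjoint relation is given, so the bounds concern
  differences \<open>Bs q - Bs q'\<close>. They come from testing the relation with this difference,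
  which lies in the space where \<open>B\<close> is bounded.\<close>

lemma adjoint_between_bound:
  assumes adj: "adjoint_between (L2_on \<Omega>') (L2_on \<Omega>) B Bs"
    and C: "0 \<le> C" "\<And>u. u \<in> L2_on \<Omega>' \<Longrightarrow> norm (B u) \<le> C * norm u"
    and q: "q \<in> L2_on \<Omega>" "q' \<in> L2_on \<Omega>"
  shows "norm (Bs q - Bs q') \<le> C * norm (q - q')"
    and "u \<in> L2_on \<Omega>' \<Longrightarrow> (Bs q - Bs q') \<bullet> u = B u \<bullet> (q - q')"
proof -
  have eq: "(Bs q - Bs q') \<bullet> u = B u \<bullet> (q - q')" if "u \<in> L2_on \<Omega>'" for u
    using adj q that unfolding adjoint_between_def
    by (simp add: inner_diff_left inner_diff_right inner_commute)
  then show "u \<in> L2_on \<Omega>' \<Longrightarrow> (Bs q - Bs q') \<bullet> u = B u \<bullet> (q - q')" .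
  define d where "d = Bs q - Bs q'"
  have "d \<in> L2_on \<Omega>'"
    unfolding d_def using adj q by (intro L2_on_diff) (auto simp: adjoint_between_def)
  have "norm d * norm d = B d \<bullet> (q - q')"
    using eq[OF \<open>d \<in> L2_on \<Omega>'\<close>] by (simp add: d_def power2_norm_eq_inner[symmetric] power2_eq_square)
  also have "\<dots> \<le> norm (B d) * norm (q - q')" by (rule norm_cauchy_schwarz)
  also have "\<dots> \<le> (C * norm d) * norm (q - q')"
    using C(2)[OF \<open>d \<in> L2_on \<Omega>'\<close>] by (rule mult_right_mono) simp
  finally have *: "norm d * norm d \<le> norm d * (C * norm (q - q'))" by (simp add: mult_ac)
  show "norm (Bs q - Bs q') \<le> C * norm (q - q')"
  proof (cases "d = 0")
    case True
    then show ?thesis using C(1) by (simp add: d_def)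
  next
    case False
    then show ?thesis using * by (simp add: d_def mult_le_cancel_left)
  qed
qed

text \<open>The step sizes are chosen before the sequences, and the existence of a run is asserted
  beside the estimate, which would otherwise be vacuous if no run existed.\<close>

theorem lemma2:
  fixes \<Omega> \<Omega>u :: "(real^'n::finite) set"
    and A :: "real^'n \<Rightarrow> real^'n^'n" and \<kappa> \<Lambda> :: real
    and f :: "(real^'n) l2" and \<phi> :: "real^'n \<Rightarrow> real"
    and B Bs :: "(real^'n) l2 \<Rightarrow> (real^'n) l2"
    and g j :: "(real^'n) l2 \<Rightarrow> real"
    and Dg Dj :: "(real^'n) l2 \<Rightarrow> (real^'n) l2 \<Rightarrow>\<^sub>L real"
    and dg dj :: "(real^'n) l2 \<Rightarrow> (real^'n) l2"
    and Uad Uadh :: "(real^'n) l2 set" and \<alpha> \<beta> L :: real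
    and T Tu :: "(real^'n) set set" and \<sigma> h \<sigma>u hu \<mu> :: real and m N :: nat
    and V :: "'n broken set"
    and uh u0 :: "(real^'n) l2" and yh ph :: "'n broken"
  assumes dim: "CARD('n) \<in> {2, 3}"
    and domains: "convex_polyhedral_domain \<Omega>" "convex_polyhedral_domain \<Omega>u"
    and Uad: "Uad \<subseteq> L2_on \<Omega>u" "closed Uad" "convex Uad"
    and A_reg: "\<And>i k. W1inf \<Omega> (\<lambda>x. A x $ i $ k)" "continuous_on (closure \<Omega>) A"
    and A_sym: "\<And>x. x \<in> \<Omega> \<Longrightarrow> transpose (A x) = A x"
    and A_ell: "0 < \<kappa>" "\<kappa> < \<Lambda>"
      "\<And>x \<xi>. x \<in> \<Omega> \<Longrightarrow> \<kappa> * (norm \<xi>)\<^sup>2 \<le> \<xi> \<bullet> (A x *v \<xi>) \<and> \<xi> \<bullet> (A x *v \<xi>) \<le> \<Lambda> * (norm \<xi>)\<^sup>2"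
    and f: "f \<in> L2_on \<Omega>"
    and \<phi>: "H32_boundary \<Omega> \<phi>"
    and B: "bounded_linear_between (L2_on \<Omega>u) (L2_on \<Omega>) B"
      "adjoint_between (L2_on \<Omega>u) (L2_on \<Omega>) B Bs"
    and g: "convex_on (L2_on \<Omega>) g" "continuously_frechet_differentiable (L2_on \<Omega>) g Dg"
    and j: "convex_on (L2_on \<Omega>u) j" "continuously_frechet_differentiable (L2_on \<Omega>u) j Dj"
    and integral: "integral_form \<Omega> g Dg dg" "integral_form \<Omega>u j Dj dj"
    and pos: "0 < \<alpha>" "0 < \<beta>" "0 < L"
    and j_mono: "\<And>u v. u \<in> Uad \<Longrightarrow> v \<in> Uad \<Longrightarrow> \<alpha> * (norm (u - v))\<^sup>2 \<le> (dj u - dj v) \<bullet> (u - v)"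
    and g_mono: "\<And>y z. y \<in> L2_on \<Omega> \<Longrightarrow> z \<in> L2_on \<Omega> \<Longrightarrow>
        \<beta> * (norm (y - z))\<^sup>2 \<le> (dg y - dg z) \<bullet> (y - z)"
    and j_lip: "\<And>u v. u \<in> Uad \<Longrightarrow> v \<in> Uad \<Longrightarrow> norm (dj u - dj v) \<le> L * norm (u - v)"
    and g_lip: "\<And>y z. y \<in> L2_on \<Omega> \<Longrightarrow> z \<in> L2_on \<Omega> \<Longrightarrow> norm (dg y - dg z) \<le> L * norm (y - z)"
    and mesh: "simplicial_mesh \<Omega> T" "quasi_uniform \<sigma> T h"
    and mesh_u: "polytopal_mesh \<Omega>u Tu" "quasi_uniform \<sigma>u Tu hu"
    and V: "1 \<le> m" "reconstruction_well_defined T N m" "V = reconstructed_space T N m"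
    and penalty: "0 < \<mu>" "bounded_and_coercive V (a_h T A \<mu>) (dg_norm3 T \<mu>)"
    and Uadh: "Uadh = Uad \<inter> piecewise_constants Tu"
    and solution: "uh \<in> Uadh"
      "discrete_state \<Omega> T A \<mu> V (f + B uh) \<phi> yh"
      "discrete_adjoint \<Omega> T A \<mu> V (dg (broken_l2 T yh)) ph"
      "\<And>v. v \<in> Uadh \<Longrightarrow> (dj uh + Bs (broken_l2 T ph)) \<bullet> (v - uh) \<ge> 0"
    and initial: "u0 \<in> Uadh"
  shows "\<exists>\<rho>. (\<forall>n. 0 < \<rho> n) \<and>
    (\<exists>u y p. projected_gradient \<Omega> T A \<mu> V f \<phi> B Bs dg dj Uadh \<rho> u0 u y p) \<and>
    (\<forall>u y p. projected_gradient \<Omega> T A \<mu> V f \<phi> B Bs dg dj Uadh \<rho> u0 u y p \<longrightarrow>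
      (\<exists>\<eta>. 0 < \<eta> \<and> \<eta> < 1 \<and> (\<exists>lam>0. \<forall>n.
        norm (u n - uh) + lam * dg_norm3 T \<mu> (\<lambda>K x. y n K x - yh K x)
          + lam * dg_norm3 T \<mu> (\<lambda>K x. p n K x - ph K x)
        \<le> \<eta> ^ n * (norm (u 0 - uh) + lam * dg_norm3 T \<mu> (\<lambda>K x. y 0 K x - yh K x)
          + lam * dg_norm3 T \<mu> (\<lambda>K x. p 0 K x - ph K x)))) \<and>
      u \<longlonglongrightarrow> uh \<and>
      (\<lambda>n. dg_norm3 T \<mu> (\<lambda>K x. y n K x - yh K x)) \<longlonglongrightarrow> 0 \<and>
      (\<lambda>n. dg_norm3 T \<mu> (\<lambda>K x. p n K x - ph K x)) \<longlonglongrightarrow> 0)"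
proof -
  have n2: "2 \<le> CARD('n)" using dim by auto
  interpret dg_setting \<Omega> T A
    using domains(1) mesh(1) A_reg(2) by unfold_locales
  obtain C c where Cc: "\<And>y w. y \<in> V \<Longrightarrow> w \<in> V \<Longrightarrow> \<bar>a_h T A \<mu> y w\<bar> \<le> C * dg_norm3 T \<mu> y * dg_norm3 T \<mu> w"
    "0 < c" "\<And>w. w \<in> V \<Longrightarrow> c * (dg_norm3 T \<mu> w)\<^sup>2 \<le> a_h T A \<mu> w w"
    using penalty(2) unfolding bounded_and_coercive_def by blast
  interpret dg_discrete \<Omega> T A N m \<mu> V C c
    using n2 penalty(1) V Cc by unfold_locales
  have \<phi>_cont: "continuous_on (frontier \<Omega>) \<phi>"
  proof -
    obtain G where G: "continuous_on (closure \<Omega>) G" "\<forall>x\<in>frontier \<Omega>. \<phi> x = G x"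
      using \<phi> by (auto simp: H32_boundary_def)
    have "continuous_on (frontier \<Omega>) G"
      using G(1) by (rule continuous_on_subset) (auto simp: frontier_def)
    then show ?thesis using G(2) by (simp cong: continuous_on_cong)
  qed
  obtain P where P: "0 \<le> P" "\<And>w. w \<in> V \<Longrightarrow> norm (broken_l2 T w) \<le> P * dg_norm3 T \<mu> w"
    by (rule norm_broken_l2_le) blast
  obtain CB where CB: "0 \<le> CB" "\<And>u. u \<in> L2_on \<Omega>u \<Longrightarrow> norm (B u) \<le> CB * norm u"
    "\<And>u v. u \<in> L2_on \<Omega>u \<Longrightarrow> v \<in> L2_on \<Omega>u \<Longrightarrow> B (u - v) = B u - B v"
    by (rule bounded_linear_between_lipschitz[OF B(1)]) blast
  obtain S where S: "finite S" "piecewise_constants Tu = span S"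
    by (rule piecewise_constants_eq_span[of Tu])
       (use mesh_u(1) in \<open>auto simp: polytopal_mesh_def polytope_imp_compact\<close>)
  have Uadh_Uad: "u \<in> Uad" "u \<in> L2_on \<Omega>u" if "u \<in> Uadh" for u
    using that Uad(1) by (auto simp: Uadh)
  have convex: "convex Uadh"
    unfolding Uadh S(2) by (rule convex_Int[OF Uad(3) subspace_imp_convex[OF subspace_span]])
  have closest: "\<exists>p\<in>Uadh. \<forall>q\<in>Uadh. dist v p \<le> dist v q" for v
    using closest_point_exists_span[OF S(1) Uad(2), of uh v] solution(1) by (simp add: Uadh S(2))
  let ?N = "dg_norm3 T \<mu>"
  \<comment> \<open>The chain of stability constants: \<open>Cy\<close> leads from the control error
    through \<open>B\<close> to the state error, \<open>Cp\<close> further through the Lipschitz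
    constant of \<open>dg\<close> to the adjoint error. In \<open>M\<close> the part
    \<open>L + CB * (P * Cp)\<close> is the Lipschitz constant of the reduced gradient; the summand
    \<alpha> makes \<open>\<alpha> < M\<close> strict, so that the radicand in \<theta> lies
    strictly between 0 and 1.\<close>
  define Cy where "Cy = P / c * CB"
  define Cp where "Cp = P / c * (L * (P * Cy))"
  define M where "M = \<alpha> + L + CB * (P * Cp)"
  have nonneg_const: "0 \<le> Cy" "0 \<le> Cp" using P(1) CB(1) Cc(2) pos by (auto simp: Cy_def Cp_def)
  have M: "\<alpha> < M" using nonneg_const P(1) CB(1) pos by (simp add: M_def add_pos_nonneg)
  \<comment> \<open>Stated for a single control with its state and adjoint, so that it applies to
    each iterate separately.\<close>
  have est: "?N (\<lambda>K x. y K x - yh K x) \<le> Cy * norm (u - uh) \<and>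
      ?N (\<lambda>K x. p K x - ph K x) \<le> Cp * norm (u - uh) \<and>
      \<alpha> * (norm (u - uh))\<^sup>2 \<le> (dj u + Bs (broken_l2 T p) - (dj uh + Bs (broken_l2 T ph))) \<bullet> (u - uh) \<and>
      norm (dj u + Bs (broken_l2 T p) - (dj uh + Bs (broken_l2 T ph))) \<le> M * norm (u - uh)"
    if u: "u \<in> Uadh" and y: "discrete_state \<Omega> T A \<mu> V (f + B u) \<phi> y"
      and p: "discrete_adjoint \<Omega> T A \<mu> V (dg (broken_l2 T y)) p" for u y p
  proof -
    define ey ep where "ey = (\<lambda>K x. y K x - yh K x)" and "ep = (\<lambda>K x. p K x - ph K x)"
    have mem: "y \<in> V" "yh \<in> V" "p \<in> V" "ph \<in> V"
      using y p solution by (auto simp: discrete_state_def discrete_adjoint_def)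
    then have e: "ey \<in> V" "ep \<in> V" unfolding ey_def ep_def by (auto intro: V_diff)
    have by_eq: "broken_l2 T ey = broken_l2 T y - broken_l2 T yh"
      and bp_eq: "broken_l2 T ep = broken_l2 T p - broken_l2 T ph"
      using mem unfolding ey_def ep_def by (auto intro: broken_l2_diff)
    note bm = mem[THEN broken_l2_mem]
    note ul = Uadh_Uad[OF u] Uadh_Uad[OF solution(1)]
    have eul: "u - uh \<in> L2_on \<Omega>u" using ul by (intro L2_on_diff)
    define d where "d = dg (broken_l2 T y) - dg (broken_l2 T yh)"
    have state: "a_h T A \<mu> ey w = B (u - uh) \<bullet> broken_l2 T w" if "w \<in> V" for w
      using discrete_state_diff[OF y solution(2) that] CB(3)[OF ul(2,4)] by (simp add: ey_def)
    have adj: "a_h T A \<mu> q ep = d \<bullet> broken_l2 T q" if "q \<in> V" for q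
      using discrete_adjoint_diff[OF p solution(3) that] by (simp add: ep_def d_def)
    have "?N ey \<le> P / c * norm (B (u - uh))" by (rule dg_norm3_le_of_energy[OF P e(1) state[OF e(1)]])
    also have "\<dots> \<le> P / c * (CB * norm (u - uh))"
      using P(1) Cc(2) CB(2)[OF eul] by (intro mult_left_mono) auto
    finally have y_est: "?N ey \<le> Cy * norm (u - uh)" by (simp add: Cy_def)
    have "?N ep \<le> P / c * norm d" by (rule dg_norm3_le_of_energy[OF P e(2) adj[OF e(2)]])
    also have "\<dots> \<le> P / c * (L * (P * (Cy * norm (u - uh))))"
    proof (intro mult_left_mono)
      have "norm d \<le> L * norm (broken_l2 T ey)" unfolding d_def by_eq by (rule g_lip[OF bm(1,2)])
      also have "\<dots> \<le> L * (P * ?N ey)" using P(2)[OF e(1)] pos(3) by (intro mult_left_mono) auto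
      also have "\<dots> \<le> L * (P * (Cy * norm (u - uh)))"
        using y_est P(1) pos(3) by (intro mult_left_mono) auto
      finally show "norm d \<le> L * (P * (Cy * norm (u - uh)))" .
    qed (use P(1) Cc(2) in auto)
    finally have p_est: "?N ep \<le> Cp * norm (u - uh)" by (simp add: Cp_def mult_ac)
    have split: "dj u + Bs (broken_l2 T p) - (dj uh + Bs (broken_l2 T ph))
        = (dj u - dj uh) + (Bs (broken_l2 T p) - Bs (broken_l2 T ph))" by simp
    have "(Bs (broken_l2 T p) - Bs (broken_l2 T ph)) \<bullet> (u - uh) = B (u - uh) \<bullet> broken_l2 T ep"
      unfolding bp_eq by (rule adjoint_between_bound(2)[OF B(2) CB(1,2) bm(3,4) eul])
    also have "\<dots> = d \<bullet> broken_l2 T ey" using state[OF e(2)] adj[OF e(1)] by simp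
    finally have "(Bs (broken_l2 T p) - Bs (broken_l2 T ph)) \<bullet> (u - uh) = d \<bullet> broken_l2 T ey" .
    moreover have "0 \<le> d \<bullet> broken_l2 T ey"
      unfolding d_def by_eq using g_mono[OF bm(1,2)] pos(2) by (smt (verit) mult_nonneg_nonneg zero_le_power2)
    ultimately have mono: "\<alpha> * (norm (u - uh))\<^sup>2
        \<le> (dj u + Bs (broken_l2 T p) - (dj uh + Bs (broken_l2 T ph))) \<bullet> (u - uh)"
      unfolding split inner_add_left using j_mono[OF ul(1,3)] by linarith
    have "norm (Bs (broken_l2 T p) - Bs (broken_l2 T ph)) \<le> CB * norm (broken_l2 T ep)"
      unfolding bp_eq by (rule adjoint_between_bound(1)[OF B(2) CB(1,2) bm(3,4)])
    also have "\<dots> \<le> CB * (P * ?N ep)" using P(2)[OF e(2)] CB(1) by (rule mult_left_mono)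
    also have "\<dots> \<le> CB * (P * (Cp * norm (u - uh)))"
      using p_est P(1) CB(1) by (intro mult_left_mono) auto
    finally have "norm (dj u + Bs (broken_l2 T p) - (dj uh + Bs (broken_l2 T ph)))
        \<le> L * norm (u - uh) + CB * (P * (Cp * norm (u - uh)))"
      unfolding split using j_lip[OF ul(1,3)] by (meson add_mono norm_triangle_le)
    also have "\<dots> \<le> M * norm (u - uh)" using pos(1) by (simp add: M_def algebra_simps)
    finally show ?thesis using y_est p_est mono unfolding ey_def ep_def by blast
  qed
  define \<rho> where "\<rho> = (\<lambda>n :: nat. \<alpha> / M\<^sup>2)"
  define \<theta> where "\<theta> = sqrt (1 - \<alpha>\<^sup>2 / M\<^sup>2)"
  have "\<alpha>\<^sup>2 < M\<^sup>2" using M pos(1) by (intro power_strict_mono) auto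
  then have \<theta>: "0 \<le> \<theta>" "\<theta> < 1" using M pos(1) by (auto simp: \<theta>_def)
  have \<rho>_pos: "0 < \<rho> n" for n using M pos(1) by (simp add: \<rho>_def)
  have ex: "\<exists>u y p. projected_gradient \<Omega> T A \<mu> V f \<phi> B Bs dg dj Uadh \<rho> u0 u y p"
  proof -
    \<comment> \<open>Choosing a state and an adjoint for every control turns the iteration into a
      recursion for the controls alone.\<close>
    have "\<exists>Y. \<forall>u. discrete_state \<Omega> T A \<mu> V (f + B u) \<phi> (Y u)"
      by (intro choice allI discrete_state_exists[OF \<phi>_cont])
    then obtain Y where Y: "\<And>u. discrete_state \<Omega> T A \<mu> V (f + B u) \<phi> (Y u)" by blast
    have "\<exists>Z. \<forall>u. discrete_adjoint \<Omega> T A \<mu> V (dg (broken_l2 T (Y u))) (Z u)"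
      by (intro choice allI discrete_adjoint_exists)
    then obtain Z where Z: "\<And>u. discrete_adjoint \<Omega> T A \<mu> V (dg (broken_l2 T (Y u))) (Z u)" by blast
    define u where "u = rec_nat u0 (\<lambda>n u. projection Uadh (u - \<rho> n *\<^sub>R (dj u + Bs (broken_l2 T (Z u)))))"
    have "projected_gradient \<Omega> T A \<mu> V f \<phi> B Bs dg dj Uadh \<rho> u0 u (\<lambda>n. Y (u n)) (\<lambda>n. Z (u n))"
      unfolding projected_gradient_def using Y Z by (simp add: u_def)
    then show ?thesis by blast
  qed
  have conv: "(\<exists>\<eta>. 0 < \<eta> \<and> \<eta> < 1 \<and> (\<exists>lam>0. \<forall>n.
        norm (u n - uh) + lam * ?N (\<lambda>K x. y n K x - yh K x) + lam * ?N (\<lambda>K x. p n K x - ph K x)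
        \<le> \<eta> ^ n * (norm (u 0 - uh) + lam * ?N (\<lambda>K x. y 0 K x - yh K x)
          + lam * ?N (\<lambda>K x. p 0 K x - ph K x)))) \<and>
      u \<longlonglongrightarrow> uh \<and>
      (\<lambda>n. ?N (\<lambda>K x. y n K x - yh K x)) \<longlonglongrightarrow> 0 \<and>
      (\<lambda>n. ?N (\<lambda>K x. p n K x - ph K x)) \<longlonglongrightarrow> 0"
    if pg: "projected_gradient \<Omega> T A \<mu> V f \<phi> B Bs dg dj Uadh \<rho> u0 u y p" for u y p
  proof -
    have u0: "u 0 = u0" and y: "\<And>n. discrete_state \<Omega> T A \<mu> V (f + B (u n)) \<phi> (y n)"
      and p: "\<And>n. discrete_adjoint \<Omega> T A \<mu> V (dg (broken_l2 T (y n))) (p n)"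
      and step: "\<And>n. u (Suc n) = projection Uadh (u n - \<rho> n *\<^sub>R (dj (u n) + Bs (broken_l2 T (p n))))"
      using pg by (auto simp: projected_gradient_def)
    have u: "u n \<in> Uadh" for n
    proof (cases n)
      case 0
      then show ?thesis using u0 initial by simp
    next
      case (Suc k)
      then show ?thesis using step[of k] projection_mem_inner_le(1)[OF convex closest] by simp
    qed
    note E = est[OF u y p]
    define e where "e = (\<lambda>n. norm (u n - uh))"
    define Ey Ep where "Ey = (\<lambda>n. ?N (\<lambda>K x. y n K x - yh K x))" and "Ep = (\<lambda>n. ?N (\<lambda>K x. p n K x - ph K x))"
    have nn: "0 \<le> e n" "0 \<le> Ey n" "0 \<le> Ep n" for n by (simp_all add: e_def Ey_def Ep_def nonneg)
    have contr: "e (Suc n) \<le> \<theta> * e n" for n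
      unfolding e_def step \<theta>_def
      by (rule projected_gradient_step_contraction[OF convex closest solution(1) solution(4)])
         (use E[of n] pos(1) M in \<open>auto simp: \<rho>_def\<close>)
    \<comment> \<open>Both errors carry the same weight \<open>lam\<close>, so their sum plays the
      part of \<open>E\<close> in the decay estimate.\<close>
    have bd: "Ey n + Ep n \<le> (Cy + Cp) * e n" for n
      using E[of n] by (simp add: e_def Ey_def Ep_def distrib_right)
    obtain \<eta> lam where \<eta>: "0 < \<eta>" "\<eta> < 1" "0 < lam"
      "\<And>n. e n + lam * (Ey n + Ep n) \<le> \<eta> ^ n * (e 0 + lam * (Ey 0 + Ep 0))"
      by (rule geometric_decay_weighted[of \<theta> "Cy + Cp" e "\<lambda>n. Ey n + Ep n"])
         (use \<theta> nonneg_const nn contr bd in auto)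
    have decay: "\<forall>n. e n + lam * Ey n + lam * Ep n \<le> \<eta> ^ n * (e 0 + lam * Ey 0 + lam * Ep 0)"
      using \<eta>(4) by (simp add: distrib_left add.assoc)
    have lim: "(\<lambda>n. \<eta> ^ n * K) \<longlonglongrightarrow> 0" for K
      using LIMSEQ_realpow_zero[of \<eta>] \<eta> by (intro tendsto_mult_left_zero) auto
    have "e \<longlonglongrightarrow> 0"
    proof (rule tendsto_sandwich[OF _ _ tendsto_const lim])
      show "eventually (\<lambda>n. e n \<le> \<eta> ^ n * (e 0 + lam * (Ey 0 + Ep 0))) sequentially"
        using \<eta>(3,4) nn by (intro always_eventually allI) (smt (verit) mult_nonneg_nonneg)
    qed (use nn in auto)
    then have ulim: "u \<longlonglongrightarrow> uh" unfolding e_def by (simp add: tendsto_norm_zero_iff LIM_zero_iff)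
    have Esum: "(\<lambda>n. (Cy + Cp) * e n) \<longlonglongrightarrow> 0" using tendsto_mult_right_zero[OF \<open>e \<longlonglongrightarrow> 0\<close>] .
    have Eb: "Ey n \<le> (Cy + Cp) * e n" "Ep n \<le> (Cy + Cp) * e n" for n
      using nn(2,3)[of n] bd[of n] by linarith+
    have Eylim: "Ey \<longlonglongrightarrow> 0"
      by (rule tendsto_sandwich[OF _ _ tendsto_const Esum])
         (use nn Eb in \<open>auto intro!: always_eventually\<close>)
    have Eplim: "Ep \<longlonglongrightarrow> 0"
      by (rule tendsto_sandwich[OF _ _ tendsto_const Esum])
         (use nn Eb in \<open>auto intro!: always_eventually\<close>)
    show ?thesis
      using \<eta>(1-3) decay[unfolded e_def Ey_def Ep_def] ulim Eylim[unfolded Ey_def] Eplim[unfolded Ep_def]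
      by (intro conjI exI[of _ \<eta>] exI[of _ lam])
  qed
  show ?thesis using \<rho>_pos ex conv by blast
qed

end
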